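(* Let $\alpha,\beta\ge -\frac12$, $\mu=\max(\alpha,\beta)$, and let $n>N\ge 2$ be integers satisfying $$0.63\, n > m_{\alpha,\beta}^2\,(N+1)^{2\mu+2}\log(N+1).$$ Let $X_1,\dots,X_n$ be i.i.d. random variables with the Beta $B(\alpha+1,\beta+1)$ distribution on $I=[-1,1]$, and let $$A_N=\Big[\frac1n\sum_{j=1}^n \widetilde P^{(\alpha,\beta)}_{k-1}(X_j)\,\widetilde P^{(\alpha,\beta)}_{l-1}(X_j)\Big]_{1\le k,l\le N+1}.$$ Then for any $0<\delta<1$, with probability at least $(1-\delta)^2$, $$\kappa_2(A_N)\le \frac{1.72+m_{\alpha,\beta}^2 (N+1)^{2\mu+2}\Big(\frac{\log(N+1)}{n}+\sqrt{\frac{2}{n}\log\big(\frac{2}{\delta}\big)}\Big)}{0.63-m_{\alpha,\beta}^2 (N+1)^{2\mu+2}\Big(\frac{\log(N+1)}{n}+\sqrt{\frac{2}{n}\log\big(\frac{2}{\delta}\big)}\Big)}.$$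
   Context: $I=[-1,1]$, $\omega_{\alpha,\beta}(x)=(1-x)^\alpha(1+x)^\beta$. The Jacobi polynomials are $P_k^{(\alpha,\beta)}(x)=\frac{(-1)^k}{2^k k!}\frac{1}{\omega_{\alpha,\beta}(x)}\frac{d^k}{dx^k}\big(\omega_{\alpha,\beta}(x)(1-x^2)^k\big)$, and the normalized Jacobi polynomials are $\widetilde P^{(\alpha,\beta)}_k=P^{(\alpha,\beta)}_k/\sqrt{h_k^{\alpha,\beta}}$ with $h_k^{\alpha,\beta}=\frac{2^{\alpha+\beta+1}\Gamma(k+\alpha+1)\Gamma(k+\beta+1)}{k!(2k+\alpha+\beta+1)\Gamma(k+\alpha+\beta+1)}$, so that $\int_{-1}^1 (\widetilde P^{(\alpha,\beta)}_k)^2\omega_{\alpha,\beta}\,dx=1$. The Beta $B(\alpha+1,\beta+1)$ distribution on $I$ has density $\omega_{\alpha,\beta}(x)/\gamma_{\alpha,\beta}$ on $I$, with $\gamma_{\alpha,\beta}=2^{\alpha+\beta+1}B(\alpha+1,\beta+1)$, where $B(\cdot,\cdot)$ is the Beta function. Constants: $c_{\alpha,\beta}=\frac{\alpha+\beta+1}{2}$, $\ \eta_{\alpha,\beta}=\frac{\exp\big(\frac{2\max(\mu,0)}{12}+\frac{\max(\mu^2+\alpha\beta,0)}{8}\big)}{2^{(\alpha+\beta)/2}\Gamma(\mu+1)}$, $\ m_{\alpha,\beta}^2=\frac{1+\frac12\sqrt{c_{\alpha,\beta}/2}}{\mu+3/2}\,\eta_{\alpha,\beta}^2$. $\kappa_2(A)$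 is the $2$-norm condition number; for a positive definite matrix $\kappa_2(A)=\lambda_{\max}(A)/\lambda_{\min}(A)$ (and $+\infty$ for a singular matrix).
   Formalization: The formal theorem additionally assumes that the denominator 0.63 − m²(N+1)^{2μ+2}(log(N+1)/n + √((2/n)log(2/δ))) is positive; otherwise the right-hand side is negative or undefined while κ₂ ≥ 1, so the claim fails (e.g. α=β=0, N=2, n=14, δ=1/2). *)

theory Defs
  imports
    "HOL-Probability.Probability"
    "Jordan_Normal_Form.Gauss_Jordan_Elimination"
    "Jordan_Normal_Form.Spectral_Radius"
begin

section \<open>Jacobi weight and Jacobi polynomials\<close>

definition jacobi_weight :: "real \<Rightarrow> real \<Rightarrow> real \<Rightarrow> real" where
  "jacobi_weight \<alpha> \<beta> x = (1 - x) powr \<alpha> * (1 + x) powr \<beta>"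

definition jacobi_rodrigues :: "real \<Rightarrow> real \<Rightarrow> nat \<Rightarrow> real \<Rightarrow> real" where
  "jacobi_rodrigues \<alpha> \<beta> k x =
     (-1) ^ k / (2 ^ k * fact k) * (1 / jacobi_weight \<alpha> \<beta> x) *
     (deriv ^^ k) (\<lambda>t. jacobi_weight \<alpha> \<beta> t * (1 - t\<^sup>2) ^ k) x"

text \<open>Rodrigues' formula only makes sense on the open interval, where the weight is positive
  and smooth; the Jacobi polynomial is the polynomial it defines there
  (existence and uniqueness: \<open>jacobi_poly_ex1\<close> below).\<close>

definition jacobi_poly :: "real \<Rightarrow> real \<Rightarrow> nat \<Rightarrow> real poly" where
  "jacobi_poly \<alpha> \<beta> k = (THE p. \<forall>x\<in>{-1<..<1}. poly p x = jacobi_rodrigues \<alpha> \<beta> k x)"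

text \<open>For \<open>k = 0\<close> the product \<open>(2k + \<alpha> + \<beta> + 1) \<Gamma>(k + \<alpha> + \<beta> + 1)\<close> is read as
  \<open>\<Gamma>(\<alpha> + \<beta> + 2)\<close>. This changes nothing unless \<open>\<alpha> + \<beta> = -1\<close>
  (lemma \<open>jacobi_h_eq\<close>), where the product has the indeterminate form \<open>0 \<cdot> \<infinity>\<close>.\<close>

definition jacobi_h :: "real \<Rightarrow> real \<Rightarrow> nat \<Rightarrow> real" where
  "jacobi_h \<alpha> \<beta> k =
     (if k = 0
      then 2 powr (\<alpha> + \<beta> + 1) * Gamma (\<alpha> + 1) * Gamma (\<beta> + 1) / Gamma (\<alpha> + \<beta> + 2)
      else 2 powr (\<alpha> + \<beta> + 1) * Gamma (real k + \<alpha> + 1) * Gamma (real k + \<beta> + 1) /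
           (fact k * (2 * real k + \<alpha> + \<beta> + 1) * Gamma (real k + \<alpha> + \<beta> + 1)))"

definition jacobi_normalized :: "real \<Rightarrow> real \<Rightarrow> nat \<Rightarrow> real \<Rightarrow> real" where
  "jacobi_normalized \<alpha> \<beta> k x = poly (jacobi_poly \<alpha> \<beta> k) x / sqrt (jacobi_h \<alpha> \<beta> k)"

lemma jacobi_h_eq:
  assumes "\<alpha> \<ge> -1/2" "\<beta> \<ge> -1/2" "\<alpha> + \<beta> \<noteq> -1"
  shows "jacobi_h \<alpha> \<beta> k =
     2 powr (\<alpha> + \<beta> + 1) * Gamma (real k + \<alpha> + 1) * Gamma (real k + \<beta> + 1) /
     (fact k * (2 * real k + \<alpha> + \<beta> + 1) * Gamma (real k + \<alpha> + \<beta> + 1))"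
proof -
  have "\<alpha> + \<beta> + 1 > 0"
    using assms by linarith
  then have "Gamma (\<alpha> + \<beta> + 1 + 1) = (\<alpha> + \<beta> + 1) * Gamma (\<alpha> + \<beta> + 1)"
    by (intro Gamma_plus1) (auto elim!: nonpos_Ints_cases)
  then show ?thesis
    by (auto simp: jacobi_h_def add.assoc)
qed

lemma jacobi_weight_poly_deriv:
  assumes "x \<in> {-1<..<1}"
  shows "((\<lambda>t. jacobi_weight a b t * poly p t) has_real_derivative
     jacobi_weight (a - 1) (b - 1) x *
     poly (Polynomial.smult (- a) ([:1, 1:] * p) + Polynomial.smult b ([:1, -1:] * p) + [:1, 0, -1:] * pderiv p) x) (at x)"
proof -
  have pos: "1 - x > 0" "1 + x > 0" using assms by auto
  have e: "(1 - x) powr a = (1 - x) powr (a - 1) * (1 - x)"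
    "(1 + x) powr b = (1 + x) powr (b - 1) * (1 + x)"
    using pos by (simp_all add: powr_diff)
  have "((\<lambda>t. (1 - t) powr a * (1 + t) powr b * poly p t) has_real_derivative
      ((a * (1 - x) powr (a - 1) * (-1)) * (1 + x) powr b
        + (b * (1 + x) powr (b - 1)) * (1 - x) powr a) * poly p x
      + poly (pderiv p) x * ((1 - x) powr a * (1 + x) powr b)) (at x)"
    using pos by (auto intro!: derivative_eq_intros simp: powr_diff)
  then show ?thesis
    unfolding jacobi_weight_def
    by (rule back_subst[where P = "\<lambda>d. (_ has_real_derivative d) (at x)"])
       (simp add: e algebra_simps)
qed

lemma jacobi_weight_higher_deriv:
  "\<exists>q. \<forall>x\<in>{-1<..<1}. (deriv ^^ j) (\<lambda>t. jacobi_weight \<alpha> \<beta> t * (1 - t\<^sup>2) ^ k) x =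
     jacobi_weight (\<alpha> + real k - real j) (\<beta> + real k - real j) x * poly q x"
proof (induction j)
  case 0
  have "jacobi_weight \<alpha> \<beta> x * (1 - x\<^sup>2) ^ k = jacobi_weight (\<alpha> + k) (\<beta> + k) x"
    if "x \<in> {-1<..<1}" for x
  proof -
    have "1 - x\<^sup>2 = (1 - x) * (1 + x)" by (simp add: power2_eq_square algebra_simps)
    then show ?thesis
      using that by (simp add: jacobi_weight_def powr_add powr_realpow power_mult_distrib)
  qed
  then show ?case by (intro exI[of _ 1]) simp
next
  case (Suc j)
  let ?f = "\<lambda>t. jacobi_weight \<alpha> \<beta> t * (1 - t\<^sup>2) ^ k"
  let ?a = "\<alpha> + real k - real j" and ?b = "\<beta> + real k - real j"
  obtain q where q: "\<And>x. x \<in> {-1<..<1} \<Longrightarrow> (deriv ^^ j) ?f x = jacobi_weight ?a ?b x * poly q x"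
    using Suc by blast
  let ?q = "Polynomial.smult (- ?a) ([:1, 1:] * q) + Polynomial.smult ?b ([:1, -1:] * q) + [:1, 0, -1:] * pderiv q"
  have "(deriv ^^ Suc j) ?f x = jacobi_weight (?a - 1) (?b - 1) x * poly ?q x"
    if x: "x \<in> {-1<..<1}" for x
  proof -
    have "((deriv ^^ j) ?f has_real_derivative
        jacobi_weight (?a - 1) (?b - 1) x * poly ?q x) (at x)"
      by (rule has_field_derivative_transform_within_open[OF
            jacobi_weight_poly_deriv[OF x] open_greaterThanLessThan x])
         (simp add: q)
    then show ?thesis by (simp add: DERIV_imp_deriv)
  qed
  then show ?case
    by (intro exI[of _ ?q]) (simp add: algebra_simps)
qed

lemma jacobi_poly_ex1:
  "\<exists>!p. \<forall>x\<in>{-1<..<1}. poly p x = jacobi_rodrigues \<alpha> \<beta> k x"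
proof (rule ex_ex1I)
  obtain q where q: "\<And>x. x \<in> {-1<..<1} \<Longrightarrow>
      (deriv ^^ k) (\<lambda>t. jacobi_weight \<alpha> \<beta> t * (1 - t\<^sup>2) ^ k) x = jacobi_weight \<alpha> \<beta> x * poly q x"
    using jacobi_weight_higher_deriv[of k \<alpha> \<beta> k] unfolding add_diff_cancel_right' by blast
  have "jacobi_weight \<alpha> \<beta> x \<noteq> 0" if "x \<in> {-1<..<1}" for x
    using that by (auto simp: jacobi_weight_def)
  then show "\<exists>p. \<forall>x\<in>{-1<..<1}. poly p x = jacobi_rodrigues \<alpha> \<beta> k x"
    by (intro exI[of _ "Polynomial.smult ((-1) ^ k / (2 ^ k * fact k)) q"])
       (auto simp: jacobi_rodrigues_def q)
next
  fix p r :: "real poly"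
  assume p: "\<forall>x\<in>{-1<..<1}. poly p x = jacobi_rodrigues \<alpha> \<beta> k x"
    and r: "\<forall>x\<in>{-1<..<1}. poly r x = jacobi_rodrigues \<alpha> \<beta> k x"
  have "{-1<..<1} \<subseteq> {x. poly (p - r) x = 0}"
    using p r by auto
  moreover have "infinite {-1<..<1::real}"
    by (rule infinite_Ioo) simp
  ultimately have "infinite {x. poly (p - r) x = 0}"
    using infinite_super by blast
  then show "p = r"
    using poly_roots_finite[of "p - r"] by auto
qed

section \<open>The Beta distribution on \<open>[-1, 1]\<close>\<close>

definition jacobi_gamma :: "real \<Rightarrow> real \<Rightarrow> real" where
  "jacobi_gamma \<alpha> \<beta> = 2 powr (\<alpha> + \<beta> + 1) * Beta (\<alpha> + 1) (\<beta> + 1)"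

definition beta_density :: "real \<Rightarrow> real \<Rightarrow> real \<Rightarrow> real" where
  "beta_density \<alpha> \<beta> x = indicator {-1..1} x * (jacobi_weight \<alpha> \<beta> x / jacobi_gamma \<alpha> \<beta>)"

section \<open>Constants\<close>

definition jacobi_c :: "real \<Rightarrow> real \<Rightarrow> real" where
  "jacobi_c \<alpha> \<beta> = (\<alpha> + \<beta> + 1) / 2"

definition jacobi_eta :: "real \<Rightarrow> real \<Rightarrow> real" where
  "jacobi_eta \<alpha> \<beta> = (let \<mu> = max \<alpha> \<beta> in
     exp (2 * max \<mu> 0 / 12 + max (\<mu>\<^sup>2 + \<alpha> * \<beta>) 0 / 8) /
     (2 powr ((\<alpha> + \<beta>) / 2) * Gamma (\<mu> + 1)))"

definition jacobi_m_sq :: "real \<Rightarrow> real \<Rightarrow> real" where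
  "jacobi_m_sq \<alpha> \<beta> = (let \<mu> = max \<alpha> \<beta> in
     (1 + 1 / 2 * sqrt (jacobi_c \<alpha> \<beta> / 2)) / (\<mu> + 3 / 2) * (jacobi_eta \<alpha> \<beta>)\<^sup>2)"

section \<open>Condition number in the Euclidean operator norm\<close>

definition vec_norm2 :: "real vec \<Rightarrow> real" where
  "vec_norm2 v = sqrt (scalar_prod v v)"

definition mat_norm2 :: "real mat \<Rightarrow> real" where
  "mat_norm2 A = (SUP v\<in>{v \<in> carrier_vec (dim_col A). vec_norm2 v = 1}. vec_norm2 (A *\<^sub>v v))"

definition cond2 :: "real mat \<Rightarrow> ereal" where
  "cond2 A = (case mat_inverse A of
     Some B \<Rightarrow> ereal (mat_norm2 A * mat_norm2 B)
   | None \<Rightarrow> \<infinity>)"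

lemma vec_norm2_eq: "vec_norm2 v = sqrt (\<Sum>i<dim_vec v. (v $ i)\<^sup>2)"
  by (simp add: vec_norm2_def scalar_prod_def power2_eq_square lessThan_atLeast0)

lemma scalar_prod_self: "scalar_prod v v = (vec_norm2 v)\<^sup>2"
  by (simp add: vec_norm2_def scalar_prod_def sum_nonneg)

lemma vec_norm2_eq_0: "v \<in> carrier_vec n \<Longrightarrow> vec_norm2 v = 0 \<longleftrightarrow> v = 0\<^sub>v n"
  by (auto simp: vec_norm2_eq sum_nonneg_eq_0_iff intro!: eq_vecI)

lemma vec_norm2_nonneg: "vec_norm2 v \<ge> 0"
  by (simp add: vec_norm2_eq sum_nonneg)

lemma vec_norm2_smult: "vec_norm2 (c \<cdot>\<^sub>v v) = \<bar>c\<bar> * vec_norm2 v"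
  by (simp add: vec_norm2_eq power_mult_distrib real_sqrt_mult flip: sum_distrib_left)

lemma mat_norm2_attained:
  assumes A: "A \<in> carrier_mat n n" and n: "n > 0"
  obtains v where "v \<in> carrier_vec n" "vec_norm2 v = 1" "vec_norm2 (A *\<^sub>v v) = mat_norm2 A"
    "\<And>w. w \<in> carrier_vec n \<Longrightarrow> vec_norm2 (A *\<^sub>v w) \<le> mat_norm2 A * vec_norm2 w"
proof -
  define B :: "(nat \<Rightarrow> real) set" where "B = PiE UNIV (\<lambda>i. if i < n then {-1..1} else {0})"
  define K where "K = B \<inter> {f. (\<Sum>i<n. (f i)\<^sup>2) = 1}"
  define F where "F f = vec_norm2 (A *\<^sub>v Matrix.vec n f)" for f
  have Feq: "F f = sqrt (\<Sum>i<n. (\<Sum>j<n. A $$ (i, j) * f j)\<^sup>2)" for f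
    using A by (simp add: F_def vec_norm2_eq scalar_prod_def lessThan_atLeast0)
  have cont: "continuous_on S (\<lambda>f. f i)" for S :: "(nat \<Rightarrow> real) set" and i
    by (rule continuous_on_subset[OF continuous_on_product_coordinates]) simp
  have "compactin (product_topology (\<lambda>i. euclidean) UNIV) B"
    unfolding B_def compactin_PiE by auto
  then have "compact B"
    by (simp add: euclidean_product_topology)
  moreover have "closed {f :: nat \<Rightarrow> real. (\<Sum>i<n. (f i)\<^sup>2) = 1}"
    by (intro closed_Collect_eq continuous_intros cont)
  ultimately have "compact K"
    unfolding K_def by (rule compact_Int_closed)
  moreover have "(\<lambda>i. if i = 0 then 1 else 0) \<in> K"
    using n by (auto simp: K_def B_def if_distrib[of "\<lambda>x. x\<^sup>2"] cong: if_cong)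
  then have "K \<noteq> {}" by blast
  moreover have "continuous_on K F"
    unfolding Feq by (intro continuous_intros cont)
  ultimately obtain f where f: "f \<in> K" "\<And>g. g \<in> K \<Longrightarrow> F g \<le> F f"
    using continuous_attains_sup[of K F] by blast
  define v where "v = Matrix.vec n f"
  have v: "v \<in> carrier_vec n" "vec_norm2 v = 1"
    using f(1) by (auto simp: v_def K_def vec_norm2_eq)
  have max: "vec_norm2 (A *\<^sub>v w) \<le> vec_norm2 (A *\<^sub>v v)"
    if w: "w \<in> carrier_vec n" "vec_norm2 w = 1" for w
  proof -
    define g where "g i = (if i < n then w $ i else 0)" for i
    have sq: "(\<Sum>i<n. (w $ i)\<^sup>2) = 1"
      using w by (simp add: vec_norm2_eq)
    have "\<bar>w $ i\<bar> \<le> 1" if "i < n" for i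
    proof -
      have "(w $ i)\<^sup>2 \<le> (\<Sum>i<n. (w $ i)\<^sup>2)"
        using that by (intro member_le_sum) auto
      then show ?thesis using sq by (simp add: abs_square_le_1)
    qed
    then have "g \<in> K"
      using sq by (force simp: K_def B_def g_def abs_le_iff)
    moreover have "Matrix.vec n g = w"
      using w by (auto simp: g_def)
    ultimately show ?thesis
      using f(2)[of g] by (simp add: F_def v_def)
  qed
  have S: "mat_norm2 A = vec_norm2 (A *\<^sub>v v)"
    unfolding mat_norm2_def using v max A by (intro cSup_eq_maximum) auto
  have "vec_norm2 (A *\<^sub>v w) \<le> mat_norm2 A * vec_norm2 w" if w: "w \<in> carrier_vec n" for w
  proof (cases "vec_norm2 w = 0")
    case True
    then have "A *\<^sub>v w = 0\<^sub>v n"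
      using A w by (auto simp: vec_norm2_eq_0)
    then show ?thesis using True by (simp add: vec_norm2_eq)
  next
    case False
    then have pos: "vec_norm2 w > 0" using vec_norm2_nonneg[of w] by simp
    let ?u = "(1 / vec_norm2 w) \<cdot>\<^sub>v w"
    have "vec_norm2 (A *\<^sub>v ?u) \<le> mat_norm2 A"
      unfolding S using w pos by (intro max) (auto simp: vec_norm2_smult)
    moreover have "A *\<^sub>v ?u = (1 / vec_norm2 w) \<cdot>\<^sub>v (A *\<^sub>v w)"
      using A w by (rule mult_mat_vec)
    ultimately show ?thesis
      using pos by (simp add: vec_norm2_smult field_simps)
  qed
  with v S show ?thesis by (intro that[of v]) auto
qed

definition pos_def_mat :: "nat \<Rightarrow> real mat \<Rightarrow> bool" where
  "pos_def_mat n A \<longleftrightarrow> A \<in> carrier_mat n n \<and> transpose_mat A = A \<and>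
     (\<forall>v\<in>carrier_vec n. v \<noteq> 0\<^sub>v n \<longrightarrow> scalar_prod v (A *\<^sub>v v) > 0)"

lemma pos_def_mat_eigenvalue_pos:
  assumes A: "pos_def_mat n A" and k: "eigenvalue A k"
  shows "k > 0" "k \<le> mat_norm2 A"
proof -
  obtain v where v: "v \<in> carrier_vec n" "v \<noteq> 0\<^sub>v n" "A *\<^sub>v v = k \<cdot>\<^sub>v v"
    using A k by (auto simp: eigenvalue_def eigenvector_def pos_def_mat_def)
  then have "n > 0"
    by (intro gr0I) auto
  have nv: "vec_norm2 v > 0"
    using v vec_norm2_nonneg[of v] vec_norm2_eq_0[of v n] by auto
  have "scalar_prod v (A *\<^sub>v v) > 0"
    using A v by (auto simp: pos_def_mat_def)
  then show "k > 0"
    using v nv by (simp add: scalar_prod_self zero_less_mult_iff)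
  from A have "A \<in> carrier_mat n n" by (simp add: pos_def_mat_def)
  then obtain u where "vec_norm2 (A *\<^sub>v v) \<le> mat_norm2 A * vec_norm2 v"
    using mat_norm2_attained[of A n] v \<open>n > 0\<close> by metis
  then show "k \<le> mat_norm2 A"
    using v nv \<open>k > 0\<close> by (simp add: vec_norm2_smult)
qed

lemma pos_def_mat_norm2_eigenvalue:
  assumes A: "pos_def_mat n A" and n: "n > 0"
  shows "eigenvalue A (mat_norm2 A)"
proof -
  let ?S = "mat_norm2 A"
  have Ac: "A \<in> carrier_mat n n" and At: "transpose_mat A = A"
    using A by (auto simp: pos_def_mat_def)
  obtain v where v: "v \<in> carrier_vec n" "vec_norm2 v = 1" "vec_norm2 (A *\<^sub>v v) = ?S"
    and le: "\<And>w. w \<in> carrier_vec n \<Longrightarrow> vec_norm2 (A *\<^sub>v w) \<le> ?S * vec_norm2 w"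
    using mat_norm2_attained[OF Ac n] by metis
  have S0: "?S \<ge> 0" using v(3) vec_norm2_nonneg by metis
  have c: "A *\<^sub>v v \<in> carrier_vec n" "A *\<^sub>v (A *\<^sub>v v) \<in> carrier_vec n"
    using Ac v by auto
  let ?y = "A *\<^sub>v (A *\<^sub>v v)"
  have sym: "scalar_prod ?y v = ?S\<^sup>2"
    using transpose_vec_mult_scalar[OF Ac v(1) c(1)] v(3) by (simp add: At scalar_prod_self)
  let ?z = "?y - ?S\<^sup>2 \<cdot>\<^sub>v v"
  have "(vec_norm2 ?z)\<^sup>2 = (vec_norm2 ?y)\<^sup>2 - ?S\<^sup>2 * ?S\<^sup>2"
    using c v sym comm_scalar_prod[OF c(2) v(1)]
    by (simp add: minus_scalar_prod_distrib[of _ n] scalar_prod_minus_distrib[of _ n]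
        flip: scalar_prod_self)
       (simp add: scalar_prod_self)
  also have "vec_norm2 ?y \<le> ?S * ?S"
    using le[OF c(1)] v(3) by simp
  then have "(vec_norm2 ?y)\<^sup>2 \<le> ?S\<^sup>2 * ?S\<^sup>2"
    using power_mono[OF _ vec_norm2_nonneg, of ?y "?S * ?S" 2] by (simp add: power_mult_distrib)
  finally have "vec_norm2 ?z = 0" by simp
  then have "?z = 0\<^sub>v n"
    using c v by (simp add: vec_norm2_eq_0[of _ n])
  have yeq: "?y = ?S\<^sup>2 \<cdot>\<^sub>v v"
  proof (rule eq_vecI)
    fix i assume "i < dim_vec (?S\<^sup>2 \<cdot>\<^sub>v v)"
    then show "?y $ i = (?S\<^sup>2 \<cdot>\<^sub>v v) $ i"
      using arg_cong[OF \<open>?z = 0\<^sub>v n\<close>, of "\<lambda>u. u $ i"] v c by simp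
  qed (use Ac c v in auto)
  let ?w = "A *\<^sub>v v - ?S \<cdot>\<^sub>v v"
  have w: "?w \<in> carrier_vec n" using c v by auto
  have "A *\<^sub>v ?w = ?y - ?S \<cdot>\<^sub>v (A *\<^sub>v v)"
    using Ac v c by (simp add: mult_minus_distrib_mat_vec[OF Ac] mult_mat_vec[OF Ac])
  also have "\<dots> = (- ?S) \<cdot>\<^sub>v ?w"
    unfolding yeq using Ac v c
    by (intro eq_vecI) (auto simp: power2_eq_square algebra_simps)
  finally have Aw: "A *\<^sub>v ?w = (- ?S) \<cdot>\<^sub>v ?w" .
  have "?w = 0\<^sub>v n"
  proof (rule ccontr)
    assume "?w \<noteq> 0\<^sub>v n"
    then have "scalar_prod ?w (A *\<^sub>v ?w) > 0"
      using A w by (auto simp: pos_def_mat_def)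
    also have "scalar_prod ?w (A *\<^sub>v ?w) = - ?S * (vec_norm2 ?w)\<^sup>2"
      unfolding Aw using w by (simp only: scalar_prod_smult_distrib scalar_prod_self)
    finally show False using S0 by (simp add: mult_less_0_iff)
  qed
  then have "A *\<^sub>v v = ?S \<cdot>\<^sub>v v"
    using Ac c v by (intro eq_vecI) (auto simp: vec_eq_iff)
  moreover have "v \<noteq> 0\<^sub>v n"
    using v vec_norm2_eq_0[of v n] by auto
  ultimately show ?thesis
    using v Ac by (auto simp: eigenvalue_def eigenvector_def)
qed

text \<open>For positive definite matrices \<open>cond2\<close> is the ratio of the extreme eigenvalues, and for
  singular matrices it is infinite.\<close>

theorem cond2_pos_def:
  assumes A: "pos_def_mat n A" and n: "n > 0"
  shows "cond2 A = ereal (Max (spectrum A) / Min (spectrum A))"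
proof -
  have Ac: "A \<in> carrier_mat n n" and At: "transpose_mat A = A"
    using A by (auto simp: pos_def_mat_def)
  have "det A \<noteq> 0"
  proof
    assume "det A = 0"
    then obtain v where v: "v \<in> carrier_vec n" "v \<noteq> 0\<^sub>v n" "A *\<^sub>v v = 0\<^sub>v n"
      using det_0_iff_vec_prod_zero_field[OF Ac] by auto
    then have "scalar_prod v (A *\<^sub>v v) > 0"
      using A by (auto simp: pos_def_mat_def)
    then show False using v by simp
  qed
  then obtain B where B: "mat_inverse A = Some B"
    using det_non_zero_imp_unit[OF Ac, of "()"] mat_inverse(1)[OF Ac, of "()"]
    by (cases "mat_inverse A") auto
  then have AB: "A * B = 1\<^sub>m n" and BA: "B * A = 1\<^sub>m n" and Bc: "B \<in> carrier_mat n n"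
    using mat_inverse(2)[OF Ac] by auto
  have ABv: "A *\<^sub>v (B *\<^sub>v v) = v" and BAv: "B *\<^sub>v (A *\<^sub>v v) = v" if "v \<in> carrier_vec n" for v
    using that assoc_mult_mat_vec[OF Ac Bc that] assoc_mult_mat_vec[OF Bc Ac that]
    by (simp_all add: AB BA)
  have "transpose_mat B = transpose_mat B * (A * B)"
    using Bc by (simp add: AB)
  also have "\<dots> = transpose_mat B * transpose_mat A * B"
    using Ac Bc by (subst At) (subst assoc_mult_mat, auto)
  also have "transpose_mat B * transpose_mat A = 1\<^sub>m n"
    using transpose_mult[OF Ac Bc] by (simp add: AB)
  finally have Bt: "transpose_mat B = B" using Bc by simp
  have PB: "pos_def_mat n B"
    unfolding pos_def_mat_def
  proof (intro conjI Bc Bt ballI impI)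
    fix v :: "real vec" assume v: "v \<in> carrier_vec n" "v \<noteq> 0\<^sub>v n"
    have Bv: "B *\<^sub>v v \<in> carrier_vec n" using Bc v by auto
    have "A *\<^sub>v 0\<^sub>v n = 0\<^sub>v n"
      using Ac by (intro eq_vecI) auto
    then have "B *\<^sub>v v \<noteq> 0\<^sub>v n"
      using ABv[OF v(1)] v(2) by auto
    then have "scalar_prod (B *\<^sub>v v) (A *\<^sub>v (B *\<^sub>v v)) > 0"
      using A Bv by (auto simp: pos_def_mat_def)
    then show "scalar_prod v (B *\<^sub>v v) > 0"
      using ABv[OF v(1)] comm_scalar_prod[OF v(1) Bv] by simp
  qed
  have inv: "eigenvalue Q (1 / k)"
    if PQ: "eigenvalue P k" "pos_def_mat n P" "Q \<in> carrier_mat n n"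
      "\<And>v. v \<in> carrier_vec n \<Longrightarrow> Q *\<^sub>v (P *\<^sub>v v) = v" for P Q k
  proof -
    obtain v where v: "v \<in> carrier_vec n" "v \<noteq> 0\<^sub>v n" "P *\<^sub>v v = k \<cdot>\<^sub>v v"
      using PQ(1,2) by (auto simp: eigenvalue_def eigenvector_def pos_def_mat_def)
    have "k > 0" by (rule pos_def_mat_eigenvalue_pos(1)[OF PQ(2,1)])
    have "v = k \<cdot>\<^sub>v (Q *\<^sub>v v)"
      using PQ(4)[OF v(1)] v mult_mat_vec[OF PQ(3) v(1)] by simp
    then have "(1 / k) \<cdot>\<^sub>v v = (1 / k) \<cdot>\<^sub>v (k \<cdot>\<^sub>v (Q *\<^sub>v v))" by simp
    also have "\<dots> = Q *\<^sub>v v" using \<open>k > 0\<close> by (simp add: smult_smult_assoc)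
    finally show ?thesis
      using v PQ(3) unfolding eigenvalue_def eigenvector_def by (intro exI[of _ v]) auto
  qed
  have fin: "finite (spectrum A)" using card_finite_spectrum[OF Ac] by simp
  have "Max (spectrum A) = mat_norm2 A"
    using fin pos_def_mat_norm2_eigenvalue[OF A n] pos_def_mat_eigenvalue_pos[OF A]
    by (intro Max_eqI) (auto simp: spectrum_def)
  moreover have "Min (spectrum A) = 1 / mat_norm2 B"
  proof (intro Min_eqI fin)
    show "1 / mat_norm2 B \<in> spectrum A"
      using inv[OF pos_def_mat_norm2_eigenvalue[OF PB n] PB Ac ABv] by (simp add: spectrum_def)
  next
    fix k assume "k \<in> spectrum A"
    then have k: "eigenvalue A k" by (simp add: spectrum_def)
    have "1 / k \<le> mat_norm2 B"
      using inv[OF k A Bc BAv] pos_def_mat_eigenvalue_pos[OF PB] by blast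
    moreover have "k > 0" using pos_def_mat_eigenvalue_pos[OF A k] by simp
    moreover from calculation have "mat_norm2 B > 0"
      using less_le_trans[of 0 "1 / k" "mat_norm2 B"] by simp
    ultimately show "1 / mat_norm2 B \<le> k"
      by (simp add: field_simps)
  qed
  ultimately show ?thesis by (simp add: cond2_def B)
qed

theorem cond2_singular:
  assumes "A \<in> carrier_mat n n" "det A = 0"
  shows "cond2 A = \<infinity>"
proof (cases "mat_inverse A")
  case (Some B)
  then have "A * B = 1\<^sub>m n" "B \<in> carrier_mat n n"
    using mat_inverse(2)[OF assms(1)] by auto
  then have "det A * det B = 1"
    using det_mult[OF assms(1)] by (metis det_one)
  then show ?thesis using assms(2) by simp
qed (simp add: cond2_def)

section \<open>The random Gram matrix\<close>

text \<open>Matrix indices start at \<open>0\<close> here, so the entry in row \<open>k\<close> and column \<open>l\<close> involves the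
  polynomials of degrees \<open>k\<close> and \<open>l\<close>.\<close>

definition jacobi_gram :: "real \<Rightarrow> real \<Rightarrow> nat \<Rightarrow> nat \<Rightarrow> (nat \<Rightarrow> real) \<Rightarrow> real mat" where
  "jacobi_gram \<alpha> \<beta> N n x = Matrix.mat (N + 1) (N + 1) (\<lambda>(k, l).
     1 / real n * (\<Sum>j = 1..n. jacobi_normalized \<alpha> \<beta> k (x j) * jacobi_normalized \<alpha> \<beta> l (x j)))"

end

theory Submission
  imports Defs
begin

text \<open>\<open>A\<^sub>N - I\<close> is the mean of \<open>n\<close> independent centred matrices, whose Frobenius norms are controlled by
  the Christoffel function \<open>K(x) = \<gamma> * (\<Sum>k\<le>N. P\<^sub>k(x)\<^sup>2)\<close>, where \<open>\<gamma> = \<gamma>\<^sub>\<alpha>\<^sub>\<beta>\<close> and \<open>P\<^sub>k\<close> is normalized: for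
  \<open>r \<le> K \<le> R\<close> and \<open>d = N + 1\<close>, each is at most \<open>R\<close> in norm, with second moment at most
  \<open>\<sigma>2 = (R - d)(d - r) + d\<^sup>2 - d\<close>. Pinelis' Bernstein inequality in Euclidean space then shows that the
  Frobenius norm of \<open>A\<^sub>N - I\<close> stays below \<open>\<epsilon> < 1\<close> with probability at least
  \<open>1 - 2 exp (- n\<epsilon>\<^sup>2 / (2 (\<sigma>2 + R\<epsilon>/3)))\<close>, and there the condition number is at most
  \<open>(1 + \<epsilon>) / (1 - \<epsilon>)\<close>. Writing \<open>t = 0.63 \<epsilon>\<close> for the deviation in the statement, this quotient is
  \<open>(0.63 + t) / (0.63 - t)\<close>, and it remains to see that \<open>\<sigma>2 + R/3 \<le> (m\<^sup>2 d powr (2\<mu> + 2))\<^sup>2 / 0.63\<^sup>2\<close>, an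
  inequality between explicit functions of \<open>\<alpha>\<close>, \<open>\<beta>\<close> and \<open>N\<close>. It suffices to take \<open>r = 1\<close> unless
  \<open>\<alpha>\<close> and \<open>\<beta>\<close> are both close to \<open>-1/2\<close>, where testing with Chebyshev kernels gives a larger \<open>r\<close>.\<close>

section \<open>A Bernstein inequality for sums of random vectors\<close>

text \<open>Measuring deviations in the Frobenius norm makes the tail bound Euclidean: its prefactor
  is 2 whatever the size of the matrix, which is what \<open>ln (2 / \<delta>)\<close> allows. The
  price is a second moment of order \<open>R * d\<close> instead of \<open>R\<close>. It is
  affordable because the right-hand side is squared: with \<open>e = \<mu> + 1/2\<close>,
  \<open>R * d\<close> has order \<open>d powr (2 * e + 2)\<close> against
  \<open>d powr (4 * e + 2)\<close>. The spare factor \<open>d powr (2 * e)\<close> degenerates in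
  the Chebyshev case \<open>e = 0\<close>, where only constants decide: there
  \<open>R = 2 * d - 1\<close>, so \<open>r = 1\<close> costs about \<open>2 * d^2\<close>, while
  the right-hand side is \<open>2.519 * (4 / pi^2) * exp (1/4) * d^2\<close>, about
  \<open>1.31 * d^2\<close>. With \<open>r\<close> near \<open>3/4 * d\<close> the cost falls to
  about \<open>5/4 * d^2\<close>, which fits, and the margin lasts up to \<open>e = 2/25\<close>.
  Beyond that, \<open>r = 1\<close> suffices: directly for \<open>e \<le> 3/2\<close>, and for
  larger parameters by comparing how both sides grow when the parameters increase by 1. Hence
  \<open>e = a + 1/2\<close> and \<open>f = b + 1/2\<close> are the coordinates of most numerical
  estimates.\<close>

lemma borel_measurable_cosh: "cosh \<in> borel_measurable (borel :: real measure)"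
  unfolding cosh_def by measurable

lemma convex_on_realpow: "convex_on {0..} (\<lambda>x::real. x ^ m)"
  using convex_power_odd[of m] convex_on_subset[OF convex_power_even[of m]] by (cases "even m") auto

text \<open>\<open>cosh (sqrt s)\<close> is a power series in \<open>s\<close> with nonnegative
  coefficients, hence convex for \<open>s \<ge> 0\<close>; this is its chord inequality between
  \<open>p\<^sup>2\<close> and \<open>q\<^sup>2\<close>, proved term by term.\<close>

lemma cosh_sqrt_chord:
  fixes p q u :: real
  assumes u: "0 \<le> u" "u \<le> 1"
  shows "cosh (sqrt (u * p\<^sup>2 + (1 - u) * q\<^sup>2)) \<le> u * cosh p + (1 - u) * cosh q"
proof -
  let ?s = "u * p\<^sup>2 + (1 - u) * q\<^sup>2"
  have s: "?s \<ge> 0" using u by auto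
  have "(\<lambda>n. u * (if even n then p ^ n /\<^sub>R fact n else 0) + (1 - u) * (if even n then q ^ n /\<^sub>R fact n else 0))
      sums (u * cosh p + (1 - u) * cosh q)"
    by (intro sums_add sums_mult cosh_converges)
  moreover have "(if even n then sqrt ?s ^ n /\<^sub>R fact n else 0) \<le>
      u * (if even n then p ^ n /\<^sub>R fact n else 0) + (1 - u) * (if even n then q ^ n /\<^sub>R fact n else 0)" for n
  proof (cases "even n")
    case True
    then obtain m where n: "n = 2 * m" by auto
    have "?s ^ m \<le> u * (p\<^sup>2) ^ m + (1 - u) * (q\<^sup>2) ^ m"
      using convex_onD[OF convex_on_realpow[of m], of "1 - u" "p\<^sup>2" "q\<^sup>2"] u by simp
    then have "?s ^ m / fact n \<le> (u * (p\<^sup>2) ^ m + (1 - u) * (q\<^sup>2) ^ m) / fact n"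
      by (intro divide_right_mono) auto
    also have "\<dots> = u * (p ^ n /\<^sub>R fact n) + (1 - u) * (q ^ n /\<^sub>R fact n)"
      unfolding n power_mult by (simp add: divide_inverse algebra_simps)
    also have "?s ^ m = sqrt ?s ^ n" using s unfolding n power_mult by simp
    finally show ?thesis using True by (simp add: divide_inverse mult.commute)
  qed simp
  ultimately show ?thesis
    using cosh_converges[of "sqrt ?s"] by (rule_tac sums_le)
qed

lemma sinh_ge_self: "0 \<le> x \<Longrightarrow> x \<le> sinh x" for x :: real
proof -
  assume "0 \<le> x"
  then have "sinh x - x \<ge> sinh 0 - (0::real)"
    by (intro DERIV_nonneg_imp_nondecreasing[of 0 x "\<lambda>x. sinh x - x"])
       (auto intro!: derivative_eq_intros exI cosh_real_ge_1)
  then show ?thesis by simp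
qed

lemma cosh_le_exp_minus: "0 \<le> y \<Longrightarrow> cosh y \<le> exp y - y" for y :: real
  using sinh_ge_self[of y] cosh_plus_sinh[of y] by linarith

text \<open>Read \<open>a\<close>, \<open>b\<close> as the norms of two vectors and \<open>v\<close>
  as their inner product. The squared norm of the sum lies between \<open>(a - b)\<^sup>2\<close>
  and \<open>(a + b)\<^sup>2\<close>, so the chord inequality gives a product of \<open>cosh\<close>
  values plus \<open>v / (a * b)\<close> times a product of \<open>sinh\<close> values. Splitting
  off \<open>l * b\<close> from \<open>sinh (l * b)\<close> isolates a term linear in
  \<open>v\<close>, which will vanish in expectation; the rest is absorbed by
  \<open>sinh \<le> cosh\<close>.\<close>

lemma cosh_norm_add_le:
  fixes a b v l :: real
  assumes "a \<ge> 0" "b \<ge> 0" "l \<ge> 0" "\<bar>v\<bar> \<le> a * b"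
  shows "cosh (l * sqrt (a\<^sup>2 + 2 * v + b\<^sup>2)) \<le>
    cosh (l * a) * (exp (l * b) - l * b) + v * (if a = 0 then 0 else l * sinh (l * a) / a)"
proof (cases "a = 0 \<or> b = 0")
  case True
  then have v: "v = 0" using assms by auto
  have "cosh (l * b) \<le> exp (l * b) - l * b"
    using assms by (intro cosh_le_exp_minus) auto
  then show ?thesis using True v assms by auto
next
  case False
  then have pos: "a > 0" "b > 0" using assms by auto
  \<comment> \<open>The weight at which \<open>a\<^sup>2 + 2 * v + b\<^sup>2\<close> is the mean of
    \<open>(a + b)\<^sup>2\<close> and \<open>(a - b)\<^sup>2\<close>.\<close>
  define u where "u = (1 + v / (a * b)) / 2"
  have vab: "\<bar>v / (a * b)\<bar> \<le> 1" using assms pos by (simp add: abs_divide)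
  then have u: "0 \<le> u" "u \<le> 1" unfolding u_def abs_le_iff by auto
  have "u * (l * (a + b))\<^sup>2 + (1 - u) * (l * (a - b))\<^sup>2 = l\<^sup>2 * (a\<^sup>2 + 2 * v + b\<^sup>2)"
  proof -
    have "u * (l * (a + b))\<^sup>2 + (1 - u) * (l * (a - b))\<^sup>2 = l\<^sup>2 * (a\<^sup>2 + b\<^sup>2 + 2 * (a * b) * (2 * u - 1))"
      by (simp add: power2_eq_square algebra_simps)
    also have "a * b * (2 * u - 1) = v" using pos by (simp add: u_def field_simps)
    then have "2 * (a * b) * (2 * u - 1) = 2 * v" by simp
    finally show ?thesis by simp
  qed
  then have "l * sqrt (a\<^sup>2 + 2 * v + b\<^sup>2) = sqrt (u * (l * (a + b))\<^sup>2 + (1 - u) * (l * (a - b))\<^sup>2)"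
    using assms by (simp add: real_sqrt_mult)
  then have "cosh (l * sqrt (a\<^sup>2 + 2 * v + b\<^sup>2)) \<le> u * cosh (l * (a + b)) + (1 - u) * cosh (l * (a - b))"
    using cosh_sqrt_chord[OF u] by simp
  also have "\<dots> = cosh (l * a) * cosh (l * b) + (v / (a * b)) * (sinh (l * a) * sinh (l * b))"
    by (simp add: u_def distrib_left right_diff_distrib cosh_add cosh_diff field_simps)
  also have "\<dots> = cosh (l * a) * cosh (l * b) + v * (l * sinh (l * a) / a) +
      (v / (a * b)) * (sinh (l * a) * (sinh (l * b) - l * b))"
    using pos by (simp add: field_simps)
  also have "(v / (a * b)) * (sinh (l * a) * (sinh (l * b) - l * b)) \<le> 1 * (cosh (l * a) * (sinh (l * b) - l * b))"
    using vab[unfolded abs_le_iff] assms(1-3) sinh_ge_self[of "l * b"] sinh_le_cosh_real[of "l * a"]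
    by (intro mult_mono mult_right_mono) auto
  also have "cosh (l * b) = exp (l * b) - sinh (l * b)"
    using cosh_plus_sinh[of "l * b"] by linarith
  finally show ?thesis using pos by (simp add: algebra_simps)
qed

text \<open>The exponential series is compared with a geometric one through
  \<open>2 * 3 ^ n \<le> fact (n + 2)\<close>. Having the bound \<open>c\<close> in the denominator
  keeps the result quadratic in \<open>y\<close>, so that it can be integrated against a second
  moment.\<close>

lemma exp_le_bernstein:
  fixes y c :: real
  assumes "0 \<le> y" "y \<le> c" "c < 3"
  shows "exp y - y \<le> 1 + y\<^sup>2 / (2 * (1 - c / 3))"
proof -
  have y3: "\<bar>y / 3\<bar> < 1" using assms by simp
  have "(\<lambda>n. y ^ (n + 2) /\<^sub>R fact (n + 2)) sums (exp y - (\<Sum>i<2. y ^ i /\<^sub>R fact i))"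
    using exp_converges[of y] by (subst sums_iff_shift) (simp add: numeral_2_eq_2)
  then have e: "(\<lambda>n. y ^ (n + 2) /\<^sub>R fact (n + 2)) sums (exp y - 1 - y)"
    by (simp add: numeral_2_eq_2 diff_diff_eq)
  have g: "(\<lambda>n. y\<^sup>2 / 2 * (y / 3) ^ n) sums (y\<^sup>2 / 2 * (1 / (1 - y / 3)))"
    using y3 by (intro sums_mult geometric_sums) auto
  have f: "2 * 3 ^ n \<le> (fact (n + 2) :: real)" for n
  proof (induction n)
    case (Suc n)
    have "2 * 3 ^ Suc n \<le> (3 + real n) * (fact (n + 2) :: real)"
      using mult_mono[of 3 "3 + real n" "2 * 3 ^ n" "fact (n + 2)"] Suc by simp
    then show ?case by (simp add: algebra_simps)
  qed (simp add: numeral_2_eq_2)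
  have "exp y - 1 - y \<le> y\<^sup>2 / 2 * (1 / (1 - y / 3))"
  proof (rule sums_le[OF _ e g])
    fix n
    have "y ^ (n + 2) / fact (n + 2) \<le> y ^ (n + 2) / (2 * 3 ^ n)"
      using assms f[of n] by (intro divide_left_mono) auto
    also have "y ^ (n + 2) / (2 * 3 ^ n) = y\<^sup>2 / 2 * (y / 3) ^ n"
      by (simp add: power_add power_divide power2_eq_square)
    finally show "y ^ (n + 2) /\<^sub>R fact (n + 2) \<le> y\<^sup>2 / 2 * (y / 3) ^ n"
      by (simp only: real_scaleR_def divide_inverse mult.commute)
  qed
  also have "\<dots> \<le> y\<^sup>2 / 2 * (1 / (1 - c / 3))"
    using assms by (intro mult_left_mono divide_left_mono) auto
  finally show ?thesis by (simp add: field_simps)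
qed

lemma L2_set_power2: "(L2_set f K)\<^sup>2 = (\<Sum>k\<in>K. (f k)\<^sup>2)"
  by (simp add: L2_set_def sum_nonneg)

lemma L2_set_add_sqrt:
  "L2_set (\<lambda>k. f k + g k) K = sqrt ((L2_set f K)\<^sup>2 + 2 * (\<Sum>k\<in>K. f k * g k) + (L2_set g K)\<^sup>2)"
proof -
  have "(\<Sum>k\<in>K. (f k + g k)\<^sup>2) = (L2_set f K)\<^sup>2 + 2 * (\<Sum>k\<in>K. f k * g k) + (L2_set g K)\<^sup>2"
    unfolding L2_set_power2 power2_sum by (simp add: sum.distrib sum_distrib_left algebra_simps)
  then show ?thesis by (simp add: L2_set_def)
qed

text \<open>One step of Pinelis' argument: \<open>S\<close> is the sum already accumulated, and one
  more centred vector, with coordinates indexed by \<open>K\<close>, multiplies the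
  \<open>cosh\<close> moment by a factor free of the dimension.\<close>

lemma (in prob_space) cosh_L2_step:
  fixes z :: "'a \<Rightarrow> 'k \<Rightarrow> real"
  assumes K: "finite K" and meas[measurable]: "\<And>k. k \<in> K \<Longrightarrow> (\<lambda>x. z x k) \<in> borel_measurable M"
    and bd: "AE x in M. L2_set (z x) K \<le> b"
    and mean: "\<And>k. k \<in> K \<Longrightarrow> expectation (\<lambda>x. z x k) = 0"
    and var: "expectation (\<lambda>x. (L2_set (z x) K)\<^sup>2) \<le> \<sigma>2"
    and l: "l \<ge> 0" "l * b < 3"
  shows "(\<integral>\<^sup>+x. ennreal (cosh (l * L2_set (\<lambda>k. S k + z x k) K)) \<partial>M) \<le>
     ennreal (cosh (l * L2_set S K) * exp (l\<^sup>2 * \<sigma>2 / (2 * (1 - l * b / 3))))"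
proof -
  let ?a = "L2_set S K" and ?c = "l\<^sup>2 / (2 * (1 - l * b / 3))"
  \<comment> \<open>The numbers \<open>C * S k\<close> are the partial derivatives of
    \<open>cosh (l * norm)\<close> at \<open>S\<close>: the coefficients of the linear term, whose
    mean is 0.\<close>
  define C where "C = (if ?a = 0 then 0 else l * sinh (l * ?a) / ?a)"
  have mz[measurable]: "(\<lambda>x. L2_set (z x) K) \<in> borel_measurable M"
    unfolding L2_set_def by measurable
  have int: "integrable M (\<lambda>x. z x k)" if k: "k \<in> K" for k
  proof (rule integrable_const_bound[where B = b])
    show "AE x in M. norm (z x k) \<le> b"
      using bd
    proof eventually_elim
      case (elim x)
      have "\<bar>z x k\<bar> \<le> L2_set (z x) K"
        using member_le_L2_set[OF K k, of "\<lambda>k. \<bar>z x k\<bar>"] by (simp add: L2_set_def)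
      with elim show ?case by simp
    qed
  qed (use k in measurable)
  have intsq: "integrable M (\<lambda>x. (L2_set (z x) K)\<^sup>2)"
  proof (rule integrable_const_bound[where B = "b\<^sup>2"])
    show "AE x in M. norm ((L2_set (z x) K)\<^sup>2) \<le> b\<^sup>2"
      using bd by eventually_elim (auto intro!: power_mono)
  qed measurable
  define G where "G x = cosh (l * ?a) * (1 + ?c * (L2_set (z x) K)\<^sup>2) + (\<Sum>k\<in>K. S k * z x k) * C" for x
  have le: "AE x in M. cosh (l * L2_set (\<lambda>k. S k + z x k) K) \<le> G x"
    using bd
  proof eventually_elim
    case (elim x)
    let ?b = "L2_set (z x) K" and ?v = "\<Sum>k\<in>K. S k * z x k"
    have "\<bar>?v\<bar> \<le> (\<Sum>k\<in>K. \<bar>S k\<bar> * \<bar>z x k\<bar>)"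
      by (rule order_trans[OF sum_abs]) (simp add: abs_mult)
    then have v: "\<bar>?v\<bar> \<le> ?a * ?b"
      using L2_set_mult_ineq[of S "z x" K] by linarith
    have "cosh (l * L2_set (\<lambda>k. S k + z x k) K) \<le> cosh (l * ?a) * (exp (l * ?b) - l * ?b) + ?v * C"
      unfolding L2_set_add_sqrt C_def using v l by (intro cosh_norm_add_le) auto
    also have "exp (l * ?b) - l * ?b \<le> 1 + (l * ?b)\<^sup>2 / (2 * (1 - l * b / 3))"
      using l elim by (intro exp_le_bernstein) (auto intro: mult_left_mono)
    finally show ?case by (simp add: G_def power_mult_distrib)
  qed
  have intG: "integrable M G"
    unfolding G_def using int intsq by (auto intro!: Bochner_Integration.integrable_add integrable_mult_left integrable_mult_right
      Bochner_Integration.integrable_sum)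
  have nn: "AE x in M. 0 \<le> G x"
    using le by eventually_elim (use cosh_real_pos less_le_trans in \<open>metis less_imp_le\<close>)
  have "(\<integral>\<^sup>+x. ennreal (cosh (l * L2_set (\<lambda>k. S k + z x k) K)) \<partial>M) \<le> (\<integral>\<^sup>+x. ennreal (G x) \<partial>M)"
    using le by (intro nn_integral_mono_AE) (auto intro: ennreal_leI)
  also have "\<dots> = ennreal (expectation G)"
    by (rule nn_integral_eq_integral[OF intG nn])
  also have "expectation G = cosh (l * ?a) * (1 + ?c * expectation (\<lambda>x. (L2_set (z x) K)\<^sup>2))"
  proof -
    have "expectation (\<lambda>x. (\<Sum>k\<in>K. S k * z x k) * C) = 0"
      using int mean by (simp add: Bochner_Integration.integral_sum)
    moreover have "integrable M (\<lambda>x. (\<Sum>k\<in>K. S k * z x k) * C)"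
      using int by auto
    moreover have "expectation (\<lambda>x. cosh (l * ?a) * (1 + ?c * (L2_set (z x) K)\<^sup>2)) =
        cosh (l * ?a) * (1 + ?c * expectation (\<lambda>x. (L2_set (z x) K)\<^sup>2))"
      using intsq by (simp add: Bochner_Integration.integral_add prob_space)
    ultimately show ?thesis
      unfolding G_def using intsq by (subst Bochner_Integration.integral_add) auto
  qed
  also have "\<dots> \<le> cosh (l * ?a) * (1 + ?c * \<sigma>2)"
    using var l by (intro mult_left_mono add_left_mono divide_nonneg_nonneg) (auto simp: mult.commute)
  also have "\<dots> \<le> cosh (l * ?a) * exp (?c * \<sigma>2)"
    by (intro mult_left_mono exp_ge_add_one_self) auto
  finally show ?thesis by (simp add: mult_ac ennreal_leI)
qed

lemma borel_measurable_L2_set_PiM: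
  assumes "\<And>k. k \<in> K \<Longrightarrow> (\<lambda>x. z x k) \<in> borel_measurable N"
  shows "(\<lambda>x. L2_set (\<lambda>k. \<Sum>i\<in>I. z (x i) k) K) \<in> borel_measurable (\<Pi>\<^sub>M i\<in>I. N)"
proof -
  have "(\<lambda>x. z (x i) k) \<in> borel_measurable (\<Pi>\<^sub>M i\<in>I. N)" if "k \<in> K" "i \<in> I" for k i
    by (rule measurable_compose[OF measurable_component_singleton[OF that(2), of "\<lambda>_. N"] assms[OF that(1)]])
  then show ?thesis
    unfolding L2_set_def
    by (intro measurable_compose[OF _ borel_measurable_sqrt] borel_measurable_sum borel_measurable_power) auto
qed

lemma borel_measurable_cosh_L2_set_PiM:
  assumes "\<And>k. k \<in> K \<Longrightarrow> (\<lambda>x. z x k) \<in> borel_measurable N"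
  shows "(\<lambda>x. ennreal (cosh (l * L2_set (\<lambda>k. \<Sum>i\<in>I. z (x i) k) K))) \<in> borel_measurable (\<Pi>\<^sub>M i\<in>I. N)"
  by (intro measurable_compose[OF _ measurable_ennreal] measurable_compose[OF _ borel_measurable_cosh]
      borel_measurable_times borel_measurable_const borel_measurable_L2_set_PiM assms)

text \<open>Fubini integrates out one coordinate at a time, with the others frozen in the
  \<open>S\<close> of the one-step bound. Nonnegative integrals spare a separate proof that the
  \<open>cosh\<close> moment is finite.\<close>

lemma nn_integral_PiM_cosh_L2:
  fixes z :: "'a \<Rightarrow> 'k \<Rightarrow> real"
  assumes \<nu>: "prob_space \<nu>" and K: "finite K" and meas[measurable]: "\<And>k. k \<in> K \<Longrightarrow> (\<lambda>x. z x k) \<in> borel_measurable \<nu>"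
    and bd: "AE x in \<nu>. L2_set (z x) K \<le> b"
    and mean: "\<And>k. k \<in> K \<Longrightarrow> integral\<^sup>L \<nu> (\<lambda>x. z x k) = 0"
    and var: "integral\<^sup>L \<nu> (\<lambda>x. (L2_set (z x) K)\<^sup>2) \<le> \<sigma>2"
    and l: "l \<ge> 0" "l * b < 3" and I: "finite I"
  shows "(\<integral>\<^sup>+x. ennreal (cosh (l * L2_set (\<lambda>k. \<Sum>i\<in>I. z (x i) k) K)) \<partial>(\<Pi>\<^sub>M i\<in>I. \<nu>)) \<le>
     ennreal (exp (real (card I) * (l\<^sup>2 * \<sigma>2 / (2 * (1 - l * b / 3)))))"
  using I
proof (induction I)
  case empty
  interpret E: prob_space "\<Pi>\<^sub>M i\<in>{}::'b set. \<nu>" by (intro prob_space_PiM \<nu>)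
  show ?case by (simp add: L2_set_def E.emeasure_space_1)
next
  case (insert j I)
  interpret prob_space \<nu> by (rule \<nu>)
  interpret product_prob_space "\<lambda>_::'b. \<nu>" UNIV
    by unfold_locales
  let ?E = "l\<^sup>2 * \<sigma>2 / (2 * (1 - l * b / 3))"
  have mC: "(\<lambda>x. ennreal (cosh (l * L2_set (\<lambda>k. \<Sum>i\<in>J. z (x i) k) K))) \<in> borel_measurable (\<Pi>\<^sub>M i\<in>J. \<nu>)" for J :: "'b set"
    by (rule borel_measurable_cosh_L2_set_PiM) (rule meas)
  have "(\<integral>\<^sup>+x. ennreal (cosh (l * L2_set (\<lambda>k. \<Sum>i\<in>insert j I. z (x i) k) K)) \<partial>(\<Pi>\<^sub>M i\<in>insert j I. \<nu>)) =
    (\<integral>\<^sup>+x. \<integral>\<^sup>+y. ennreal (cosh (l * L2_set (\<lambda>k. \<Sum>i\<in>insert j I. z ((x(j := y)) i) k) K)) \<partial>\<nu> \<partial>(\<Pi>\<^sub>M i\<in>I. \<nu>))"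
    by (rule product_nn_integral_insert[OF insert.hyps mC])
  also have "\<dots> = (\<integral>\<^sup>+x. \<integral>\<^sup>+y. ennreal (cosh (l * L2_set (\<lambda>k. (\<Sum>i\<in>I. z (x i) k) + z y k) K)) \<partial>\<nu> \<partial>(\<Pi>\<^sub>M i\<in>I. \<nu>))"
  proof -
    have "(\<Sum>i\<in>insert j I. z ((x(j := y)) i) k) = (\<Sum>i\<in>I. z (x i) k) + z y k" for x y k
    proof -
      have "(\<Sum>i\<in>I. z ((x(j := y)) i) k) = (\<Sum>i\<in>I. z (x i) k)"
        using insert.hyps by (intro sum.cong) auto
      then show ?thesis using insert.hyps by simp
    qed
    then show ?thesis by simp
  qed
  also have "\<dots> \<le> (\<integral>\<^sup>+x. ennreal (cosh (l * L2_set (\<lambda>k. \<Sum>i\<in>I. z (x i) k) K) * exp ?E) \<partial>(\<Pi>\<^sub>M i\<in>I. \<nu>))"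
    by (rule nn_integral_mono) (rule prob_space.cosh_L2_step[OF \<nu> K meas bd mean var l])
  also have "\<dots> = (\<integral>\<^sup>+x. ennreal (cosh (l * L2_set (\<lambda>k. \<Sum>i\<in>I. z (x i) k) K)) \<partial>(\<Pi>\<^sub>M i\<in>I. \<nu>)) * ennreal (exp ?E)"
  proof -
    from nn_integral_multc[OF mC[of I], of "ennreal (exp ?E)"] show ?thesis
      by (simp add: ennreal_mult)
  qed
  also have "\<dots> \<le> ennreal (exp (real (card I) * ?E)) * ennreal (exp ?E)"
    by (intro mult_right_mono insert.IH) auto
  also have "\<dots> = ennreal (exp (real (card (insert j I)) * ?E))"
    using insert.hyps by (simp add: distrib_right mult.commute flip: ennreal_mult exp_add add_divide_distrib)
  finally show ?case .
qed

text \<open>Markov's inequality for \<open>cosh (l * norm)\<close> under the joint law, which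
  independence turns into a product measure; \<open>exp y \<le> 2 * cosh y\<close> costs the factor
  2.\<close>

lemma (in prob_space) bernstein_L2_set:
  fixes z :: "'b \<Rightarrow> 'k \<Rightarrow> real" and X :: "'i \<Rightarrow> 'a \<Rightarrow> 'b"
  assumes indep: "indep_vars (\<lambda>_. N) X I" and I: "finite I" "I \<noteq> {}"
    and distr: "\<And>i. i \<in> I \<Longrightarrow> distr M N (X i) = \<nu>"
    and K: "finite K" and meas: "\<And>k. k \<in> K \<Longrightarrow> (\<lambda>x. z x k) \<in> borel_measurable N"
    and bd: "AE x in \<nu>. L2_set (z x) K \<le> b"
    and mean: "\<And>k. k \<in> K \<Longrightarrow> integral\<^sup>L \<nu> (\<lambda>x. z x k) = 0"
    and var: "integral\<^sup>L \<nu> (\<lambda>x. (L2_set (z x) K)\<^sup>2) \<le> \<sigma>2"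
    and pos: "\<sigma>2 > 0" "b \<ge> 0" "\<epsilon> \<ge> 0"
  shows "prob {\<omega> \<in> space M. L2_set (\<lambda>k. \<Sum>i\<in>I. z (X i \<omega>) k) K \<ge> real (card I) * \<epsilon>} \<le>
     2 * exp (- real (card I) * \<epsilon>\<^sup>2 / (2 * (\<sigma>2 + b * \<epsilon> / 3)))"
proof -
  have rv: "random_variable N (X i)" if "i \<in> I" for i
    using indep that by (auto simp: indep_vars_def)
  obtain i0 where i0: "i0 \<in> I" using I by auto
  have \<nu>: "prob_space \<nu>" using prob_space_distr[OF rv[OF i0]] distr[OF i0] by simp
  have sets: "sets \<nu> = sets N" using distr[OF i0] by (metis sets_distr)
  \<comment> \<open>Bernstein's choice: it turns \<open>1 - l * b / 3\<close> into
    \<open>\<sigma>2 / (\<sigma>2 + b * \<epsilon> / 3)\<close>, so that the moment exponent is half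
    of the Markov gain \<open>l * \<epsilon>\<close>.\<close>
  define l where "l = \<epsilon> / (\<sigma>2 + b * \<epsilon> / 3)"
  let ?n = "real (card I)" and ?D = "\<sigma>2 + b * \<epsilon> / 3"
  have D: "?D > 0" using pos by (simp add: add_pos_nonneg)
  have l0: "l \<ge> 0" using D pos by (simp add: l_def)
  have lb: "1 - l * b / 3 = \<sigma>2 / ?D" using D by (simp add: l_def field_simps)
  have lb3: "l * b < 3"
  proof -
    have "\<sigma>2 / ?D > 0" using pos D by simp
    then show ?thesis using lb by linarith
  qed
  have expo: "l\<^sup>2 * \<sigma>2 / (2 * (1 - l * b / 3)) = l * \<epsilon> / 2"
  proof -
    have "l\<^sup>2 * \<sigma>2 / (2 * (1 - l * b / 3)) = l * (l * ?D) / 2"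
      unfolding lb using pos D by (simp add: power2_eq_square field_simps)
    also have "l * ?D = \<epsilon>" using D by (simp add: l_def)
    finally show ?thesis .
  qed
  let ?F = "\<lambda>x. cosh (l * L2_set (\<lambda>k. \<Sum>i\<in>I. z (x i) k) K)"
  have eq: "distr M (\<Pi>\<^sub>M i\<in>I. N) (\<lambda>x. \<lambda>i\<in>I. X i x) = (\<Pi>\<^sub>M i\<in>I. \<nu>)"
  proof -
    have "distr M (\<Pi>\<^sub>M i\<in>I. N) (\<lambda>x. \<lambda>i\<in>I. X i x) = (\<Pi>\<^sub>M i\<in>I. distr M N (X i))"
      using indep_vars_iff_distr_eq_PiM'[OF I(2), where M' = "\<lambda>_. N" and X = X] rv indep by simp
    also have "\<dots> = (\<Pi>\<^sub>M i\<in>I. \<nu>)" by (intro PiM_cong distr refl)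
    finally show ?thesis .
  qed
  have mF: "(\<lambda>x. ennreal (?F x)) \<in> borel_measurable (\<Pi>\<^sub>M i\<in>I. N)"
    by (rule borel_measurable_cosh_L2_set_PiM) (rule meas)
  have mX: "(\<lambda>x. \<lambda>i\<in>I. X i x) \<in> measurable M (\<Pi>\<^sub>M i\<in>I. N)"
    using rv by measurable
  have R: "?F (\<lambda>i\<in>I. X i \<omega>) = ?F (\<lambda>i. X i \<omega>)" for \<omega>
    by (simp cong: sum.cong)
  have mom: "(\<integral>\<^sup>+\<omega>. ennreal (?F (\<lambda>i. X i \<omega>)) \<partial>M) \<le> ennreal (exp (?n * (l * \<epsilon> / 2)))"
  proof -
    have "(\<integral>\<^sup>+\<omega>. ennreal (?F (\<lambda>i. X i \<omega>)) \<partial>M) = (\<integral>\<^sup>+x. ennreal (?F x) \<partial>(\<Pi>\<^sub>M i\<in>I. \<nu>))"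
      unfolding eq[symmetric] R[symmetric]
      by (rule nn_integral_distr[OF mX, symmetric]) (simp add: mF)
    also have "\<dots> \<le> ennreal (exp (?n * (l\<^sup>2 * \<sigma>2 / (2 * (1 - l * b / 3)))))"
      using nn_integral_PiM_cosh_L2[OF \<nu> K _ bd mean var l0 lb3 I(1)] meas
      by (simp add: measurable_cong_sets[OF sets refl])
    finally show ?thesis unfolding expo .
  qed
  let ?A = "{\<omega> \<in> space M. L2_set (\<lambda>k. \<Sum>i\<in>I. z (X i \<omega>) k) K \<ge> ?n * \<epsilon>}"
  have mW: "(\<lambda>\<omega>. L2_set (\<lambda>k. \<Sum>i\<in>I. z (X i \<omega>) k) K) \<in> borel_measurable M"
    unfolding L2_set_def
    by (intro measurable_compose[OF _ borel_measurable_sqrt] borel_measurable_sum borel_measurable_power measurable_compose[OF rv meas]) auto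
  have mA: "?A \<in> sets M" using mW by measurable
  have "emeasure M ?A = (\<integral>\<^sup>+\<omega>. indicator ?A \<omega> \<partial>M)" using mA by simp
  also have "\<dots> \<le> (\<integral>\<^sup>+\<omega>. ennreal (2 * exp (- l * (?n * \<epsilon>))) * ennreal (?F (\<lambda>i. X i \<omega>)) \<partial>M)"
  proof (intro nn_integral_mono)
    fix \<omega> assume "\<omega> \<in> space M"
    show "indicator ?A \<omega> \<le> ennreal (2 * exp (- l * (?n * \<epsilon>))) * ennreal (?F (\<lambda>i. X i \<omega>))"
    proof (cases "\<omega> \<in> ?A")
      case True
      let ?y = "L2_set (\<lambda>k. \<Sum>i\<in>I. z (X i \<omega>) k) K"
      have "l * (?n * \<epsilon>) \<le> l * ?y" using True l0 by (intro mult_left_mono) auto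
      then have "exp (l * (?n * \<epsilon>)) \<le> exp (l * ?y)" by simp
      also have "\<dots> \<le> 2 * cosh (l * ?y)" by (simp add: cosh_def)
      finally have "1 \<le> 2 * exp (- l * (?n * \<epsilon>)) * cosh (l * ?y)"
        by (simp add: exp_minus field_simps)
      then show ?thesis using True by (simp add: ennreal_mult[symmetric] del: ennreal_1 flip: ennreal_1)
    qed simp
  qed
  also have "\<dots> = ennreal (2 * exp (- l * (?n * \<epsilon>))) * (\<integral>\<^sup>+\<omega>. ennreal (?F (\<lambda>i. X i \<omega>)) \<partial>M)"
    by (intro nn_integral_cmult measurable_compose[OF _ measurable_ennreal] measurable_compose[OF _ borel_measurable_cosh]
      borel_measurable_times borel_measurable_const mW)
  also have "\<dots> \<le> ennreal (2 * exp (- l * (?n * \<epsilon>))) * ennreal (exp (?n * (l * \<epsilon> / 2)))"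
    by (intro mult_left_mono mom) auto
  also have "\<dots> = ennreal (2 * exp (- ?n * (l * \<epsilon>) / 2))"
    by (simp add: ennreal_mult[symmetric] flip: exp_add)
  also have "- ?n * (l * \<epsilon>) / 2 = - ?n * \<epsilon>\<^sup>2 / (2 * ?D)"
    using D by (simp add: l_def power2_eq_square field_simps)
  finally show ?thesis by (simp add: emeasure_eq_measure)
qed

section \<open>Jacobi polynomials\<close>

text \<open>Up to the weight with both exponents lowered by 1, this is the derivative of
  \<open>jacobi_weight a b\<close> times \<open>p\<close>.\<close>

definition jacobi_raise :: "real \<Rightarrow> real \<Rightarrow> real poly \<Rightarrow> real poly" where
  "jacobi_raise a b p = [:b - a, - (a + b):] * p + [:1, 0, -1:] * pderiv p"

text \<open>Rodrigues' formula unrolled one derivative at a time. The recursion passes to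
  \<open>(a + 1, b + 1)\<close>, so inductions keep both parameters arbitrary.\<close>

fun jacobi_rec :: "real \<Rightarrow> real \<Rightarrow> nat \<Rightarrow> real poly" where
  "jacobi_rec a b 0 = 1"
| "jacobi_rec a b (Suc k) =
     Polynomial.smult (- 1 / (2 * real (Suc k))) (jacobi_raise (a + 1) (b + 1) (jacobi_rec (a + 1) (b + 1) k))"

lemma poly_jacobi_raise:
  "poly (jacobi_raise a b p) x = (b - a - (a + b) * x) * poly p x + (1 - x\<^sup>2) * poly (pderiv p) x"
  by (simp add: jacobi_raise_def power2_eq_square algebra_simps)

lemma DERIV_jacobi_weight_poly:
  assumes "x \<in> {-1<..<1}"
  shows "((\<lambda>t. jacobi_weight (a + 1) (b + 1) t * poly p t) has_real_derivative
     jacobi_weight a b x * poly (jacobi_raise (a + 1) (b + 1) p) x) (at x)"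
proof -
  have "poly (Polynomial.smult (- a - 1) ([:1, 1:] * p) + Polynomial.smult (b + 1) ([:1, -1:] * p) + [:1, 0, -1:] * pderiv p) x
     = poly (jacobi_raise (a + 1) (b + 1) p) x"
    by (simp add: poly_jacobi_raise power2_eq_square algebra_simps)
  then show ?thesis
    using jacobi_weight_poly_deriv[OF assms, of "a + 1" "b + 1" p] by simp
qed

text \<open>The factor \<open>(-2) ^ j * fact j\<close> undoes the normalization built into
  \<open>jacobi_rec\<close>. Equality is only known inside the interval, hence the local transfer of
  derivatives.\<close>

lemma higher_deriv_jacobi_weight:
  assumes "\<And>t. t \<in> {-1<..<1} \<Longrightarrow> f t = jacobi_weight (a + real j) (b + real j) t" "x \<in> {-1<..<1}"
  shows "(deriv ^^ j) f x = (-2) ^ j * fact j * (jacobi_weight a b x * poly (jacobi_rec a b j) x)"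
  using assms
proof (induction j arbitrary: a b x)
  case (Suc j)
  have IH: "(deriv ^^ j) f t = (-2) ^ j * fact j * (jacobi_weight (a + 1) (b + 1) t * poly (jacobi_rec (a + 1) (b + 1) j) t)"
    if "t \<in> {-1<..<1}" for t
    using Suc.IH[of "a + 1" "b + 1" t] Suc.prems(1) that by (simp add: add_ac)
  have "((deriv ^^ j) f has_real_derivative (-2) ^ j * fact j *
      (jacobi_weight a b x * poly (jacobi_raise (a + 1) (b + 1) (jacobi_rec (a + 1) (b + 1) j)) x)) (at x)"
    by (rule has_field_derivative_transform_within_open[OF
          DERIV_cmult[OF DERIV_jacobi_weight_poly[OF Suc.prems(2)]] open_greaterThanLessThan Suc.prems(2)])
       (simp add: IH)
  then have "(deriv ^^ Suc j) f x = (-2) ^ j * fact j *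
      (jacobi_weight a b x * poly (jacobi_raise (a + 1) (b + 1) (jacobi_rec (a + 1) (b + 1) j)) x)"
    by (simp add: DERIV_imp_deriv)
  then show ?case by (simp add: field_simps)
qed simp

lemma jacobi_poly_eq_rec: "jacobi_poly a b k = jacobi_rec a b k"
  unfolding jacobi_poly_def
proof (rule the1_equality[OF jacobi_poly_ex1], intro ballI)
  fix x :: real assume x: "x \<in> {-1<..<1}"
  have "jacobi_weight a b t * (1 - t\<^sup>2) ^ k = jacobi_weight (a + real k) (b + real k) t" if "t \<in> {-1<..<1}" for t
  proof -
    have "1 - t\<^sup>2 = (1 - t) * (1 + t)" by (simp add: power2_eq_square algebra_simps)
    then show ?thesis
      using that by (simp add: jacobi_weight_def powr_add powr_realpow power_mult_distrib)
  qed
  from higher_deriv_jacobi_weight[of "\<lambda>t. jacobi_weight a b t * (1 - t\<^sup>2) ^ k", OF this x]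
  have "(deriv ^^ k) (\<lambda>t. jacobi_weight a b t * (1 - t\<^sup>2) ^ k) x =
     (-2) ^ k * fact k * (jacobi_weight a b x * poly (jacobi_rec a b k) x)" .
  moreover have "jacobi_weight a b x \<noteq> 0" using x by (auto simp: jacobi_weight_def)
  moreover have "(-1) ^ k * (-2) ^ k = (2 ^ k :: real)" by (simp flip: power_mult_distrib)
  ultimately show "poly (jacobi_rec a b k) x = jacobi_rodrigues a b k x"
    by (simp add: jacobi_rodrigues_def field_simps)
qed

lemma pderiv_jacobi_raise:
  "pderiv (jacobi_raise a b p) = jacobi_raise (a + 1) (b + 1) (pderiv p) - Polynomial.smult (a + b) p"
  unfolding jacobi_raise_def
  by (rule poly_ext) (simp add: pderiv_mult pderiv_pCons pderiv_add pderiv_smult pderiv_minus algebra_simps)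

lemma jacobi_raise_smult: "jacobi_raise a b (Polynomial.smult c p) = Polynomial.smult c (jacobi_raise a b p)"
  by (simp add: jacobi_raise_def pderiv_smult smult_add_right)

lemma jacobi_raise_diff: "jacobi_raise a b (p - q) = jacobi_raise a b p - jacobi_raise a b q"
  by (rule poly_ext) (simp add: poly_jacobi_raise pderiv_diff algebra_simps)

text \<open>Jacobi's differential equation in Sturm-Liouville form. Commuting \<open>pderiv\<close>
  with \<open>jacobi_raise\<close> shifts the parameters and adds \<open>a + b + 2\<close> to the
  eigenvalue, and
  \<open>k * (k + a + b + 3) + a + b + 2 = (k + 1) * (k + a + b + 2)\<close>.\<close>

lemma jacobi_rec_ode:
  "jacobi_raise (a + 1) (b + 1) (pderiv (jacobi_rec a b k)) =
     Polynomial.smult (- (real k * (real k + a + b + 1))) (jacobi_rec a b k)"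
proof (induction k arbitrary: a b)
  case 0
  then show ?case by (simp add: jacobi_raise_def pderiv_1)
next
  case (Suc k)
  let ?q = "jacobi_rec (a + 1) (b + 1) k" and ?c = "- 1 / (2 * real (Suc k))"
  have "jacobi_raise (a + 1) (b + 1) (pderiv (jacobi_rec a b (Suc k))) =
     Polynomial.smult ?c (jacobi_raise (a + 1) (b + 1)
       (jacobi_raise (a + 1 + 1) (b + 1 + 1) (pderiv ?q) - Polynomial.smult (a + 1 + (b + 1)) ?q))"
    unfolding jacobi_rec.simps pderiv_smult pderiv_jacobi_raise jacobi_raise_smult ..
  also have "\<dots> = Polynomial.smult (?c * (- (real k * (real k + (a + 1) + (b + 1) + 1)) - (a + 1 + (b + 1))))
      (jacobi_raise (a + 1) (b + 1) ?q)"
    unfolding Suc.IH by (simp only: jacobi_raise_diff jacobi_raise_smult smult_diff_left[symmetric] smult_smult)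
  also have "?c * (- (real k * (real k + (a + 1) + (b + 1) + 1)) - (a + 1 + (b + 1))) =
      - (real (Suc k) * (real (Suc k) + a + b + 1)) * ?c"
    by (simp add: algebra_simps)
  finally show ?case by (simp only: jacobi_rec.simps smult_smult)
qed

lemma coeff_jacobi_raise:
  assumes "degree p \<le> m"
  shows "coeff (jacobi_raise a b p) (Suc m) = - (a + b + real m) * coeff p m"
proof -
  have "coeff p (Suc m) = 0" "coeff p (Suc (Suc m)) = 0" using assms by (auto intro!: coeff_eq_0)
  then show ?thesis
    by (cases m) (simp_all add: jacobi_raise_def coeff_pderiv algebra_simps)
qed

lemma degree_jacobi_raise:
  assumes "degree p \<le> m"
  shows "degree (jacobi_raise a b p) \<le> Suc m"
proof (rule degree_le, intro allI impI)
  fix i assume i: "Suc m < i"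
  then obtain j where j: "i = Suc j" "j > m" by (cases i) auto
  then have "coeff p j = 0" using assms by (auto intro!: coeff_eq_0)
  then show "coeff (jacobi_raise a b p) i = 0"
    using coeff_jacobi_raise[of p j a b] j assms by simp
qed

lemma degree_jacobi_rec: "degree (jacobi_rec a b k) \<le> k"
proof (induction k arbitrary: a b)
  case (Suc k)
  then show ?case
    using degree_jacobi_raise[OF Suc.IH] order_trans[OF degree_smult_le] by simp
qed simp

lemma coeff_jacobi_rec:
  "coeff (jacobi_rec a b k) k = pochhammer (a + b + real k + 1) k / (2 ^ k * fact k)"
proof (induction k arbitrary: a b)
  case (Suc k)
  have "coeff (jacobi_rec a b (Suc k)) (Suc k) =
     - 1 / (2 * real (Suc k)) * (- (a + 1 + (b + 1) + real k) * (pochhammer (a + 1 + (b + 1) + real k + 1) k / (2 ^ k * fact k)))"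
    by (simp add: coeff_jacobi_raise[OF degree_jacobi_rec] Suc.IH)
  also have "\<dots> = (a + b + real (Suc k) + 1) * pochhammer (a + b + real (Suc k) + 1 + 1) k / (2 ^ Suc k * fact (Suc k))"
  proof -
    have "- 1 / (2 * real (Suc k)) * (- s * (w / (2 ^ k * fact k))) = s * w / (2 ^ Suc k * fact (Suc k))" for s w :: real
      by (simp add: divide_simps)
    moreover have "a + 1 + (b + 1) + real k = a + b + real (Suc k) + 1" by simp
    ultimately show ?thesis by metis
  qed
  finally show ?case by (simp only: pochhammer_rec)
qed simp

text \<open>At \<open>1\<close> the term with \<open>1 - x\<^sup>2\<close> drops out of
  \<open>jacobi_raise\<close>, leaving a product recursion.\<close>

lemma poly_jacobi_rec_1: "poly (jacobi_rec a b k) 1 = pochhammer (a + 1) k / fact k"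
proof (induction k arbitrary: a b)
  case (Suc k)
  have "poly (jacobi_rec a b (Suc k)) 1 = (a + 1) / real (Suc k) * poly (jacobi_rec (a + 1) (b + 1) k) 1"
    by (simp add: poly_jacobi_raise divide_simps) (simp add: algebra_simps)
  then show ?case unfolding Suc.IH by (simp add: pochhammer_rec)
qed simp

lemma poly_jacobi_rec_minus_1: "poly (jacobi_rec a b k) (-1) = (-1) ^ k * (pochhammer (b + 1) k / fact k)"
proof (induction k arbitrary: a b)
  case (Suc k)
  have "poly (jacobi_rec a b (Suc k)) (-1) = - (b + 1) / real (Suc k) * poly (jacobi_rec (a + 1) (b + 1) k) (-1)"
    by (simp add: poly_jacobi_raise divide_simps) (simp add: algebra_simps)
  also have "\<dots> = (-1) ^ Suc k * ((b + 1) * pochhammer (b + 1 + 1) k / fact (Suc k))"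
  proof -
    have "- c / real (Suc k) * ((-1) ^ k * (w / fact k)) = (-1) ^ Suc k * (c * w / fact (Suc k))" for c w :: real
      by (simp add: divide_simps)
    then show ?thesis unfolding Suc.IH .
  qed
  finally show ?case by (simp only: pochhammer_rec)
qed simp

lemma pochhammer_mono:
  fixes x y :: real
  assumes "0 \<le> x" "x \<le> y"
  shows "pochhammer x k \<le> pochhammer y k"
  unfolding pochhammer_prod using assms by (intro prod_mono) auto

text \<open>Sonin's function \<open>P\<^sup>2 + (1 - x\<^sup>2) P'\<^sup>2 / \<lambda>\<close> dominates \<open>P\<^sup>2\<close>, agrees with it at \<open>\<plusminus>1\<close>, and
  its derivative changes sign at most once, from negative to positive.\<close>

lemma abs_jacobi_rec_le:
  assumes ab: "a \<ge> -1/2" "b \<ge> -1/2" and x: "x \<in> {-1..1}"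
  shows "\<bar>poly (jacobi_rec a b k) x\<bar> \<le> pochhammer (max a b + 1) k / fact k"
proof (cases "k = 0")
  case False
  define P where "P = jacobi_rec a b k"
  define l where "l = real k * (real k + a + b + 1)"
  have l: "l > 0" using False ab by (auto simp: l_def intro!: mult_pos_pos add_pos_nonneg)
  define f where "f x = (poly P x)\<^sup>2 + (1 - x\<^sup>2) * (poly (pderiv P) x)\<^sup>2 / l" for x
  \<comment> \<open>\<open>g\<close> carries the sign of the derivative of \<open>f\<close>; its
    slope \<open>a + b + 1\<close> is nonnegative because both parameters are at least
    \<open>-1/2\<close>, so \<open>f\<close> is largest at an endpoint.\<close>
  define g where "g x = (a - b) + (a + b + 1) * x" for x
  have D: "(f has_real_derivative 2 * (poly (pderiv P) x)\<^sup>2 * g x / l) (at x)" for x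
  proof -
    have D0: "(f has_real_derivative 2 * poly P x * poly (pderiv P) x +
       (- 2 * x * (poly (pderiv P) x)\<^sup>2 + (1 - x\<^sup>2) * (2 * poly (pderiv P) x * poly (pderiv (pderiv P)) x)) / l) (at x)"
      unfolding f_def using l by (auto intro!: derivative_eq_intros simp: field_simps)
    have ode: "(1 - x\<^sup>2) * poly (pderiv (pderiv P)) x =
        - l * poly P x - (b - a - (a + b + 2) * x) * poly (pderiv P) x"
      using arg_cong[OF jacobi_rec_ode[of a b k], of "\<lambda>p. poly p x"]
      by (simp add: poly_jacobi_raise P_def l_def algebra_simps)
    have "2 * poly P x * poly (pderiv P) x +
       (- 2 * x * (poly (pderiv P) x)\<^sup>2 + (1 - x\<^sup>2) * (2 * poly (pderiv P) x * poly (pderiv (pderiv P)) x)) / l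
      = 2 * poly P x * poly (pderiv P) x +
       (- 2 * x * (poly (pderiv P) x)\<^sup>2 + 2 * poly (pderiv P) x * ((1 - x\<^sup>2) * poly (pderiv (pderiv P)) x)) / l"
      by (simp add: algebra_simps)
    also have "\<dots> = 2 * (poly (pderiv P) x)\<^sup>2 * g x / l"
      unfolding ode using l by (simp add: g_def power2_eq_square field_simps)
    finally show ?thesis using D0 by simp
  qed
  have f_ge: "(poly P x)\<^sup>2 \<le> f x"
    using x l by (auto simp: f_def abs_square_le_1 abs_le_iff)
  have gmono: "g s \<le> g t" if "s \<le> t" for s t
    using that ab by (auto simp: g_def intro!: mult_left_mono)
  let ?B = "pochhammer (max a b + 1) k / fact k"
  have B0: "?B \<ge> 0" using ab by (intro divide_nonneg_nonneg pochhammer_nonneg) auto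
  have "f 1 \<le> ?B\<^sup>2"
  proof -
    have "f 1 = (pochhammer (a + 1) k / fact k)\<^sup>2" by (simp add: f_def P_def poly_jacobi_rec_1)
    also have "\<dots> \<le> ?B\<^sup>2"
      using ab by (intro power_mono divide_right_mono pochhammer_mono) (auto intro!: divide_nonneg_nonneg pochhammer_nonneg)
    finally show ?thesis .
  qed
  moreover have "f (-1) \<le> ?B\<^sup>2"
  proof -
    have "f (-1) = (pochhammer (b + 1) k / fact k)\<^sup>2"
      by (simp add: f_def P_def poly_jacobi_rec_minus_1 power_mult_distrib power_divide power2_eq_square[of "(-1) ^ k"])
    also have "\<dots> \<le> ?B\<^sup>2"
      using ab by (intro power_mono divide_right_mono pochhammer_mono) (auto intro!: divide_nonneg_nonneg pochhammer_nonneg)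
    finally show ?thesis .
  qed
  moreover have "f x \<le> f 1 \<or> f x \<le> f (-1)"
  proof (cases "g x \<ge> 0")
    case True
    have "f x \<le> f 1"
    proof (rule DERIV_nonneg_imp_nondecreasing[of x 1 f])
      show "x \<le> 1" using x by simp
      fix t assume "x \<le> t" "t \<le> 1"
      then have "g t \<ge> 0" using True gmono[of x t] by simp
      then show "\<exists>y. (f has_real_derivative y) (at t) \<and> 0 \<le> y"
        using l by (intro exI[of _ "2 * (poly (pderiv P) t)\<^sup>2 * g t / l"] conjI D) simp
    qed
    then show ?thesis ..
  next
    case False
    have "f (-1) \<ge> f x"
    proof (rule DERIV_nonpos_imp_nonincreasing[of "-1" x f])
      show "-1 \<le> x" using x by simp
      fix t assume "-1 \<le> t" "t \<le> x"
      then have "g t \<le> 0" using False gmono[of t x] by simp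
      then show "\<exists>y. (f has_real_derivative y) (at t) \<and> y \<le> 0"
        using l by (intro exI[of _ "2 * (poly (pderiv P) t)\<^sup>2 * g t / l"] conjI D)
          (simp add: divide_le_0_iff mult_le_0_iff)
    qed
    then show ?thesis ..
  qed
  ultimately have "(poly P x)\<^sup>2 \<le> ?B\<^sup>2" using f_ge by linarith
  then show ?thesis using B0 abs_le_square_iff[of "poly P x" ?B] by (simp add: P_def)
qed simp

section \<open>Orthogonality\<close>

definition jacobi_int :: "real \<Rightarrow> real \<Rightarrow> real poly \<Rightarrow> real" where
  "jacobi_int a b q = (LINT x:{-1..1}|lborel. jacobi_weight a b x * poly q x)"

lemma jacobi_weight_nonneg: "x \<in> {-1..1} \<Longrightarrow> jacobi_weight a b x \<ge> 0"
  by (simp add: jacobi_weight_def)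

lemma borel_measurable_jacobi_weight[measurable]: "jacobi_weight a b \<in> borel_measurable borel"
  unfolding jacobi_weight_def[abs_def] by measurable

lemma borel_measurable_poly[measurable]: "poly p \<in> borel_measurable (borel :: real measure)"
  by (intro borel_measurable_continuous_onI continuous_intros)

lemma has_integral_jacobi_weight:
  assumes "a > -1" "b > -1"
  shows "(jacobi_weight a b has_integral jacobi_gamma a b) {-1..1}"
proof -
  have "((\<lambda>t. t powr (b + 1 - 1) * (1 - t) powr (a + 1 - 1)) has_integral Beta (b + 1) (a + 1)) (cbox 0 1)"
    using has_integral_Beta_real[of "b + 1" "a + 1"] assms by simp
  from has_integral_affinity'[OF this, of "1/2" "1/2"]
  have "((\<lambda>x. ((1 + x) / 2) powr b * (1 - (1 + x) / 2) powr a) has_integral 2 * Beta (b + 1) (a + 1)) {-1..1}"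
    by (simp add: add_divide_distrib add.commute)
  from has_integral_mult_right[OF this, of "2 powr (a + b)"]
  have "((\<lambda>x. 2 powr (a + b) * (((1 + x) / 2) powr b * (1 - (1 + x) / 2) powr a)) has_integral
      2 powr (a + b) * (2 * Beta (b + 1) (a + 1))) {-1..1}" .
  moreover have "2 powr (a + b) * (2 * Beta (b + 1) (a + 1)) = jacobi_gamma a b"
    by (simp add: jacobi_gamma_def powr_add Beta_commute)
  moreover have "2 powr (a + b) * (((1 + x) / 2) powr b * (1 - (1 + x) / 2) powr a) = jacobi_weight a b x"
    if "x \<in> {-1..1}" for x
  proof -
    have "1 - (1 + x) / 2 = (1 - x) / 2" by (simp add: field_simps)
    then show ?thesis using that by (simp only:) (simp add: jacobi_weight_def powr_add powr_divide)
  qed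
  ultimately show ?thesis by (metis (no_types, lifting) has_integral_cong)
qed

lemma jacobi_gamma_pos:
  assumes "a > -1" "b > -1"
  shows "jacobi_gamma a b > 0"
  using assms by (simp add: jacobi_gamma_def Beta_def Gamma_real_pos)

lemma set_integrable_jacobi_weight_poly:
  assumes "a > -1" "b > -1"
  shows "set_integrable lborel {-1..1} (\<lambda>x. jacobi_weight a b x * poly p x)"
proof -
  have "jacobi_weight a b absolutely_integrable_on {-1..1}"
    by (intro nonnegative_absolutely_integrable_1 jacobi_weight_nonneg)
       (use has_integral_jacobi_weight[OF assms] in auto)
  then have w: "integrable lborel (\<lambda>x. indicator {-1..1} x *\<^sub>R jacobi_weight a b x)"
    unfolding set_integrable_def by (subst (asm) integrable_completion) auto
  have "compact (poly p ` {-1..1})"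
    by (intro compact_continuous_image continuous_intros) auto
  then obtain B where "\<forall>y\<in>poly p ` {-1..1}. norm y \<le> B"
    using compact_imp_bounded bounded_iff by metis
  then have B: "\<And>x. x \<in> {-1..1} \<Longrightarrow> \<bar>poly p x\<bar> \<le> B" by auto
  show ?thesis
    unfolding set_integrable_def
  proof (rule Bochner_Integration.integrable_bound[OF integrable_mult_right[OF w, of B]])
    show "AE x in lborel. norm (indicator {-1..1} x *\<^sub>R (jacobi_weight a b x * poly p x)) \<le>
        norm (B * (indicator {-1..1} x *\<^sub>R jacobi_weight a b x))"
    proof (intro AE_I2)
      fix x :: real
      show "norm (indicator {-1..1} x *\<^sub>R (jacobi_weight a b x * poly p x)) \<le>
        norm (B * (indicator {-1..1} x *\<^sub>R jacobi_weight a b x))"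
      proof (cases "x \<in> {-1..1}")
        case True
        have "\<bar>poly p x\<bar> \<le> \<bar>B\<bar>" using B[OF True] by simp
        then have "\<bar>jacobi_weight a b x\<bar> * \<bar>poly p x\<bar> \<le> \<bar>jacobi_weight a b x\<bar> * \<bar>B\<bar>"
          by (intro mult_left_mono) auto
        then show ?thesis using True by (simp add: abs_mult mult.commute)
      qed simp
    qed
  qed measurable
qed

lemma jacobi_int_eq_integral:
  assumes "a > -1" "b > -1"
  shows "jacobi_int a b p = integral {-1..1} (\<lambda>x. jacobi_weight a b x * poly p x)"
  unfolding jacobi_int_def by (rule set_borel_integral_eq_integral(2)[OF set_integrable_jacobi_weight_poly[OF assms]])

lemma jacobi_int_1:
  assumes "a > -1" "b > -1"
  shows "jacobi_int a b 1 = jacobi_gamma a b"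
  using has_integral_jacobi_weight[OF assms] by (simp add: jacobi_int_eq_integral[OF assms] integral_unique)

lemma jacobi_int_add:
  assumes "a > -1" "b > -1"
  shows "jacobi_int a b (p + q) = jacobi_int a b p + jacobi_int a b q"
  unfolding jacobi_int_def
  by (subst set_integral_add(2)[symmetric]) (simp_all add: set_integrable_jacobi_weight_poly assms distrib_left)

lemma jacobi_int_smult: "jacobi_int a b (Polynomial.smult c p) = c * jacobi_int a b p"
proof -
  have "jacobi_int a b (Polynomial.smult c p) = (LINT x:{-1..1}|lborel. c * (jacobi_weight a b x * poly p x))"
    unfolding jacobi_int_def by (simp add: mult_ac)
  also have "\<dots> = c * jacobi_int a b p"
    unfolding jacobi_int_def by (rule set_integral_mult_right)
  finally show ?thesis .
qed

lemma jacobi_int_0: "jacobi_int a b 0 = 0"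
  using jacobi_int_smult[of a b 0 0] by simp

lemma jacobi_int_sum:
  assumes "a > -1" "b > -1"
  shows "jacobi_int a b (\<Sum>i\<in>I. p i) = (\<Sum>i\<in>I. jacobi_int a b (p i))"
  by (induction I rule: infinite_finite_induct) (simp_all add: jacobi_int_0 jacobi_int_add[OF assms])

text \<open>The integrand is the derivative of \<open>jacobi_weight (a + 1) (b + 1)\<close> times
  \<open>p\<close>, which vanishes at both endpoints since \<open>a + 1\<close> and
  \<open>b + 1\<close> are positive. The integrand itself may be unbounded there, hence the interior
  form of the fundamental theorem.\<close>

lemma jacobi_int_raise:
  assumes "a > -1" "b > -1"
  shows "jacobi_int a b (jacobi_raise (a + 1) (b + 1) p) = 0"
proof -
  let ?f = "\<lambda>x. jacobi_weight (a + 1) (b + 1) x * poly p x"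
  have "((\<lambda>x. jacobi_weight a b x * poly (jacobi_raise (a + 1) (b + 1) p) x) has_integral ?f 1 - ?f (-1)) {-1..1}"
  proof (rule fundamental_theorem_of_calculus_interior)
    show "continuous_on {-1..1} ?f"
      unfolding jacobi_weight_def using assms
      by (intro continuous_intros continuous_on_powr') auto
    show "(?f has_vector_derivative jacobi_weight a b x * poly (jacobi_raise (a + 1) (b + 1) p) x) (at x)"
      if "x \<in> {-1<..<1}" for x
      using DERIV_jacobi_weight_poly[OF that] by (simp add: has_real_derivative_iff_has_vector_derivative)
  qed simp
  then show ?thesis
    unfolding jacobi_int_eq_integral[OF assms] by (simp add: integral_unique jacobi_weight_def)
qed

lemma jacobi_weight_shift:
  assumes "x \<in> {-1..1}"
  shows "jacobi_weight (a + 1) (b + 1) x = jacobi_weight a b x * (1 - x\<^sup>2)"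
proof -
  have e: "1 - x\<^sup>2 = (1 - x) * (1 + x)" by (simp add: power2_eq_square algebra_simps)
  show ?thesis
    using assms by (simp add: jacobi_weight_def powr_add e)
qed

text \<open>Integration by parts: up to sign, \<open>jacobi_raise\<close> and \<open>pderiv\<close>
  are adjoint between the two weights.\<close>

lemma jacobi_int_raise_mult:
  assumes "a > -1" "b > -1"
  shows "jacobi_int a b (jacobi_raise (a + 1) (b + 1) p * q) = - jacobi_int (a + 1) (b + 1) (p * pderiv q)"
proof -
  have 1: "jacobi_raise (a + 1) (b + 1) (p * q) = jacobi_raise (a + 1) (b + 1) p * q + [:1, 0, -1:] * (p * pderiv q)"
    by (rule poly_ext) (simp add: poly_jacobi_raise pderiv_mult power2_eq_square algebra_simps)
  have 2: "jacobi_int a b ([:1, 0, -1:] * (p * pderiv q)) = jacobi_int (a + 1) (b + 1) (p * pderiv q)"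
    unfolding jacobi_int_def
  proof (intro set_lebesgue_integral_cong allI impI)
    fix x :: real assume "x \<in> {-1..1}"
    from jacobi_weight_shift[OF this, of a b]
    show "jacobi_weight a b x * poly ([:1, 0, -1:] * (p * pderiv q)) x =
        jacobi_weight (a + 1) (b + 1) x * poly (p * pderiv q) x"
      by (simp only:) (simp add: power2_eq_square algebra_simps)
  qed simp
  show ?thesis
    using jacobi_int_raise[OF assms, of "p * q"] unfolding 1 jacobi_int_add[OF assms] 2 by simp
qed

lemma jacobi_int_rec_mult:
  assumes "a > -1" "b > -1"
  shows "jacobi_int a b (jacobi_rec a b k * q) =
    jacobi_int (a + real k) (b + real k) ((pderiv ^^ k) q) / (2 ^ k * fact k)"
  using assms
proof (induction k arbitrary: a b q)
  case (Suc k)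
  have "jacobi_int a b (jacobi_rec a b (Suc k) * q) =
      - 1 / (2 * real (Suc k)) * jacobi_int a b (jacobi_raise (a + 1) (b + 1) (jacobi_rec (a + 1) (b + 1) k) * q)"
    by (simp only: jacobi_rec.simps mult_smult_left jacobi_int_smult)
  also have "\<dots> = 1 / (2 * real (Suc k)) * jacobi_int (a + 1) (b + 1) (jacobi_rec (a + 1) (b + 1) k * pderiv q)"
    using Suc.prems by (simp add: jacobi_int_raise_mult)
  also have "\<dots> = 1 / (2 * real (Suc k)) *
      (jacobi_int (a + 1 + real k) (b + 1 + real k) ((pderiv ^^ k) (pderiv q)) / (2 ^ k * fact k))"
    using Suc.prems by (subst Suc.IH) auto
  also have "\<dots> = jacobi_int (a + real (Suc k)) (b + real (Suc k)) ((pderiv ^^ Suc k) q) / (2 ^ Suc k * fact (Suc k))"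
    by (simp add: funpow_swap1 add_ac divide_simps)
  finally show ?case .
qed simp

lemma higher_pderiv_eq_const:
  fixes q :: "real poly"
  assumes "degree q \<le> k"
  shows "(pderiv ^^ k) q = [:fact k * coeff q k:]"
proof (rule poly_eqI)
  fix n
  show "coeff ((pderiv ^^ k) q) n = coeff [:fact k * coeff q k:] n"
  proof (cases n)
    case 0
    then show ?thesis by (simp add: coeff_higher_pderiv pochhammer_fact)
  next
    case (Suc m)
    then show ?thesis using assms by (simp add: coeff_higher_pderiv coeff_eq_0)
  qed
qed

text \<open>After \<open>k\<close> integrations by parts only the \<open>k\<close>-th derivative of
  \<open>q\<close> is left, a constant. This one formula yields both the orthogonality and the
  norms.\<close>

lemma jacobi_int_rec_mult_degree_le:
  assumes "a > -1" "b > -1" "degree q \<le> k"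
  shows "jacobi_int a b (jacobi_rec a b k * q) = coeff q k / 2 ^ k * jacobi_gamma (a + real k) (b + real k)"
proof -
  have "[:fact k * coeff q k:] = Polynomial.smult (fact k * coeff q k) 1" by simp
  then have "jacobi_int (a + real k) (b + real k) ((pderiv ^^ k) q) =
      fact k * coeff q k * jacobi_gamma (a + real k) (b + real k)"
    unfolding higher_pderiv_eq_const[OF assms(3)] using assms(1,2)
    by (simp only: jacobi_int_smult) (simp add: jacobi_int_1)
  then show ?thesis by (simp add: jacobi_int_rec_mult assms)
qed

lemma jacobi_int_rec_orthogonal:
  assumes "a > -1" "b > -1" "k \<noteq> l"
  shows "jacobi_int a b (jacobi_rec a b k * jacobi_rec a b l) = 0"
  using \<open>k \<noteq> l\<close>
proof (induction k l rule: linorder_wlog)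
  case (le l k)
  have "jacobi_int a b (jacobi_rec a b k * jacobi_rec a b l) = 0"
  proof -
    have "degree (jacobi_rec a b l) < k" using le degree_jacobi_rec[of a b l] by simp
    then show ?thesis
      using jacobi_int_rec_mult_degree_le[OF assms(1,2), of "jacobi_rec a b l" k]
      by (simp add: coeff_eq_0)
  qed
  then show ?case by (simp add: mult.commute)
next
  case (sym l k)
  then show ?case by (simp add: mult.commute)
qed

lemma jacobi_int_rec_square:
  assumes "a \<ge> -1/2" "b \<ge> -1/2"
  shows "jacobi_int a b (jacobi_rec a b k * jacobi_rec a b k) = jacobi_h a b k"
proof (cases "k = 0")
  case True
  then show ?thesis
    using assms by (simp add: jacobi_int_1 jacobi_h_def jacobi_gamma_def Beta_def add_ac)
next
  case False
  \<comment> \<open>From \<open>k \<ge> 1\<close> all Gamma arguments below are positive, even if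
    \<open>a + b = -1\<close>.\<close>
  have k: "real k \<ge> 1" using False by simp
  let ?G = "Gamma (a + b + 2 * real k + 1)"
  have nz: "a + b + real k + 1 \<notin> \<int>\<^sub>\<le>\<^sub>0" using assms k by (auto elim!: nonpos_Ints_cases)
  have G1: "Gamma (a + b + real k + 1) > 0" and G2: "?G > 0"
    using assms k by (auto intro!: Gamma_real_pos)
  have G2': "Gamma (1 + (a + (b + 2 * real k))) \<noteq> 0" using G2 by (simp add: add_ac)
  have G3: "Gamma (a + b + 2 * real k + 1 + 1) = (a + b + 2 * real k + 1) * ?G"
    using assms k by (intro Gamma_plus1) (auto elim!: nonpos_Ints_cases)
  have "(2::real) powr (real k + real k) = 2 ^ k * 2 ^ k" by (simp only: powr_add) (simp add: powr_realpow)
  then have tw: "(2::real) powr (real k * 2) = 2 ^ k * 2 ^ k" by (simp only: mult_2_right)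
  have p: "pochhammer (a + b + real k + 1) k = ?G / Gamma (a + b + real k + 1)"
    using pochhammer_Gamma[OF nz, of k] by (simp add: add_ac)
  have "jacobi_int a b (jacobi_rec a b k * jacobi_rec a b k) =
      pochhammer (a + b + real k + 1) k / (2 ^ k * fact k) / 2 ^ k * jacobi_gamma (a + real k) (b + real k)"
    using jacobi_int_rec_mult_degree_le[of a b "jacobi_rec a b k" k] assms
    by (simp add: degree_jacobi_rec coeff_jacobi_rec)
  also have "jacobi_gamma (a + real k) (b + real k) =
      2 powr (a + b + 1) * (2 ^ k * 2 ^ k) * Gamma (a + real k + 1) * Gamma (b + real k + 1) /
      ((a + b + 2 * real k + 1) * ?G)"
    unfolding G3[symmetric]
    by (simp add: jacobi_gamma_def Beta_def powr_add tw add_ac mult_ac)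
  finally show ?thesis
    unfolding p using False G1 G2' assms k
    by (simp add: jacobi_h_def add_ac mult_ac)
qed

section \<open>The Christoffel function\<close>

text \<open>Orthonormal for the Beta law instead of the weight, so that the polynomial of degree 0
  is \<open>1\<close> and \<open>jacobi_gamma a b\<close> times the Gram matrix has mean
  \<open>I\<close>.\<close>

definition jacobi_on :: "real \<Rightarrow> real \<Rightarrow> nat \<Rightarrow> real poly" where
  "jacobi_on a b k = Polynomial.smult (sqrt (jacobi_gamma a b / jacobi_h a b k)) (jacobi_rec a b k)"

definition christoffel_sum :: "real \<Rightarrow> real \<Rightarrow> nat \<Rightarrow> real \<Rightarrow> real" where
  "christoffel_sum a b N x = (\<Sum>k\<le>N. (poly (jacobi_on a b k) x)\<^sup>2)"

text \<open>The Christoffel function at \<open>1\<close> in closed form, which for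
  \<open>a \<ge> b \<ge> -1/2\<close> is its maximum on the interval.\<close>

definition christoffel_bound :: "real \<Rightarrow> real \<Rightarrow> nat \<Rightarrow> real" where
  "christoffel_bound a b N = pochhammer (a + b + 2) N * pochhammer (a + 2) N / (fact N * pochhammer (b + 1) N)"

lemma jacobi_gamma_commute: "jacobi_gamma a b = jacobi_gamma b a"
  by (simp add: jacobi_gamma_def Beta_commute add.commute)

lemma jacobi_h_commute: "jacobi_h a b k = jacobi_h b a k"
  by (simp add: jacobi_h_def add_ac mult_ac)

lemma jacobi_h_pos:
  assumes "a \<ge> -1/2" "b \<ge> -1/2"
  shows "jacobi_h a b k > 0"
proof (cases "k = 0")
  case False
  then have "real k \<ge> 1" by simp
  then show ?thesis using assms by (auto simp: jacobi_h_def intro!: divide_pos_pos mult_pos_pos Gamma_real_pos)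
qed (use assms in \<open>auto simp: jacobi_h_def intro!: divide_pos_pos mult_pos_pos Gamma_real_pos\<close>)

lemma jacobi_h_0:
  assumes "a \<ge> -1/2" "b \<ge> -1/2"
  shows "jacobi_h a b 0 = jacobi_gamma a b"
  by (simp add: jacobi_h_def jacobi_gamma_def Beta_def add_ac)

lemma jacobi_normalized_mult:
  assumes "a \<ge> -1/2" "b \<ge> -1/2"
  shows "jacobi_gamma a b * (jacobi_normalized a b k x * jacobi_normalized a b l x) =
    poly (jacobi_on a b k) x * poly (jacobi_on a b l) x"
proof -
  have "jacobi_gamma a b > 0" using assms by (intro jacobi_gamma_pos) auto
  then have "sqrt (jacobi_gamma a b) * sqrt (jacobi_gamma a b) = jacobi_gamma a b" by simp
  moreover have "c * (p / s * (q / r)) = (t / s * p) * (t / r * q)" if "t * t = c" for c p q r s t :: real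
    by (simp flip: that)
  ultimately show ?thesis
    by (simp only: jacobi_on_def jacobi_normalized_def jacobi_poly_eq_rec real_sqrt_divide poly_smult)
qed

lemma jacobi_int_on:
  assumes "a \<ge> -1/2" "b \<ge> -1/2"
  shows "jacobi_int a b (jacobi_on a b k * jacobi_on a b l) = (if k = l then jacobi_gamma a b else 0)"
proof (cases "k = l")
  case True
  have "jacobi_gamma a b > 0" using assms by (intro jacobi_gamma_pos) auto
  then show ?thesis
    using True jacobi_int_rec_square[OF assms, of l] jacobi_h_pos[OF assms, of l]
    by (simp add: jacobi_on_def jacobi_int_smult real_sqrt_divide)
next
  case False
  then show ?thesis
    using jacobi_int_rec_orthogonal[of a b k l] assms by (simp add: jacobi_on_def jacobi_int_smult)
qed

lemma jacobi_on_0: "a \<ge> -1/2 \<Longrightarrow> b \<ge> -1/2 \<Longrightarrow> jacobi_on a b 0 = 1"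
  using jacobi_h_pos[of a b 0] by (simp add: jacobi_on_def jacobi_h_0)

text \<open>With \<open>Suc k\<close> every Gamma value is a \<open>pochhammer\<close> multiple of
  one at a positive argument, so \<open>a + b = -1\<close> is covered as well.\<close>

lemma jacobi_gamma_div_h_Suc:
  assumes "a \<ge> -1/2" "b \<ge> -1/2"
  shows "jacobi_gamma a b / jacobi_h a b (Suc k) =
    fact (Suc k) * (2 * real (Suc k) + a + b + 1) * pochhammer (a + b + 2) k /
      (pochhammer (a + 1) (Suc k) * pochhammer (b + 1) (Suc k))"
proof -
  have G: "Gamma (x + real k) = pochhammer x k * Gamma x" if "x > 0" for x :: real and k
  proof -
    have "x \<notin> \<int>\<^sub>\<le>\<^sub>0" using that by (auto elim!: nonpos_Ints_cases)
    then show ?thesis using pochhammer_Gamma[of x k] Gamma_real_pos[OF that] by simp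
  qed
  have e: "real (Suc k) + a + 1 = a + 1 + real (Suc k)" "real (Suc k) + b + 1 = b + 1 + real (Suc k)"
    "real (Suc k) + a + b + 1 = a + b + 2 + real k" "a + 1 + (b + 1) = a + b + 2"
    by simp_all
  have p: "Gamma (a + 1) > 0" "Gamma (b + 1) > 0" "Gamma (a + b + 2) > 0"
      "pochhammer (a + 1) (Suc k) > 0" "pochhammer (b + 1) (Suc k) > 0" "pochhammer (a + b + 2) k > 0"
      "2 * real (Suc k) + a + b + 1 > 0"
    using assms by (auto intro!: Gamma_real_pos pochhammer_pos)
  have h: "jacobi_h a b (Suc k) = 2 powr (a + b + 1) * (pochhammer (a + 1) (Suc k) * Gamma (a + 1)) *
      (pochhammer (b + 1) (Suc k) * Gamma (b + 1)) /
      (fact (Suc k) * (2 * real (Suc k) + a + b + 1) * (pochhammer (a + b + 2) k * Gamma (a + b + 2)))"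
    using assms unfolding jacobi_h_def e by (subst (1 2 3) G) auto
  have g: "jacobi_gamma a b = 2 powr (a + b + 1) * (Gamma (a + 1) * Gamma (b + 1) / Gamma (a + b + 2))"
    unfolding jacobi_gamma_def Beta_def e ..
  have key: "t * (A * B / C) / (t * (P * A) * (Q * B) / (F * S * (U * C))) = F * S * U / (P * Q)"
    if "t > 0" "A > 0" "B > 0" "C > 0" "P > 0" "Q > 0" "F > 0" "S > 0" "U > 0" for t A B C P Q F S U :: real
    using that by (simp add: field_simps)
  show ?thesis unfolding g h by (rule key; (rule p | simp))
qed

text \<open>Over the common denominator the induction step is \<open>(N + 1) * (N + b + 1) + (a + 1)
  * (2 * N + a + b + 3) = (N + a + b + 2) * (N + a + 2)\<close>.\<close>

lemma christoffel_bound_sum: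
  assumes "a \<ge> -1/2" "b \<ge> -1/2"
  shows "(\<Sum>k\<le>N. (pochhammer (a + 1) k / fact k)\<^sup>2 * (jacobi_gamma a b / jacobi_h a b k)) = christoffel_bound a b N"
proof (induction N)
  case 0
  show ?case using jacobi_h_pos[OF assms, of 0] by (simp add: christoffel_bound_def jacobi_h_0[OF assms])
next
  case (Suc N)
  have pos: "real N + b + 1 > 0" "pochhammer (b + 1) N > 0" "pochhammer (a + 1) (Suc N) > 0"
    using assms by (auto intro!: pochhammer_pos)
  let ?W = "pochhammer (a + b + 2) N" and ?V = "pochhammer (a + 2) N" and ?U = "pochhammer (b + 1) N"
  have "(pochhammer (a + 1) (Suc N) / fact (Suc N))\<^sup>2 * (jacobi_gamma a b / jacobi_h a b (Suc N)) =
     pochhammer (a + 1) (Suc N) * (2 * real (Suc N) + a + b + 1) * ?W / (fact (Suc N) * pochhammer (b + 1) (Suc N))"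
    unfolding jacobi_gamma_div_h_Suc[OF assms] using pos(3) by (simp add: power2_eq_square)
  also have "\<dots> = (a + 1) * ?V * (2 * real (Suc N) + a + b + 1) * ?W / ((real N + 1) * fact N * (?U * (real N + b + 1)))"
    unfolding pochhammer_rec[of "a + 1"] pochhammer_rec'[of "b + 1"] by (simp add: add_ac mult_ac)
  finally have 1: "(pochhammer (a + 1) (Suc N) / fact (Suc N))\<^sup>2 * (jacobi_gamma a b / jacobi_h a b (Suc N)) = \<dots>" .
  have 2: "christoffel_bound a b (Suc N) =
      ?W * (a + b + 2 + real N) * (?V * (a + 2 + real N)) / ((real N + 1) * fact N * (?U * (real N + b + 1)))"
    by (simp add: christoffel_bound_def pochhammer_Suc add_ac mult_ac)
  have 3: "christoffel_bound a b N =
      (real N + 1) * (real N + b + 1) * ?W * ?V / ((real N + 1) * fact N * (?U * (real N + b + 1)))"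
    using pos by (simp add: christoffel_bound_def)
  show ?case
    unfolding sum.atMost_Suc Suc.IH 1 2 3 add_divide_distrib[symmetric]
    by (rule arg_cong2[where f = "(/)"]) (simp_all add: algebra_simps)
qed

text \<open>Every polynomial obeys its endpoint bound, attained at the endpoint that belongs to
  \<open>max a b\<close>; \<open>jacobi_gamma\<close> and \<open>jacobi_h\<close> are symmetric in
  the parameters, so these bounds sum to the closed form for the ordered pair.\<close>

lemma christoffel_sum_le:
  assumes ab: "a \<ge> -1/2" "b \<ge> -1/2" and x: "x \<in> {-1..1}"
  shows "christoffel_sum a b N x \<le> christoffel_bound (max a b) (min a b) N"
proof -
  let ?m = "max a b" and ?n = "min a b"
  have g: "jacobi_gamma a b / jacobi_h a b k = jacobi_gamma ?m ?n / jacobi_h ?m ?n k" for k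
    by (auto simp: max_def min_def jacobi_gamma_commute[of b a] jacobi_h_commute[of b a])
  have "(poly (jacobi_on a b k) x)\<^sup>2 \<le> (pochhammer (?m + 1) k / fact k)\<^sup>2 * (jacobi_gamma a b / jacobi_h a b k)" for k
  proof -
    have q: "jacobi_gamma a b / jacobi_h a b k \<ge> 0"
      using jacobi_gamma_pos[of a b] jacobi_h_pos[OF ab, of k] ab by simp
    have "(poly (jacobi_on a b k) x)\<^sup>2 = (poly (jacobi_rec a b k) x)\<^sup>2 * (jacobi_gamma a b / jacobi_h a b k)"
      using q by (simp add: jacobi_on_def power_mult_distrib)
    also have "\<dots> \<le> (pochhammer (?m + 1) k / fact k)\<^sup>2 * (jacobi_gamma a b / jacobi_h a b k)"
      using abs_jacobi_rec_le[OF ab x, of k] power_mono[of "\<bar>poly (jacobi_rec a b k) x\<bar>" _ 2]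
      by (intro mult_right_mono q) simp
    finally show ?thesis .
  qed
  then have "christoffel_sum a b N x \<le> (\<Sum>k\<le>N. (pochhammer (?m + 1) k / fact k)\<^sup>2 * (jacobi_gamma a b / jacobi_h a b k))"
    unfolding christoffel_sum_def by (intro sum_mono)
  also have "\<dots> = christoffel_bound ?m ?n N"
    unfolding g by (rule christoffel_bound_sum) (use ab in auto)
  finally show ?thesis .
qed

lemma christoffel_sum_ge_1:
  assumes "a \<ge> -1/2" "b \<ge> -1/2"
  shows "christoffel_sum a b N x \<ge> 1"
proof -
  have "(poly (jacobi_on a b 0) x)\<^sup>2 \<le> christoffel_sum a b N x"
    unfolding christoffel_sum_def by (intro member_le_sum) auto
  then show ?thesis using assms by (simp add: jacobi_on_0)
qed

section \<open>Expectations under the Beta distribution\<close>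

definition beta_measure :: "real \<Rightarrow> real \<Rightarrow> real measure" where
  "beta_measure a b = density lborel (\<lambda>x. ennreal (beta_density a b x))"

lemma borel_measurable_beta_density[measurable]: "beta_density a b \<in> borel_measurable borel"
  unfolding beta_density_def[abs_def] by measurable

lemma beta_density_nonneg: "a > -1 \<Longrightarrow> b > -1 \<Longrightarrow> beta_density a b x \<ge> 0"
  using jacobi_gamma_pos[of a b] jacobi_weight_nonneg[of x a b]
  by (auto simp: beta_density_def indicator_def)

lemma integral_beta_measure:
  assumes "a > -1" "b > -1"
  shows "integrable (beta_measure a b) (poly q)"
    and "integral\<^sup>L (beta_measure a b) (poly q) = jacobi_int a b q / jacobi_gamma a b"
proof -
  let ?g = "\<lambda>x. indicator {-1..1} x * (jacobi_weight a b x * poly q x)"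
  have i: "integrable lborel ?g"
    using set_integrable_jacobi_weight_poly[OF assms] by (simp add: set_integrable_def)
  have e: "(\<lambda>x. beta_density a b x * poly q x) = (\<lambda>x. ?g x / jacobi_gamma a b)"
    by (auto simp: beta_density_def)
  show "integrable (beta_measure a b) (poly q)"
    unfolding beta_measure_def
    by (subst integrable_density) (auto simp: beta_density_nonneg assms e intro!: integrable_divide i)
  show "integral\<^sup>L (beta_measure a b) (poly q) = jacobi_int a b q / jacobi_gamma a b"
    unfolding beta_measure_def
    by (subst integral_density)
      (auto simp: beta_density_nonneg assms e jacobi_int_def set_lebesgue_integral_def)
qed

lemma prob_space_beta_measure:
  assumes "a > -1" "b > -1"
  shows "prob_space (beta_measure a b)"
proof -
  have "poly 1 = (\<lambda>_. 1 :: real)" by auto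
  then have i: "integrable (beta_measure a b) (\<lambda>_. 1 :: real)" "integral\<^sup>L (beta_measure a b) (\<lambda>_. 1 :: real) = 1"
    using integral_beta_measure[OF assms, of 1] jacobi_int_1[OF assms] jacobi_gamma_pos[OF assms] by auto
  have "(\<integral>\<^sup>+x. ennreal 1 \<partial>(beta_measure a b)) = ennreal 1"
    using nn_integral_eq_integral[OF i(1)] unfolding i(2) by simp
  then show ?thesis by (intro prob_spaceI) simp
qed

lemma AE_beta_measure: "AE x in beta_measure a b. x \<in> {-1..1}"
  unfolding beta_measure_def
  by (subst AE_density) (auto simp: beta_density_def indicator_def)

section \<open>Condition numbers of perturbed identity matrices\<close>

text \<open>By Cauchy-Schwarz against the matrix with entries \<open>v $ i * v $ j\<close>, of
  Frobenius norm \<open>(vec_norm2 v)\<^sup>2\<close>, the quadratic form of \<open>g * A\<close>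
  differs from that of the identity by a relative error of at most \<open>e\<close>. So all
  eigenvalues of \<open>g * A\<close> lie in \<open>[1 - e, 1 + e]\<close>, and \<open>g\<close>
  cancels in their ratio.\<close>

lemma cond2_le_of_near_identity:
  fixes A :: "real mat"
  assumes A: "A \<in> carrier_mat m m" "transpose_mat A = A" and m: "m > 0" and g: "g > 0"
    and e: "L2_set (\<lambda>(i, j). g * A $$ (i, j) - (if i = j then 1 else 0)) ({..<m} \<times> {..<m}) \<le> e" "e < 1"
  shows "cond2 A \<le> ereal ((1 + e) / (1 - e))"
proof -
  let ?E = "\<lambda>(i, j). g * A $$ (i, j) - (if i = j then 1 else (0::real))"
  have quad: "\<bar>g * scalar_prod v (A *\<^sub>v v) - (vec_norm2 v)\<^sup>2\<bar> \<le> e * (vec_norm2 v)\<^sup>2" if v: "v \<in> carrier_vec m" for v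
  proof -
    have n: "(vec_norm2 v)\<^sup>2 = (\<Sum>i<m. v $ i * v $ i)"
      using v by (simp flip: scalar_prod_self) (simp add: scalar_prod_def lessThan_atLeast0)
    have "scalar_prod v (A *\<^sub>v v) = (\<Sum>i<m. \<Sum>j<m. v $ i * v $ j * A $$ (i, j))"
      using A v by (simp add: scalar_prod_def lessThan_atLeast0 sum_distrib_left mult_ac)
    moreover have "(\<Sum>i<m. v $ i * v $ i) = (\<Sum>i<m. \<Sum>j<m. v $ i * v $ j * (if i = j then 1 else 0))"
      by (simp add: if_distrib cong: if_cong)
    ultimately have "g * scalar_prod v (A *\<^sub>v v) - (vec_norm2 v)\<^sup>2 = (\<Sum>i<m. \<Sum>j<m. (v $ i * v $ j) * ?E (i, j))"
      unfolding n by (simp add: sum_distrib_left sum_subtractf[symmetric] algebra_simps)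
    also have "\<dots> = (\<Sum>p\<in>{..<m} \<times> {..<m}. (v $ fst p * v $ snd p) * ?E p)"
      by (simp add: sum.cartesian_product case_prod_beta)
    finally have "\<bar>g * scalar_prod v (A *\<^sub>v v) - (vec_norm2 v)\<^sup>2\<bar> \<le>
        (\<Sum>p\<in>{..<m} \<times> {..<m}. \<bar>v $ fst p * v $ snd p\<bar> * \<bar>?E p\<bar>)"
      by (simp only:) (rule order_trans[OF sum_abs], simp add: abs_mult)
    also have "\<dots> \<le> L2_set (\<lambda>p. v $ fst p * v $ snd p) ({..<m} \<times> {..<m}) * L2_set ?E ({..<m} \<times> {..<m})"
      by (rule L2_set_mult_ineq)
    also have "L2_set (\<lambda>p. v $ fst p * v $ snd p) ({..<m} \<times> {..<m}) = (vec_norm2 v)\<^sup>2"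
    proof -
      have "(\<Sum>p\<in>{..<m} \<times> {..<m}. (v $ fst p * v $ snd p)\<^sup>2) = ((vec_norm2 v)\<^sup>2)\<^sup>2"
        unfolding n power2_eq_square[of "sum _ _"] sum_product sum.cartesian_product
        by (simp add: case_prod_beta power2_eq_square mult_ac)
      then show ?thesis by (simp only: L2_set_def real_sqrt_abs) simp
    qed
    also have "(vec_norm2 v)\<^sup>2 * L2_set ?E ({..<m} \<times> {..<m}) \<le> (vec_norm2 v)\<^sup>2 * e"
      using e by (intro mult_left_mono) auto
    finally show ?thesis by (simp add: mult.commute)
  qed
  have nv: "vec_norm2 v > 0" if "v \<in> carrier_vec m" "v \<noteq> 0\<^sub>v m" for v
    using that vec_norm2_nonneg[of v] vec_norm2_eq_0[of v m] by auto
  have pd: "pos_def_mat m A"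
    unfolding pos_def_mat_def
  proof (intro conjI A ballI impI)
    fix v :: "real vec" assume v: "v \<in> carrier_vec m" "v \<noteq> 0\<^sub>v m"
    have "e * (vec_norm2 v)\<^sup>2 < 1 * (vec_norm2 v)\<^sup>2"
      using nv[OF v] e by (intro mult_strict_right_mono) auto
    then have "g * scalar_prod v (A *\<^sub>v v) > 0" using quad[OF v(1)] by linarith
    then show "scalar_prod v (A *\<^sub>v v) > 0" using g by (simp add: zero_less_mult_iff)
  qed
  have ev: "g * k \<le> 1 + e \<and> 1 - e \<le> g * k" if k: "eigenvalue A k" for k
  proof -
    obtain v where v: "v \<in> carrier_vec m" "v \<noteq> 0\<^sub>v m" "A *\<^sub>v v = k \<cdot>\<^sub>v v"
      using k A(1) by (auto simp: eigenvalue_def eigenvector_def)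
    have "\<bar>g * k - 1\<bar> * (vec_norm2 v)\<^sup>2 \<le> e * (vec_norm2 v)\<^sup>2"
    proof -
      have "g * scalar_prod v (A *\<^sub>v v) - (vec_norm2 v)\<^sup>2 = (g * k - 1) * (vec_norm2 v)\<^sup>2"
        using v by (simp add: scalar_prod_self algebra_simps)
      then show ?thesis using quad[OF v(1)] by (simp add: abs_mult)
    qed
    then have "\<bar>g * k - 1\<bar> \<le> e" using nv[OF v(1,2)] by simp
    then show ?thesis by linarith
  qed
  have fin: "finite (spectrum A)" using card_finite_spectrum[OF A(1)] by simp
  have ne: "spectrum A \<noteq> {}"
    using pos_def_mat_norm2_eigenvalue[OF pd m] by (auto simp: spectrum_def)
  have M: "eigenvalue A (Max (spectrum A))" "eigenvalue A (Min (spectrum A))"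
    using Max_in[OF fin ne] Min_in[OF fin ne] by (auto simp: spectrum_def)
  have "Max (spectrum A) / Min (spectrum A) = (g * Max (spectrum A)) / (g * Min (spectrum A))"
    using g by simp
  also have "\<dots> \<le> (1 + e) / (1 - e)"
    using ev[OF M(1)] ev[OF M(2)] e pos_def_mat_eigenvalue_pos(1)[OF pd M(1)] g
    by (intro frac_le) auto
  finally show ?thesis by (simp add: cond2_pos_def[OF pd m])
qed

section \<open>Measurability of the condition number\<close>

lemma borel_measurable_det:
  assumes "\<And>\<omega>. A \<omega> \<in> carrier_mat m m"
    and "\<And>i j. i < m \<Longrightarrow> j < m \<Longrightarrow> (\<lambda>\<omega>. A \<omega> $$ (i, j) :: real) \<in> borel_measurable M"
  shows "(\<lambda>\<omega>. det (A \<omega>)) \<in> borel_measurable M"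
proof -
  have "(\<lambda>\<omega>. A \<omega> $$ (i, p i)) \<in> borel_measurable M" if "p permutes {0..<m}" "i \<in> {0..<m}" for p i
    using assms(2)[of i "p i"] that permutes_in_image[of p "{0..<m}" i] by auto
  then show ?thesis
    unfolding det_def'[OF assms(1)]
    by (intro borel_measurable_sum borel_measurable_times borel_measurable_prod) auto
qed

lemma borel_measurable_adj_mat:
  assumes A: "\<And>\<omega>. A \<omega> \<in> carrier_mat m m"
    and meas: "\<And>i j. i < m \<Longrightarrow> j < m \<Longrightarrow> (\<lambda>\<omega>. A \<omega> $$ (i, j) :: real) \<in> borel_measurable M"
    and ij: "i < m" "j < m"
  shows "(\<lambda>\<omega>. adj_mat (A \<omega>) $$ (i, j)) \<in> borel_measurable M"
proof -
  have "(\<lambda>\<omega>. det (mat_delete (A \<omega>) j i)) \<in> borel_measurable M"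
  proof (rule borel_measurable_det[where m = "m - 1"])
    show "mat_delete (A \<omega>) j i \<in> carrier_mat (m - 1) (m - 1)" for \<omega>
      by (rule mat_delete_carrier[OF A])
    show "(\<lambda>\<omega>. mat_delete (A \<omega>) j i $$ (i', j')) \<in> borel_measurable M" if "i' < m - 1" "j' < m - 1" for i' j'
      using that A unfolding mat_delete_def by (auto simp: carrier_matD[OF A] intro!: meas)
  qed
  then show ?thesis
    using ij by (simp add: adj_mat_def carrier_matD[OF A] cofactor_def)
qed

text \<open>The supremum runs over an uncountable sphere, but in homogeneous form the inequality
  extends by continuity from rational vectors, which need not have norm 1, to all vectors.\<close>

lemma mat_norm2_le_iff_rational:
  assumes A: "A \<in> carrier_mat m m" and m: "m > 0"
  shows "mat_norm2 A \<le> c \<longleftrightarrow>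
    (\<forall>q::nat \<Rightarrow> rat. vec_norm2 (A *\<^sub>v Matrix.vec m (\<lambda>i. of_rat (q i))) \<le> c * vec_norm2 (Matrix.vec m (\<lambda>i. of_rat (q i))))"
    (is "_ \<longleftrightarrow> (\<forall>q. ?P q)")
proof
  obtain v where v: "v \<in> carrier_vec m" "vec_norm2 v = 1" "vec_norm2 (A *\<^sub>v v) = mat_norm2 A"
    and le: "\<And>w. w \<in> carrier_vec m \<Longrightarrow> vec_norm2 (A *\<^sub>v w) \<le> mat_norm2 A * vec_norm2 w"
    using mat_norm2_attained[OF A m] by metis
  {
    assume c: "mat_norm2 A \<le> c"
    show "\<forall>q. ?P q"
    proof
      fix q :: "nat \<Rightarrow> rat"
      let ?w = "Matrix.vec m (\<lambda>i. of_rat (q i)) :: real vec"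
      have "vec_norm2 (A *\<^sub>v ?w) \<le> mat_norm2 A * vec_norm2 ?w" by (rule le) simp
      also have "\<dots> \<le> c * vec_norm2 ?w" by (intro mult_right_mono c vec_norm2_nonneg)
      finally show "?P q" .
    qed
  next
    assume P: "\<forall>q. ?P q"
    have "\<exists>q::nat \<Rightarrow> rat. (\<lambda>k. of_rat (q k)) \<longlonglongrightarrow> x" for x :: real
    proof -
      have "\<exists>r::rat. x < of_rat r \<and> of_rat r < x + 1 / real (Suc k)" for k
        using of_rat_dense[of x "x + 1 / real (Suc k)"] by simp
      then obtain q where q: "\<And>k. x < of_rat (q k) \<and> of_rat (q k) < x + 1 / real (Suc k)" by metis
      have "(\<lambda>k. x + 1 / real (Suc k)) \<longlonglongrightarrow> x + 0"
        by (intro tendsto_intros LIMSEQ_Suc lim_1_over_n)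
      moreover have "x \<le> of_rat (q k)" "of_rat (q k) \<le> x + 1 / real (Suc k)" for k
        using q less_imp_le by blast+
      ultimately have "(\<lambda>k. of_rat (q k)) \<longlonglongrightarrow> x"
        by (intro tendsto_sandwich[of "\<lambda>_. x" "\<lambda>k. of_rat (q k)" sequentially "\<lambda>k. x + 1 / real (Suc k)"]
          always_eventually allI) auto
      then show ?thesis by blast
    qed
    then have "\<forall>i. \<exists>q::nat \<Rightarrow> rat. (\<lambda>k. of_rat (q k)) \<longlonglongrightarrow> v $ i" by blast
    from choice[OF this] obtain q :: "nat \<Rightarrow> nat \<Rightarrow> rat"
      where "\<forall>i. (\<lambda>k. of_rat (q i k)) \<longlonglongrightarrow> v $ i" ..
    then have q: "(\<lambda>k. of_rat (q i k)) \<longlonglongrightarrow> v $ i" for i ..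
    let ?w = "\<lambda>k. Matrix.vec m (\<lambda>i. of_rat (q i k)) :: real vec"
    have norm: "vec_norm2 (Matrix.vec m f) = sqrt (\<Sum>i<m. (f i)\<^sup>2)"
      "vec_norm2 (A *\<^sub>v Matrix.vec m f) = sqrt (\<Sum>i<m. (\<Sum>j<m. A $$ (i, j) * f j)\<^sup>2)" for f
      using A by (simp_all add: vec_norm2_eq scalar_prod_def lessThan_atLeast0)
    have vv: "v = Matrix.vec m (\<lambda>i. v $ i)" using v(1) by (intro eq_vecI) auto
    have 1: "(\<lambda>k. vec_norm2 (?w k)) \<longlonglongrightarrow> vec_norm2 v"
      unfolding norm by (subst vv, unfold norm) (intro tendsto_real_sqrt tendsto_sum tendsto_power q)
    have 2: "(\<lambda>k. vec_norm2 (A *\<^sub>v ?w k)) \<longlonglongrightarrow> vec_norm2 (A *\<^sub>v v)"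
      unfolding norm by (subst vv, unfold norm)
        (intro tendsto_real_sqrt tendsto_sum tendsto_power tendsto_mult tendsto_const q)
    have "vec_norm2 (A *\<^sub>v v) \<le> c * vec_norm2 v"
      using P by (intro LIMSEQ_le[OF 2 tendsto_mult[OF tendsto_const 1]]) auto
    then show "mat_norm2 A \<le> c" using v by simp
  }
qed

lemma borel_measurable_mat_norm2:
  assumes A: "\<And>\<omega>. A \<omega> \<in> carrier_mat m m" and m: "m > 0"
    and meas: "\<And>i j. i < m \<Longrightarrow> j < m \<Longrightarrow> (\<lambda>\<omega>. A \<omega> $$ (i, j) :: real) \<in> borel_measurable M"
  shows "(\<lambda>\<omega>. mat_norm2 (A \<omega>)) \<in> borel_measurable M"
proof (rule borel_measurable_iff_le[THEN iffD2], intro allI)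
  fix c :: real
  \<comment> \<open>Lists padded with zeros replace functions from \<open>nat\<close> to
    \<open>rat\<close>, since they form a countable type.\<close>
  let ?w = "\<lambda>q. Matrix.vec m (\<lambda>i. of_rat (if i < length q then q ! i else 0)) :: real vec"
  have surj: "\<exists>q'::rat list. \<forall>i<m. (if i < length q' then q' ! i else 0) = q i" for q :: "nat \<Rightarrow> rat"
    by (intro exI[of _ "map q [0..<m]"]) auto
  have "mat_norm2 (A \<omega>) \<le> c \<longleftrightarrow> (\<forall>q::rat list. vec_norm2 (A \<omega> *\<^sub>v ?w q) \<le> c * vec_norm2 (?w q))" for \<omega>
  proof -
    have "(\<forall>q::nat \<Rightarrow> rat. vec_norm2 (A \<omega> *\<^sub>v Matrix.vec m (\<lambda>i. of_rat (q i))) \<le> c * vec_norm2 (Matrix.vec m (\<lambda>i. of_rat (q i)))) \<longleftrightarrow>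
      (\<forall>q::rat list. vec_norm2 (A \<omega> *\<^sub>v ?w q) \<le> c * vec_norm2 (?w q))"
    proof (intro iffI allI)
      fix q :: "nat \<Rightarrow> rat"
      assume *: "\<forall>q::rat list. vec_norm2 (A \<omega> *\<^sub>v ?w q) \<le> c * vec_norm2 (?w q)"
      obtain q' :: "rat list" where "\<forall>i<m. (if i < length q' then q' ! i else 0) = q i" using surj by blast
      then have "?w q' = Matrix.vec m (\<lambda>i. of_rat (q i))" by (intro eq_vecI) auto
      then show "vec_norm2 (A \<omega> *\<^sub>v Matrix.vec m (\<lambda>i. of_rat (q i))) \<le> c * vec_norm2 (Matrix.vec m (\<lambda>i. of_rat (q i)))"
        using * by metis
    next
      fix q :: "rat list"
      assume *: "\<forall>q::nat \<Rightarrow> rat. vec_norm2 (A \<omega> *\<^sub>v Matrix.vec m (\<lambda>i. of_rat (q i))) \<le> c * vec_norm2 (Matrix.vec m (\<lambda>i. of_rat (q i)))"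
      show "vec_norm2 (A \<omega> *\<^sub>v ?w q) \<le> c * vec_norm2 (?w q)"
        using *[rule_format, of "\<lambda>i. if i < length q then q ! i else 0"] .
    qed
    then show ?thesis unfolding mat_norm2_le_iff_rational[OF A m] .
  qed
  then have "{\<omega> \<in> space M. mat_norm2 (A \<omega>) \<le> c} = {\<omega> \<in> space M. \<forall>q::rat list. vec_norm2 (A \<omega> *\<^sub>v ?w q) \<le> c * vec_norm2 (?w q)}"
    by simp
  moreover have "(\<lambda>\<omega>. vec_norm2 (A \<omega> *\<^sub>v ?w q)) \<in> borel_measurable M" for q
    unfolding vec_norm2_eq using meas
    by (auto simp: carrier_matD[OF A] scalar_prod_def
      intro!: measurable_compose[OF _ borel_measurable_sqrt] borel_measurable_sum borel_measurable_power borel_measurable_times)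
  ultimately show "{\<omega> \<in> space M. mat_norm2 (A \<omega>) \<le> c} \<in> sets M" by simp
qed

text \<open>Cramer's rule writes the inverse through determinants, which makes its entries
  measurable functions of those of \<open>A\<close>.\<close>

lemma cond2_eq:
  assumes A: "A \<in> carrier_mat m m"
  shows "cond2 A = (if det A = 0 then \<infinity> else ereal (mat_norm2 A * mat_norm2 (inverse (det A) \<cdot>\<^sub>m adj_mat A)))"
proof (cases "det A = 0")
  case True
  then show ?thesis using cond2_singular[OF A] by simp
next
  case False
  obtain B where B: "mat_inverse A = Some B"
    using det_non_zero_imp_unit[OF A False, of "()"] mat_inverse(1)[OF A, of "()"]
    by (cases "mat_inverse A") auto
  then have AB: "A * B = 1\<^sub>m m" "B * A = 1\<^sub>m m" "B \<in> carrier_mat m m"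
    using mat_inverse(2)[OF A] by auto
  let ?C = "inverse (det A) \<cdot>\<^sub>m adj_mat A"
  have C: "?C \<in> carrier_mat m m" using adj_mat[OF A] by simp
  have "A * ?C = inverse (det A) \<cdot>\<^sub>m (A * adj_mat A)"
    using A adj_mat(1)[OF A] by (rule mult_smult_distrib)
  also have "\<dots> = 1\<^sub>m m"
    using False unfolding adj_mat(2)[OF A] by (intro eq_matI) auto
  finally have AC: "A * ?C = 1\<^sub>m m" .
  have "B = B * (A * ?C)" using AB by (simp add: AC)
  also have "\<dots> = B * A * ?C" using AB A C by (intro assoc_mult_mat[symmetric]) auto
  also have "\<dots> = ?C" using AB(2) left_mult_one_mat[OF C] by simp
  finally show ?thesis using False B by (simp add: cond2_def)
qed

lemma sets_cond2_le:
  assumes A: "\<And>\<omega>. A \<omega> \<in> carrier_mat m m" and m: "m > 0"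
    and meas: "\<And>i j. i < m \<Longrightarrow> j < m \<Longrightarrow> (\<lambda>\<omega>. A \<omega> $$ (i, j)) \<in> borel_measurable M"
  shows "{\<omega> \<in> space M. cond2 (A \<omega>) \<le> ereal c} \<in> sets M"
proof -
  let ?C = "\<lambda>\<omega>. inverse (det (A \<omega>)) \<cdot>\<^sub>m adj_mat (A \<omega>)"
  have [measurable]: "(\<lambda>\<omega>. det (A \<omega>)) \<in> borel_measurable M"
    by (rule borel_measurable_det[OF A meas])
  have [measurable]: "(\<lambda>\<omega>. mat_norm2 (A \<omega>)) \<in> borel_measurable M"
    by (rule borel_measurable_mat_norm2[OF A m meas])
  have [measurable]: "(\<lambda>\<omega>. mat_norm2 (?C \<omega>)) \<in> borel_measurable M"
  proof (rule borel_measurable_mat_norm2[OF _ m])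
    show "?C \<omega> \<in> carrier_mat m m" for \<omega> using adj_mat(1)[OF A] by simp
    fix i j assume ij: "i < m" "j < m"
    have "(\<lambda>\<omega>. inverse (det (A \<omega>)) * adj_mat (A \<omega>) $$ (i, j)) \<in> borel_measurable M"
      using borel_measurable_adj_mat[OF A meas ij] by measurable
    moreover have "?C \<omega> $$ (i, j) = inverse (det (A \<omega>)) * adj_mat (A \<omega>) $$ (i, j)" for \<omega>
      using ij carrier_matD[OF adj_mat(1)[OF A, of \<omega>]] by simp
    ultimately show "(\<lambda>\<omega>. ?C \<omega> $$ (i, j)) \<in> borel_measurable M" by simp
  qed
  have "{\<omega> \<in> space M. cond2 (A \<omega>) \<le> ereal c} =
      {\<omega> \<in> space M. det (A \<omega>) \<noteq> 0 \<and> mat_norm2 (A \<omega>) * mat_norm2 (?C \<omega>) \<le> c}"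
    by (auto simp: cond2_eq[OF A] split: if_splits)
  also have "\<dots> \<in> sets M" by measurable
  finally show ?thesis .
qed

section \<open>The random Gram matrix\<close>

text \<open>The Christoffel function as an object of type \<open>real poly\<close>, to which the
  integration lemmas apply.\<close>

definition christoffel_poly :: "real \<Rightarrow> real \<Rightarrow> nat \<Rightarrow> real poly" where
  "christoffel_poly a b N = (\<Sum>k\<le>N. jacobi_on a b k * jacobi_on a b k)"

lemma poly_christoffel_poly: "poly (christoffel_poly a b N) = christoffel_sum a b N"
  by (rule ext) (simp add: christoffel_poly_def christoffel_sum_def poly_sum power2_eq_square)

lemma integral_beta_measure_on:
  assumes "a \<ge> -1/2" "b \<ge> -1/2"
  shows "integral\<^sup>L (beta_measure a b) (\<lambda>x. poly (jacobi_on a b k) x * poly (jacobi_on a b l) x) = (if k = l then 1 else 0)"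
proof -
  have "integral\<^sup>L (beta_measure a b) (poly (jacobi_on a b k * jacobi_on a b l)) = (if k = l then 1 else 0)"
    using assms jacobi_gamma_pos[of a b] by (subst integral_beta_measure) (auto simp: jacobi_int_on)
  moreover have "poly (jacobi_on a b k * jacobi_on a b l) = (\<lambda>x. poly (jacobi_on a b k) x * poly (jacobi_on a b l) x)"
    by (rule ext) simp
  ultimately show ?thesis by simp
qed

lemma integral_christoffel_sum:
  assumes "a \<ge> -1/2" "b \<ge> -1/2"
  shows "integral\<^sup>L (beta_measure a b) (christoffel_sum a b N) = real (N + 1)"
proof -
  have "integral\<^sup>L (beta_measure a b) (christoffel_sum a b N) =
      (\<Sum>k\<le>N. integral\<^sup>L (beta_measure a b) (\<lambda>x. poly (jacobi_on a b k) x * poly (jacobi_on a b k) x))"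
    unfolding christoffel_sum_def power2_eq_square
  proof (intro Bochner_Integration.integral_sum)
    fix k
    have "poly (jacobi_on a b k * jacobi_on a b k) = (\<lambda>x. poly (jacobi_on a b k) x * poly (jacobi_on a b k) x)"
      by (rule ext) simp
    then show "integrable (beta_measure a b) (\<lambda>x. poly (jacobi_on a b k) x * poly (jacobi_on a b k) x)"
      using integral_beta_measure(1)[of a b "jacobi_on a b k * jacobi_on a b k"] assms by simp
  qed
  then show ?thesis by (simp add: integral_beta_measure_on[OF assms])
qed

lemma integrable_christoffel_sum:
  assumes "a \<ge> -1/2" "b \<ge> -1/2"
  shows "integrable (beta_measure a b) (christoffel_sum a b N)"
    and "integrable (beta_measure a b) (\<lambda>x. (christoffel_sum a b N x)\<^sup>2)"
proof -
  show "integrable (beta_measure a b) (christoffel_sum a b N)"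
    using integral_beta_measure(1)[of a b "christoffel_poly a b N"] assms by (simp add: poly_christoffel_poly)
  have "poly (christoffel_poly a b N * christoffel_poly a b N) = (\<lambda>x. (christoffel_sum a b N x)\<^sup>2)"
    by (rule ext) (simp add: poly_christoffel_poly power2_eq_square)
  then show "integrable (beta_measure a b) (\<lambda>x. (christoffel_sum a b N x)\<^sup>2)"
    using integral_beta_measure(1)[of a b "christoffel_poly a b N * christoffel_poly a b N"] assms by simp
qed

text \<open>The Christoffel function has mean \<open>N + 1\<close> under the Beta law, and a mean
  does not exceed an upper bound.\<close>

lemma le_christoffel_bound:
  assumes ab: "a \<ge> -1/2" "b \<ge> -1/2"
    and R: "\<And>x. x \<in> {-1..1} \<Longrightarrow> christoffel_sum a b N x \<le> R"
  shows "real (N + 1) \<le> R"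
proof -
  interpret prob_space "beta_measure a b" by (intro prob_space_beta_measure) (use ab in auto)
  have "expectation (christoffel_sum a b N) \<le> expectation (\<lambda>_. R)"
    using AE_beta_measure[of a b]
    by (intro integral_mono_AE integrable_christoffel_sum ab) (auto simp: R)
  then show ?thesis by (simp add: integral_christoffel_sum[OF ab] prob_space)
qed

text \<open>Integrate \<open>0 \<le> (R - K) * (K - r)\<close> for the Christoffel function
  \<open>K\<close>, whose mean is \<open>N + 1\<close>. A larger minorant \<open>r\<close> lowers
  the bound since \<open>N + 1 \<le> R\<close>.\<close>

lemma christoffel_second_moment_le:
  assumes ab: "a \<ge> -1/2" "b \<ge> -1/2"
    and R: "\<And>x. x \<in> {-1..1} \<Longrightarrow> christoffel_sum a b N x \<le> R"
    and r: "\<And>x. x \<in> {-1..1} \<Longrightarrow> r \<le> christoffel_sum a b N x"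
  shows "integral\<^sup>L (beta_measure a b) (\<lambda>x. (christoffel_sum a b N x)\<^sup>2) \<le> (R + r) * real (N + 1) - R * r"
proof -
  interpret prob_space "beta_measure a b" by (intro prob_space_beta_measure) (use ab in auto)
  note int = integrable_christoffel_sum[OF ab, of N]
  have "expectation (\<lambda>x. (christoffel_sum a b N x)\<^sup>2) \<le> expectation (\<lambda>x. (R + r) * christoffel_sum a b N x - R * r)"
  proof (intro integral_mono_AE int)
    show "AE x in beta_measure a b. (christoffel_sum a b N x)\<^sup>2 \<le> (R + r) * christoffel_sum a b N x - R * r"
      using AE_beta_measure[of a b]
    proof eventually_elim
      case (elim x)
      have "0 \<le> (R - christoffel_sum a b N x) * (christoffel_sum a b N x - r)"
        using R[OF elim] r[OF elim] by simp
      then show ?case by (simp add: power2_eq_square algebra_simps)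
    qed
  qed (use int in auto)
  also have "\<dots> = (R + r) * real (N + 1) - R * r"
    using int by (simp add: integral_christoffel_sum[OF ab] prob_space)
  finally show ?thesis .
qed

definition gram_deviation :: "real \<Rightarrow> real \<Rightarrow> real \<Rightarrow> nat \<times> nat \<Rightarrow> real" where
  "gram_deviation a b x = (\<lambda>(k, l). poly (jacobi_on a b k) x * poly (jacobi_on a b l) x - (if k = l then 1 else 0))"

text \<open>For a vector \<open>p\<close> of length \<open>d\<close>, the squared Frobenius norm of
  \<open>p p^T - I\<close> is \<open>|p|^4 - 2 |p|^2 + d\<close>; here \<open>|p|^2\<close> is the
  Christoffel function.\<close>

lemma L2_set_gram_deviation:
  "(L2_set (gram_deviation a b x) ({..<N + 1} \<times> {..<N + 1}))\<^sup>2 =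
     (christoffel_sum a b N x)\<^sup>2 - 2 * christoffel_sum a b N x + real (N + 1)"
proof -
  define m where "m = N + 1"
  let ?p = "\<lambda>k. poly (jacobi_on a b k) x"
  have c: "christoffel_sum a b N x = (\<Sum>k<m. (?p k)\<^sup>2)"
    by (simp add: christoffel_sum_def m_def lessThan_Suc_atMost)
  have "(L2_set (gram_deviation a b x) ({..<m} \<times> {..<m}))\<^sup>2 =
      (\<Sum>k<m. \<Sum>l<m. (?p k * ?p l - (if k = l then 1 else 0))\<^sup>2)"
    unfolding L2_set_power2 gram_deviation_def by (simp add: sum.cartesian_product case_prod_beta)
  also have "\<dots> = (\<Sum>k<m. \<Sum>l<m. (?p k)\<^sup>2 * (?p l)\<^sup>2 + (if k = l then 1 - 2 * (?p k)\<^sup>2 else 0))"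
    by (intro sum.cong refl) (auto simp: power2_eq_square algebra_simps)
  also have "\<dots> = (\<Sum>k<m. (?p k)\<^sup>2) * (\<Sum>l<m. (?p l)\<^sup>2) + (\<Sum>k<m. 1 - 2 * (?p k)\<^sup>2)"
    by (simp add: sum.distrib sum_product cong: if_cong)
  also have "\<dots> = (christoffel_sum a b N x)\<^sup>2 - 2 * christoffel_sum a b N x + real m"
    unfolding c by (simp add: sum_subtractf power2_eq_square flip: sum_distrib_left)
  finally show ?thesis unfolding m_def .
qed

lemma sets_cond2_jacobi_gram_le:
  assumes rv: "\<And>j. j \<in> {1..n} \<Longrightarrow> X j \<in> borel_measurable M"
  shows "{\<omega> \<in> space M. cond2 (jacobi_gram a b N n (\<lambda>j. X j \<omega>)) \<le> ereal c} \<in> sets M"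
proof (rule sets_cond2_le)
  show "jacobi_gram a b N n (\<lambda>j. X j \<omega>) \<in> carrier_mat (N + 1) (N + 1)" for \<omega>
    by (simp add: jacobi_gram_def)
  show "(\<lambda>\<omega>. jacobi_gram a b N n (\<lambda>j. X j \<omega>) $$ (i, j)) \<in> borel_measurable M" if "i < N + 1" "j < N + 1" for i j
  proof -
    have "(\<lambda>\<omega>. jacobi_normalized a b k (X m \<omega>)) \<in> borel_measurable M" if "m \<in> {1..n}" for k m
      unfolding jacobi_normalized_def
      by (intro borel_measurable_divide measurable_compose[OF rv[OF that] borel_measurable_poly]) auto
    then have "(\<lambda>\<omega>. 1 / real n * (\<Sum>m = 1..n. jacobi_normalized a b i (X m \<omega>) * jacobi_normalized a b j (X m \<omega>))) \<in> borel_measurable M"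
      by (intro borel_measurable_times borel_measurable_sum) auto
    then show ?thesis using that by (simp add: jacobi_gram_def)
  qed
qed simp

lemma (in prob_space) cond2_jacobi_gram_tail:
  assumes ab: "a \<ge> -1/2" "b \<ge> -1/2" and n: "n > 0"
    and R: "\<And>x. x \<in> {-1..1} \<Longrightarrow> christoffel_sum a b N x \<le> R"
    and r: "\<And>x. x \<in> {-1..1} \<Longrightarrow> r \<le> christoffel_sum a b N x"
    and indep: "indep_vars (\<lambda>_. borel) X {1..n}"
    and distr: "\<And>j. j \<in> {1..n} \<Longrightarrow> distributed M lborel (X j) (\<lambda>x. ennreal (beta_density a b x))"
    and e: "0 \<le> \<epsilon>" "\<epsilon> < 1"
    and s: "(R - real (N + 1)) * (real (N + 1) - r) + (real (N + 1))\<^sup>2 - real (N + 1) \<le> \<sigma>2" "\<sigma>2 > 0"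
  shows "prob {\<omega> \<in> space M. cond2 (jacobi_gram a b N n (\<lambda>j. X j \<omega>)) \<le> ereal ((1 + \<epsilon>) / (1 - \<epsilon>))} \<ge>
    1 - 2 * exp (- real n * \<epsilon>\<^sup>2 / (2 * (\<sigma>2 + R * \<epsilon> / 3)))"
proof -
  let ?K = "{..<N + 1} \<times> {..<N + 1}"
  let ?S = "\<lambda>\<omega>. L2_set (\<lambda>p. \<Sum>j\<in>{1..n}. gram_deviation a b (X j \<omega>) p) ?K"
  let ?A = "\<lambda>\<omega>. jacobi_gram a b N n (\<lambda>j. X j \<omega>)"
  let ?d = "real (N + 1)"
  have ab': "a > -1" "b > -1" using ab by auto
  have dR: "?d \<le> R" by (rule le_christoffel_bound[OF ab R])
  have rv: "X j \<in> borel_measurable M" if "j \<in> {1..n}" for j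
    using indep that by (auto simp: indep_vars_def)
  have mpoly: "(\<lambda>x. gram_deviation a b x p) \<in> borel_measurable borel" for p
    unfolding gram_deviation_def by (cases p) simp
  have bound: "prob {\<omega> \<in> space M. ?S \<omega> \<ge> real (card {1..n}) * \<epsilon>} \<le>
      2 * exp (- real (card {1..n}) * \<epsilon>\<^sup>2 / (2 * (\<sigma>2 + R * \<epsilon> / 3)))"
  proof (rule bernstein_L2_set[where N = borel and \<nu> = "beta_measure a b"])
    show "indep_vars (\<lambda>_. borel) X {1..n}" by (rule indep)
    show "distr M borel (X i) = beta_measure a b" if "i \<in> {1..n}" for i
    proof -
      have "distr M borel (X i) = distr M lborel (X i)" by (intro distr_cong) auto
      then show ?thesis using distributed_distr_eq_density[OF distr[OF that]] by (simp add: beta_measure_def)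
    qed
    show "AE x in beta_measure a b. L2_set (gram_deviation a b x) ?K \<le> R"
      using AE_beta_measure[of a b]
    proof eventually_elim
      case (elim x)
      let ?c = "christoffel_sum a b N x"
      have c: "1 \<le> ?c" "?c \<le> R" using christoffel_sum_ge_1[OF ab] R[OF elim] by auto
      \<comment> \<open>The squared norm is \<open>(?c - 1)\<^sup>2 + ?d - 1\<close>, increasing in
        \<open>?c \<ge> 1\<close>; at \<open>?c = R\<close> it is at most \<open>R\<^sup>2\<close>
        because \<open>?d \<le> R\<close>.\<close>
      have "(?c - 1)\<^sup>2 \<le> (R - 1)\<^sup>2" using c by (intro power_mono) auto
      then have "?c\<^sup>2 - 2 * ?c + 1 \<le> R\<^sup>2 - 2 * R + 1" by (simp add: power2_diff)
      then have "(L2_set (gram_deviation a b x) ?K)\<^sup>2 \<le> R\<^sup>2"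
        unfolding L2_set_gram_deviation using c dR by linarith
      then show ?case by (rule power2_le_imp_le) (use c in linarith)
    qed
    show "integral\<^sup>L (beta_measure a b) (\<lambda>x. gram_deviation a b x p) = 0" for p
    proof -
      interpret B: prob_space "beta_measure a b" by (intro prob_space_beta_measure ab')
      obtain k l where p: "p = (k, l)" by (cases p)
      have "integrable (beta_measure a b) (\<lambda>x. poly (jacobi_on a b k) x * poly (jacobi_on a b l) x)"
      proof -
        have "poly (jacobi_on a b k * jacobi_on a b l) = (\<lambda>x. poly (jacobi_on a b k) x * poly (jacobi_on a b l) x)"
          by (rule ext) simp
        then show ?thesis
          using integral_beta_measure(1)[OF ab', of "jacobi_on a b k * jacobi_on a b l"] by simp
      qed
      then show ?thesis
        by (simp add: p gram_deviation_def integral_beta_measure_on[OF ab] B.prob_space)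
    qed
    show "integral\<^sup>L (beta_measure a b) (\<lambda>x. (L2_set (gram_deviation a b x) ?K)\<^sup>2) \<le> \<sigma>2"
    proof -
      interpret B: prob_space "beta_measure a b" by (intro prob_space_beta_measure ab')
      have "integral\<^sup>L (beta_measure a b) (\<lambda>x. (L2_set (gram_deviation a b x) ?K)\<^sup>2) =
          integral\<^sup>L (beta_measure a b) (\<lambda>x. (christoffel_sum a b N x)\<^sup>2) - ?d"
        unfolding L2_set_gram_deviation using integrable_christoffel_sum[OF ab, of N]
        by (simp add: integral_christoffel_sum[OF ab] B.prob_space)
      also have "\<dots> \<le> (R + r) * ?d - R * r - ?d"
        using christoffel_second_moment_le[OF ab R r] by simp
      also have "\<dots> = (R - ?d) * (?d - r) + ?d\<^sup>2 - ?d"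
        by (simp add: power2_eq_square algebra_simps)
      finally show ?thesis using s by simp
    qed
  qed (use n e s dR mpoly in auto)
  have car: "?A \<omega> \<in> carrier_mat (N + 1) (N + 1)" for \<omega> by (simp add: jacobi_gram_def)
  let ?G = "{\<omega> \<in> space M. cond2 (?A \<omega>) \<le> ereal ((1 + \<epsilon>) / (1 - \<epsilon>))}"
  have G: "?G \<in> sets M" by (rule sets_cond2_jacobi_gram_le[OF rv])
  have sub: "space M - ?G \<subseteq> {\<omega> \<in> space M. ?S \<omega> \<ge> real n * \<epsilon>}"
  proof (rule ccontr)
    assume "\<not> ?thesis"
    then obtain \<omega> where w0: "\<omega> \<in> space M - ?G" "\<omega> \<notin> {\<omega> \<in> space M. ?S \<omega> \<ge> real n * \<epsilon>}"
      unfolding subset_iff by blast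
    then have w1: "\<omega> \<in> space M" and w2: "\<not> cond2 (?A \<omega>) \<le> ereal ((1 + \<epsilon>) / (1 - \<epsilon>))" by blast+
    have w3: "?S \<omega> < real n * \<epsilon>"
      using w0(2) w1 by (simp only: mem_Collect_eq simp_thms not_le)
    have "cond2 (?A \<omega>) \<le> ereal ((1 + \<epsilon>) / (1 - \<epsilon>))"
    proof (rule cond2_le_of_near_identity[OF car _ _ jacobi_gamma_pos[OF ab']])
      show "transpose_mat (?A \<omega>) = ?A \<omega>"
        by (rule eq_matI) (auto simp: jacobi_gram_def mult.commute)
      have "L2_set (\<lambda>(i, j). jacobi_gamma a b * ?A \<omega> $$ (i, j) - (if i = j then 1 else 0)) ?K =
          L2_set (\<lambda>p. 1 / real n * (\<Sum>j\<in>{1..n}. gram_deviation a b (X j \<omega>) p)) ?K"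
      proof (rule L2_set_cong[OF refl])
        fix p assume p: "p \<in> ?K"
        obtain k l where kl: "p = (k, l)" by (cases p)
        have "jacobi_gamma a b * ?A \<omega> $$ (k, l) = 1 / real n * (\<Sum>j\<in>{1..n}.
            jacobi_gamma a b * (jacobi_normalized a b k (X j \<omega>) * jacobi_normalized a b l (X j \<omega>)))"
          using p kl by (simp add: jacobi_gram_def sum_distrib_left)
        moreover have "1 / real n * (\<Sum>j\<in>{1..n}. gram_deviation a b (X j \<omega>) (k, l)) =
            1 / real n * (\<Sum>j\<in>{1..n}. poly (jacobi_on a b k) (X j \<omega>) * poly (jacobi_on a b l) (X j \<omega>)) - (if k = l then 1 else 0)"
          using n by (simp add: gram_deviation_def sum_subtractf right_diff_distrib)
        ultimately show "(case p of (i, j) \<Rightarrow> jacobi_gamma a b * ?A \<omega> $$ (i, j) - (if i = j then 1 else 0)) =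
            1 / real n * (\<Sum>j\<in>{1..n}. gram_deviation a b (X j \<omega>) p)"
          unfolding jacobi_normalized_mult[OF ab] kl by simp
      qed
      also have "\<dots> = 1 / real n * ?S \<omega>" by (rule L2_set_right_distrib[symmetric]) simp
      also have "\<dots> \<le> \<epsilon>" using w3 n by (simp add: field_simps)
      finally show "L2_set (\<lambda>(i, j). jacobi_gamma a b * ?A \<omega> $$ (i, j) - (if i = j then 1 else 0)) ?K \<le> \<epsilon>" .
    qed (use e in auto)
    then show False using w2 by simp
  qed
  have mS: "{\<omega> \<in> space M. ?S \<omega> \<ge> real n * \<epsilon>} \<in> sets M"
  proof -
    have "?S \<in> borel_measurable M"
      unfolding L2_set_def
      by (intro measurable_compose[OF _ borel_measurable_sqrt] borel_measurable_sum borel_measurable_power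
          measurable_compose[OF rv mpoly]) auto
    then show ?thesis by measurable
  qed
  have "prob (space M - ?G) \<le> 2 * exp (- real n * \<epsilon>\<^sup>2 / (2 * (\<sigma>2 + R * \<epsilon> / 3)))"
    using finite_measure_mono[OF sub mS] bound by simp
  then show ?thesis using prob_compl[OF G] by simp
qed

section \<open>The Chebyshev case and a lower bound for the Christoffel function\<close>

text \<open>As functions of \<open>t\<close> both sides solve \<open>y'' = - k^2 y\<close>. Their
  difference \<open>g\<close> and its derivative vanish at 0 and the energy \<open>E\<close> is
  constant, so \<open>g = 0\<close>. For \<open>k = 0\<close> the energy would not control
  \<open>g\<close>.\<close>

lemma jacobi_rec_chebyshev:
  "poly (jacobi_rec (- (1/2)) (- (1/2)) k) (cos t) = pochhammer (1/2) k / fact k * cos (real k * t)"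
proof (cases "k = 0")
  case False
  define P where "P = jacobi_rec (- (1/2)) (- (1/2)) k"
  define c :: real where "c = pochhammer (1/2) k / fact k"
  define g where "g t = poly P (cos t) - c * cos (real k * t)" for t
  define g' where "g' t = - sin t * poly (pderiv P) (cos t) + c * real k * sin (real k * t)" for t
  have D1: "(g has_real_derivative g' t) (at t)" for t
    unfolding g_def g'_def by (auto intro!: derivative_eq_intros)
  have ode: "(1 - x\<^sup>2) * poly (pderiv (pderiv P)) x - x * poly (pderiv P) x = - (real k)\<^sup>2 * poly P x" for x
    using arg_cong[OF jacobi_rec_ode[of "- (1/2)" "- (1/2)" k], of "\<lambda>p. poly p x"]
    by (simp add: poly_jacobi_raise P_def power2_eq_square algebra_simps)
  have D2: "(g' has_real_derivative - (real k)\<^sup>2 * g t) (at t)" for t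
  proof -
    have "(g' has_real_derivative - cos t * poly (pderiv P) (cos t) + (sin t)\<^sup>2 * poly (pderiv (pderiv P)) (cos t) +
        c * (real k)\<^sup>2 * cos (real k * t)) (at t)"
      unfolding g'_def by (auto intro!: derivative_eq_intros simp: power2_eq_square algebra_simps)
    moreover have "- cos t * poly (pderiv P) (cos t) + (sin t)\<^sup>2 * poly (pderiv (pderiv P)) (cos t) +
        c * (real k)\<^sup>2 * cos (real k * t) = - (real k)\<^sup>2 * g t"
      using ode[of "cos t"] by (simp add: sin_squared_eq g_def algebra_simps)
    ultimately show ?thesis by simp
  qed
  define E where "E t = (g' t)\<^sup>2 + (real k)\<^sup>2 * (g t)\<^sup>2" for t
  have "(E has_real_derivative 2 * g' t * (- (real k)\<^sup>2 * g t) + (real k)\<^sup>2 * (2 * g t * g' t)) (at t)" for t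
    unfolding E_def by (auto intro!: derivative_eq_intros D1 D2)
  then have "DERIV E t :> 0" for t by simp
  then have "E t = E 0" by (intro DERIV_isconst_all) auto
  also have "E 0 = 0"
    using poly_jacobi_rec_1[of "- (1/2)" "- (1/2)" k] by (simp add: E_def g_def g'_def P_def c_def)
  finally have "(g t)\<^sup>2 = 0" using False
    by (simp add: E_def add_nonneg_eq_0_iff)
  then show ?thesis by (simp add: g_def P_def c_def)
qed simp

lemma jacobi_on_chebyshev_square:
  "(poly (jacobi_on (- (1/2)) (- (1/2)) k) (cos t))\<^sup>2 = (if k = 0 then 1 else 2 * (cos (real k * t))\<^sup>2)"
proof (cases k)
  case 0
  then show ?thesis using jacobi_on_0[of "- (1/2)" "- (1/2)"] by simp
next
  case (Suc j)
  have h: "jacobi_gamma (- (1/2)) (- (1/2)) / jacobi_h (- (1/2)) (- (1/2)) k =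
      2 * real k * fact k * fact j / (pochhammer (1/2) k)\<^sup>2"
    unfolding Suc by (subst jacobi_gamma_div_h_Suc) (simp_all add: power2_eq_square pochhammer_fact[symmetric] mult_ac)
  have pos: "pochhammer (1/2 :: real) k > 0" by (intro pochhammer_pos) auto
  have Q: "0 \<le> jacobi_gamma (- (1/2)) (- (1/2)) / jacobi_h (- (1/2)) (- (1/2)) k"
    unfolding h using pos by simp
  have "(poly (jacobi_on (- (1/2)) (- (1/2)) k) (cos t))\<^sup>2 =
      jacobi_gamma (- (1/2)) (- (1/2)) / jacobi_h (- (1/2)) (- (1/2)) k * (pochhammer (1/2) k / fact k * cos (real k * t))\<^sup>2"
    unfolding jacobi_on_def poly_smult jacobi_rec_chebyshev power_mult_distrib[of "sqrt _"] real_sqrt_pow2[OF Q] ..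
  also have "\<dots> = 2 * real k * fact j / fact k * (cos (real k * t))\<^sup>2"
    unfolding h using pos by (simp add: power_mult_distrib power_divide power2_eq_square)
  also have "real k * fact j = fact k" using Suc by simp
  then have "2 * real k * fact j / fact k = (2::real)" by (simp only: mult.assoc) simp
  finally show ?thesis using Suc by simp
qed

text \<open>For the Christoffel function \<open>K\<close>, the difference
  \<open>2 * K - (2 * N + 1)\<close> is the Dirichlet kernel at \<open>2 * t\<close>, that is
  \<open>sin ((2 * N + 1) * t) / sin t\<close>; the factor \<open>sin t\<close> stays on the left
  because it vanishes at the endpoints.\<close>

lemma sin_mult_christoffel_chebyshev:
  "sin t * (2 * christoffel_sum (- (1/2)) (- (1/2)) N (cos t) - real (2 * N + 1)) = sin (real (2 * N + 1) * t)"
proof (induction N)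
  case 0
  then show ?case by (simp add: christoffel_sum_def jacobi_on_chebyshev_square)
next
  case (Suc N)
  let ?m = "real (2 * N + 2) * t"
  have "sin t * (2 * christoffel_sum (- (1/2)) (- (1/2)) (Suc N) (cos t) - real (2 * Suc N + 1)) =
      sin t * (2 * christoffel_sum (- (1/2)) (- (1/2)) N (cos t) - real (2 * N + 1)) +
      sin t * (2 * (2 * (cos (real (Suc N) * t))\<^sup>2 - 1))"
    by (simp add: christoffel_sum_def jacobi_on_chebyshev_square algebra_simps)
  also have "\<dots> = sin (?m - t) + sin t * (2 * cos ?m)"
  proof -
    have "2 * (cos (real (Suc N) * t))\<^sup>2 - 1 = cos ?m"
      using cos_double_cos[of "real (Suc N) * t"] by (simp add: algebra_simps)
    moreover have "real (2 * N + 1) * t = ?m - t" by (simp add: algebra_simps)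
    ultimately show ?thesis unfolding Suc.IH by (simp only:)
  qed
  also have "\<dots> = sin (?m + t)" by (simp add: sin_diff sin_add)
  also have "?m + t = real (2 * Suc N + 1) * t" by (simp add: algebra_simps)
  finally show ?case .
qed

lemma cos_ge_quadratic: "1 - y\<^sup>2 / 2 \<le> cos y" for y :: real
proof -
  have "(sin (y / 2))\<^sup>2 \<le> (y / 2)\<^sup>2"
    by (rule abs_le_square_iff[THEN iffD1, OF abs_sin_x_le_abs_x])
  moreover have "cos y = 1 - 2 * (sin (y / 2))\<^sup>2" using cos_double_sin[of "y / 2"] by simp
  ultimately show ?thesis by (simp add: power2_eq_square)
qed

lemma sin_ge_cubic:
  fixes x :: real
  assumes "x \<ge> 0"
  shows "x - x ^ 3 / 6 \<le> sin x"
proof -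
  have "sin 0 - (0 - 0 ^ 3 / 6) \<le> sin x - (x - x ^ 3 / 6)"
  proof (rule DERIV_nonneg_imp_nondecreasing[OF assms, of "\<lambda>x. sin x - (x - x ^ 3 / 6)"])
    fix t :: real
    show "\<exists>y. ((\<lambda>x. sin x - (x - x ^ 3 / 6)) has_real_derivative y) (at t) \<and> 0 \<le> y"
      by (rule exI[of _ "cos t - (1 - t\<^sup>2 / 2)"]) (use cos_ge_quadratic[of t] in \<open>auto intro!: derivative_eq_intros\<close>)
  qed
  then show ?thesis by simp
qed

text \<open>The Dirichlet kernel is at least \<open>- (M + 1) / 4\<close>. It is nonnegative up to
  \<open>M * t = pi\<close>; up to \<open>M * t = 5\<close> the cubic bound for the sine gives
  \<open>M * t \<le> (M + 1) * sin t\<close>; from there on \<open>sin t\<close> is large enough for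
  the trivial bound \<open>1\<close> on the numerator. \<open>M \<ge> 5\<close> corresponds to
  \<open>N \<ge> 2\<close>.\<close>

lemma neg_sin_mult_le:
  fixes M t :: real
  assumes M: "M \<ge> 5" and t: "0 \<le> t" "t \<le> pi / 2"
  shows "- sin (M * t) \<le> (M + 1) / 4 * sin t"
proof -
  have low: "M * u \<le> (M + 1) * sin u" if u: "0 \<le> u" "M * u \<le> 5" for u
  proof -
    have "(M + 1) * u\<^sup>2 \<le> 6"
    proof -
      have "(M * u)\<^sup>2 \<le> 5\<^sup>2" using u M by (intro power_mono) auto
      then have "M\<^sup>2 * u\<^sup>2 \<le> 25" by (simp add: power_mult_distrib)
      moreover have "25 * (M + 1) \<le> 6 * M\<^sup>2"
      proof -
        have "0 \<le> (M - 5) * (6 * M + 5)" using M by simp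
        then show ?thesis by (simp add: power2_eq_square algebra_simps)
      qed
      then have "25 * (M + 1) * u\<^sup>2 \<le> 6 * M\<^sup>2 * u\<^sup>2" by (rule mult_right_mono) simp
      ultimately show ?thesis by (simp only: mult.assoc)
    qed
    then have "u * ((M + 1) * u\<^sup>2) \<le> u * 6" using u by (intro mult_left_mono)
    then have "M * u \<le> (M + 1) * (u - u ^ 3 / 6)" by (simp add: power2_eq_square power3_eq_cube algebra_simps)
    also have "\<dots> \<le> (M + 1) * sin u" using sin_ge_cubic[OF u(1)] M by (intro mult_left_mono) auto
    finally show ?thesis .
  qed
  consider "M * t \<le> pi" | "pi < M * t" "M * t \<le> 5" | "5 < M * t" by linarith
  then show ?thesis
  proof cases
    case 1
    then have "sin (M * t) \<ge> 0" using M t by (intro sin_ge_zero) auto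
    moreover have "sin t \<ge> 0" using t by (intro sin_ge_zero) auto
    ultimately show ?thesis using M by (smt (verit) mult_nonneg_nonneg divide_nonneg_pos)
  next
    case 2
    have "- sin (M * t) = sin (M * t - pi)" by (simp add: sin_diff)
    then have "- sin (M * t) \<le> M * t - pi" using 2 sin_x_le_x[of "M * t - pi"] by simp
    moreover have "- sin (M * t) \<le> 1" using sin_ge_minus_one[of "M * t"] by linarith
    \<comment> \<open>A quarter of the first bound plus three quarters of the second, with
      \<open>pi > 3\<close>.\<close>
    ultimately have "- sin (M * t) \<le> M * t / 4" using pi_gt3 by linarith
    also have "\<dots> \<le> (M + 1) / 4 * sin t" using low[of t] t 2 by simp
    finally show ?thesis .
  next
    case 3
    have u: "0 \<le> 5 / M" "M * (5 / M) \<le> 5" "5 / M \<le> t" using M 3 by (auto simp: field_simps)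
    have "5 \<le> (M + 1) * sin (5 / M)" using low[OF u(1,2)] M by simp
    also have "\<dots> \<le> (M + 1) * sin t"
      using M t u by (intro mult_left_mono sin_monotone_2pi_le) (auto intro: order_trans[of _ 0])
    finally show ?thesis using sin_ge_minus_one[of "M * t"] by linarith
  qed
qed

text \<open>With \<open>M = 2 * N + 1\<close> the kernel bound reads
  \<open>2 * K \<ge> M - (M + 1) / 4\<close>, and \<open>M + 1 = 2 * (N + 1)\<close>. Reflection of
  \<open>t\<close> at \<open>pi / 2\<close> covers the other half, as \<open>M\<close> is odd; at
  the endpoints the kernel identity says nothing and \<open>K\<close> is summed directly.\<close>

lemma christoffel_chebyshev_ge:
  assumes N: "N \<ge> 2" and x: "x \<in> {-1..1}"
  shows "3/4 * real (N + 1) - 1/2 \<le> christoffel_sum (- (1/2)) (- (1/2)) N x"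
proof -
  define t where "t = arccos x"
  have t: "cos t = x" "0 \<le> t" "t \<le> pi" using x by (auto simp: t_def arccos_lbound arccos_ubound)
  let ?M = "real (2 * N + 1)"
  show ?thesis
  proof (cases "sin t = 0")
    case True
    then have "x\<^sup>2 = 1" using sin_cos_squared_add[of t] t by simp
    have "t = 0 \<or> t = pi" using True t sin_gt_zero[of t] by force
    then have c: "(cos (real k * t))\<^sup>2 = 1" for k
      by (auto simp: cos_npi power_even_eq[symmetric])
    have "christoffel_sum (- (1/2)) (- (1/2)) N x = (\<Sum>k\<le>N. if k = 0 then 1 else 2)"
      unfolding christoffel_sum_def t(1)[symmetric] jacobi_on_chebyshev_square c by (intro sum.cong) auto
    also have "\<dots> \<ge> (\<Sum>k\<le>N. 1)" by (intro sum_mono) auto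
    finally have "real (N + 1) \<le> christoffel_sum (- (1/2)) (- (1/2)) N x" by simp
    moreover have "3/4 * y - 1/2 \<le> z" if "y \<le> z" "0 \<le> y" for y z :: real
      using that by linarith
    ultimately show ?thesis using of_nat_0_le_iff by blast
  next
    case False
    then have s: "sin t > 0" using sin_ge_zero[of t] t by simp
    have "- sin (?M * t) \<le> (?M + 1) / 4 * sin t"
    proof (cases "t \<le> pi / 2")
      case True
      then show ?thesis using N t by (intro neg_sin_mult_le) auto
    next
      case False
      have "sin (?M * (pi - t)) = sin (?M * t)"
      proof -
        have "?M * (pi - t) = pi - ?M * t + 2 * real N * pi" by (simp add: algebra_simps)
        then have "sin (?M * (pi - t)) = sin (pi - ?M * t + 2 * real N * pi)" by (simp only:)
        also have "\<dots> = sin (pi - ?M * t)"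
          unfolding sin_add[of "pi - ?M * t"] sin_2npi cos_2npi by simp
        finally show ?thesis by simp
      qed
      then show ?thesis using neg_sin_mult_le[of ?M "pi - t"] N t False by simp
    qed
    then have "sin t * (2 * christoffel_sum (- (1/2)) (- (1/2)) N x - ?M) \<ge> sin t * (- (?M + 1) / 4)"
      unfolding t(1)[symmetric] sin_mult_christoffel_chebyshev by (simp add: algebra_simps)
    then have "2 * christoffel_sum (- (1/2)) (- (1/2)) N x - ?M \<ge> - (?M + 1) / 4"
      using s by (simp only: mult_le_cancel_left_pos)
    moreover have "?M = 2 * real (N + 1) - 1" by simp
    moreover have "3/4 * m - 1/2 \<le> z" if "2 * z - y \<ge> - (y + 1) / 4" "y = 2 * m - 1" for y z m :: real
      using that by simp
    ultimately show ?thesis by blast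
  qed
qed

section \<open>Lower bounds for the Christoffel function from test polynomials\<close>

lemma degree_jacobi_on: "degree (jacobi_on a b k) \<le> k"
  unfolding jacobi_on_def by (rule order_trans[OF degree_smult_le degree_jacobi_rec])

lemma poly_eq_sum_jacobi_on:
  assumes ab: "a \<ge> -1/2" "b \<ge> -1/2" and q: "degree q \<le> N"
  shows "\<exists>c. q = (\<Sum>k\<le>N. Polynomial.smult (c k) (jacobi_on a b k))"
  using q
proof (induction N arbitrary: q)
  case 0
  then obtain u where "q = [:u:]" by (auto elim!: degree_eq_zeroE)
  then show ?case by (intro exI[of _ "\<lambda>_. u"]) (simp add: jacobi_on_0[OF ab])
next
  case (Suc N)
  let ?p = "jacobi_on a b (Suc N)" and ?s = "sqrt (jacobi_gamma a b / jacobi_h a b (Suc N))"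
  have "?s > 0" using jacobi_gamma_pos[of a b] jacobi_h_pos[OF ab, of "Suc N"] ab by simp
  moreover have "pochhammer (a + b + real (Suc N) + 1) (Suc N) > 0"
    using ab by (intro pochhammer_pos) simp
  ultimately have "coeff ?p (Suc N) > 0"
    unfolding jacobi_on_def coeff_smult coeff_jacobi_rec by (intro mult_pos_pos divide_pos_pos) auto
  then have lc: "coeff ?p (Suc N) \<noteq> 0" by simp
  define u where "u = coeff q (Suc N) / coeff ?p (Suc N)"
  have deg: "degree ?p \<le> Suc N"
    by (rule degree_jacobi_on)
  have "degree (q - Polynomial.smult u ?p) \<le> N"
  proof (rule degree_le, intro allI impI)
    fix i assume "N < i"
    then consider "i = Suc N" | "i > Suc N" by linarith
    then show "coeff (q - Polynomial.smult u ?p) i = 0"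
    proof cases
      case 1
      then show ?thesis using lc by (simp add: u_def)
    next
      case 2
      then have "coeff q i = 0" "coeff ?p i = 0" using Suc.prems deg by (auto intro!: coeff_eq_0)
      then show ?thesis by simp
    qed
  qed
  from Suc.IH[OF this] obtain c where c: "q - Polynomial.smult u ?p = (\<Sum>k\<le>N. Polynomial.smult (c k) (jacobi_on a b k))" ..
  have "q = (\<Sum>k\<le>N. Polynomial.smult (c k) (jacobi_on a b k)) + Polynomial.smult u ?p"
    unfolding c[symmetric] by simp
  also have "\<dots> = (\<Sum>k\<le>Suc N. Polynomial.smult ((c(Suc N := u)) k) (jacobi_on a b k))"
    by simp
  finally show ?case by blast
qed

lemma jacobi_int_sum_on_square:
  assumes ab: "a \<ge> -1/2" "b \<ge> -1/2"
  shows "jacobi_int a b ((\<Sum>k\<le>N. Polynomial.smult (c k) (jacobi_on a b k)) * (\<Sum>k\<le>N. Polynomial.smult (c k) (jacobi_on a b k)))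
    = jacobi_gamma a b * (\<Sum>k\<le>N. (c k)\<^sup>2)"
proof -
  have ab': "a > -1" "b > -1" using ab by auto
  show ?thesis
    unfolding sum_product jacobi_int_sum[OF ab'] mult_smult_left mult_smult_right jacobi_int_smult jacobi_int_on[OF ab]
    by (simp add: if_distrib power2_eq_square sum_distrib_left mult_ac cong: if_cong)
qed

text \<open>The extremal property of the Christoffel function, by Cauchy-Schwarz for the
  coefficients of \<open>q\<close>: every test polynomial yields a lower bound at
  \<open>x\<close>.\<close>

lemma poly_square_le_christoffel:
  assumes ab: "a \<ge> -1/2" "b \<ge> -1/2" and q: "degree q \<le> N"
  shows "jacobi_gamma a b * (poly q x)\<^sup>2 \<le> jacobi_int a b (q * q) * christoffel_sum a b N x"
proof -
  obtain c where c: "q = (\<Sum>k\<le>N. Polynomial.smult (c k) (jacobi_on a b k))"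
    using poly_eq_sum_jacobi_on[OF ab q] by blast
  have "(poly q x)\<^sup>2 \<le> (\<Sum>k\<le>N. (c k)\<^sup>2) * christoffel_sum a b N x"
    unfolding c christoffel_sum_def poly_sum poly_smult by (rule Cauchy_Schwarz_ineq_sum)
  then have "jacobi_gamma a b * (poly q x)\<^sup>2 \<le> jacobi_gamma a b * ((\<Sum>k\<le>N. (c k)\<^sup>2) * christoffel_sum a b N x)"
    using jacobi_gamma_pos[of a b] ab by (intro mult_left_mono) auto
  also have "\<dots> = jacobi_int a b (q * q) * christoffel_sum a b N x"
    unfolding c jacobi_int_sum_on_square[OF ab] by simp
  finally show ?thesis .
qed

lemma Gamma_duplication_real:
  fixes e :: real
  assumes "e \<ge> 0"
  shows "Gamma (1/2 + e) * Gamma (1 + e) = 4 powr (- e) * sqrt pi * Gamma (1 + 2 * e)"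
proof -
  let ?z = "complex_of_real (1/2 + e)"
  have nz: "complex_of_real y \<notin> \<int>\<^sub>\<le>\<^sub>0" if "y > 0" for y
    using that by (auto elim!: nonpos_Ints_cases simp: complex_eq_iff)
  have z: "?z + 1/2 = of_real (1 + e)" "2 * ?z = of_real (1 + 2 * e)"
    by (simp_all add: complex_eq_iff)
  have "Gamma ?z * Gamma (?z + 1/2) = exp ((1 - 2 * ?z) * of_real (ln 2)) * of_real (sqrt pi) * Gamma (2 * ?z)"
  proof (rule Gamma_legendre_duplication)
    show "?z \<notin> \<int>\<^sub>\<le>\<^sub>0" by (rule nz) (use assms in simp)
    show "?z + 1/2 \<notin> \<int>\<^sub>\<le>\<^sub>0" unfolding z by (rule nz) (use assms in simp)
  qed
  then have "of_real (Gamma (1/2 + e) * Gamma (1 + e)) =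
      complex_of_real (exp ((1 - (1 + 2 * e)) * ln 2) * sqrt pi * Gamma (1 + 2 * e))"
    by (simp only: z of_real_diff of_real_1 Gamma_complex_of_real of_real_mult exp_of_real[symmetric])
  then have "Gamma (1/2 + e) * Gamma (1 + e) = exp ((1 - (1 + 2 * e)) * ln 2) * sqrt pi * Gamma (1 + 2 * e)"
    by (simp only: of_real_eq_iff)
  moreover have "exp ((1 - (1 + 2 * e)) * ln 2) = 4 powr (- e)"
    using ln_mult[of 2 "2::real"] by (simp add: powr_def mult_ac)
  ultimately show ?thesis by simp
qed

lemma Gamma_log_convex:
  fixes x y u :: real
  assumes "x > 0" "y > 0" "0 \<le> u" "u \<le> 1"
  shows "Gamma ((1 - u) * x + u * y) \<le> Gamma x powr (1 - u) * Gamma y powr u"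
proof -
  let ?w = "(1 - u) * x + u * y"
  have w: "?w > 0"
  proof (cases "u = 0")
    case False
    then show ?thesis using assms by (intro add_nonneg_pos) auto
  qed (use assms in auto)
  have "ln (Gamma ?w) \<le> (1 - u) * ln (Gamma x) + u * ln (Gamma y)"
    using convex_onD[OF log_convex_Gamma_real, of u x y] assms by simp
  then have "exp (ln (Gamma ?w)) \<le> exp ((1 - u) * ln (Gamma x) + u * ln (Gamma y))" by simp
  then show ?thesis
    using Gamma_real_pos[OF w] Gamma_real_pos[OF assms(1)] Gamma_real_pos[OF assms(2)]
    by (simp add: powr_def exp_add)
qed

lemma Gamma_midpoint:
  fixes x y :: real
  assumes "x > 0" "y > 0"
  shows "(Gamma ((x + y) / 2))\<^sup>2 \<le> Gamma x * Gamma y"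
proof -
  have pos: "Gamma x > 0" "Gamma y > 0" "Gamma ((x + y) / 2) > 0" using assms by (auto intro!: Gamma_real_pos)
  have "Gamma ((1 - 1/2) * x + 1/2 * y) \<le> Gamma x powr (1 - 1/2) * Gamma y powr (1/2)"
    using assms by (intro Gamma_log_convex) auto
  moreover have "(1 - 1/2) * x + 1/2 * y = (x + y) / 2" by (simp add: add_divide_distrib)
  moreover have "(1 - 1/2 :: real) = 1/2" by simp
  ultimately have "Gamma ((x + y) / 2) \<le> sqrt (Gamma x) * sqrt (Gamma y)"
    using pos by (simp only: powr_half_sqrt less_imp_le)
  then have "(Gamma ((x + y) / 2))\<^sup>2 \<le> (sqrt (Gamma x) * sqrt (Gamma y))\<^sup>2"
    using pos by (intro power_mono) auto
  then show ?thesis using pos by (simp add: power_mult_distrib)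
qed

text \<open>By Legendre duplication and log-convexity of \<open>\<Gamma>\<close>; equivalently, Jensen's inequality for
  \<open>E ((1 - X) powr e * (1 + X) powr f)\<close> with \<open>X\<close> arcsine distributed.\<close>

lemma jacobi_gamma_ge:
  assumes e: "e \<ge> 0" "f \<ge> 0"
  shows "pi * 2 powr (- (e + f)) \<le> jacobi_gamma (e - 1/2) (f - 1/2)"
proof -
  have G: "Gamma (1 + x) > 0" if "x \<ge> 0" for x :: real using that by (intro Gamma_real_pos) auto
  \<comment> \<open>\<open>1 + e + f\<close> is the midpoint of \<open>1 + 2 * e\<close> and
    \<open>1 + 2 * f\<close>, and in \<open>c2\<close> the point \<open>1 + x\<close> is that of
    \<open>1\<close> and \<open>1 + 2 * x\<close>; the product of three such inequalities is the
    square of \<open>key\<close>.\<close>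
  have c1: "(Gamma (1 + e + f))\<^sup>2 \<le> Gamma (1 + 2 * e) * Gamma (1 + 2 * f)"
  proof -
    have "(1 + 2 * e + (1 + 2 * f)) / 2 = 1 + e + f" by simp
    from Gamma_midpoint[of "1 + 2 * e" "1 + 2 * f", unfolded this] show ?thesis using e by simp
  qed
  have c2: "(Gamma (1 + x))\<^sup>2 \<le> Gamma (1 + 2 * x)" if "x \<ge> 0" for x :: real
  proof -
    have "(1 + (1 + 2 * x)) / 2 = 1 + x" by simp
    from Gamma_midpoint[of 1 "1 + 2 * x", unfolded this] show ?thesis using that by simp
  qed
  have "(Gamma (1 + e) * Gamma (1 + f) * Gamma (1 + e + f))\<^sup>2 \<le> (Gamma (1 + 2 * e) * Gamma (1 + 2 * f))\<^sup>2"
  proof -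
    have "(Gamma (1 + e))\<^sup>2 * (Gamma (1 + f))\<^sup>2 * (Gamma (1 + e + f))\<^sup>2 \<le>
        Gamma (1 + 2 * e) * Gamma (1 + 2 * f) * (Gamma (1 + 2 * e) * Gamma (1 + 2 * f))"
      using c1 c2 e G[of "2 * e"] G[of "2 * f"] by (intro mult_mono) auto
    then show ?thesis by (simp add: power2_eq_square mult_ac)
  qed
  then have key: "Gamma (1 + e) * Gamma (1 + f) * Gamma (1 + e + f) \<le> Gamma (1 + 2 * e) * Gamma (1 + 2 * f)"
    by (rule power2_le_imp_le) (use mult_pos_pos[OF G[of "2 * e"] G[of "2 * f"]] e in simp)
  have half: "Gamma (1/2 + x) = 4 powr (- x) * sqrt pi * Gamma (1 + 2 * x) / Gamma (1 + x)" if "x \<ge> 0" for x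
    using Gamma_duplication_real[OF that] G[OF that] by (simp add: nonzero_eq_divide_eq)
  have ar: "e - 1/2 + 1 = 1/2 + e" "f - 1/2 + 1 = 1/2 + f" "1/2 + e + (1/2 + f) = 1 + e + f"
    "e - 1/2 + (f - 1/2) + 1 = e + f" by simp_all
  have "jacobi_gamma (e - 1/2) (f - 1/2) = 2 powr (e + f) * (Gamma (1/2 + e) * Gamma (1/2 + f) / Gamma (1 + e + f))"
    unfolding jacobi_gamma_def Beta_def ar ..
  also have "\<dots> = 2 powr (e + f) * (4 powr (- e) * 4 powr (- f)) * (sqrt pi * sqrt pi) *
      ((Gamma (1 + 2 * e) * Gamma (1 + 2 * f)) / (Gamma (1 + e) * Gamma (1 + f) * Gamma (1 + e + f)))"
  proof -
    have "t * ((p * s * A / B) * (q * s * C / D) / E) = t * (p * q) * (s * s) * ((A * C) / (B * D * E))"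
      for t p s A B q C D E :: real by simp
    then show ?thesis unfolding half[OF e(1)] half[OF e(2)] .
  qed
  also have "\<dots> \<ge> 2 powr (e + f) * (4 powr (- e) * 4 powr (- f)) * (sqrt pi * sqrt pi) * 1"
  proof (rule mult_left_mono)
    have "0 < Gamma (1 + e) * Gamma (1 + f) * Gamma (1 + e + f)"
      using mult_pos_pos[OF mult_pos_pos[OF G G] G[of "e + f"], of e f] e by (simp add: add.assoc)
    with key show "1 \<le> (Gamma (1 + 2 * e) * Gamma (1 + 2 * f)) / (Gamma (1 + e) * Gamma (1 + f) * Gamma (1 + e + f))"
      by (simp only: le_divide_eq_1_pos)
  qed simp
  also have "2 powr (e + f) * (4 powr (- e) * 4 powr (- f)) = 2 powr (- (e + f))"
  proof -
    have "4 powr (- e) * 4 powr (- f) = 2 powr (- (e + f)) * 2 powr (- (e + f))"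
      using powr_mult[of 2 2 "- (e + f)"] by (simp add: powr_add[symmetric])
    then show ?thesis by (simp flip: powr_add)
  qed
  finally show ?thesis by (simp add: mult.commute)
qed

text \<open>Relative to the Chebyshev weight the ratio is \<open>(1 - x) powr e * (1 + x) powr f =
  (1 - x\<^sup>2) powr f * (1 - x) powr (e - f)\<close>, with factors at most \<open>1\<close> and
  \<open>2 powr (e - f)\<close>. Both orientations are stated since either parameter may be the
  larger.\<close>

lemma jacobi_weight_le_chebyshev:
  assumes e: "0 \<le> f" "f \<le> e" and x: "x \<in> {-1..1}"
  shows "jacobi_weight (e - 1/2) (f - 1/2) x \<le> 2 powr (e - f) * jacobi_weight (- (1/2)) (- (1/2)) x"
    and "jacobi_weight (f - 1/2) (e - 1/2) x \<le> 2 powr (e - f) * jacobi_weight (- (1/2)) (- (1/2)) x"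
proof -
  have main: "(1 - x) powr (e - 1/2) * (1 + x) powr (f - 1/2) \<le>
      2 powr (e - f) * ((1 - x) powr (- (1/2)) * (1 + x) powr (- (1/2)))" if x: "x \<in> {-1..1}" for x
  proof -
    have "(1 - x) powr e * (1 + x) powr f = ((1 - x) * (1 + x)) powr f * (1 - x) powr (e - f)"
      using x by (simp add: powr_mult powr_add[symmetric])
    also have "\<dots> \<le> 1 powr f * 2 powr (e - f)"
    proof (intro mult_mono powr_mono2)
      have "(1 - x) * (1 + x) = 1 - x\<^sup>2" by (simp add: power2_eq_square algebra_simps)
      then show "(1 - x) * (1 + x) \<le> 1" by simp
    qed (use x e in auto)
    finally have "(1 - x) powr e * (1 + x) powr f \<le> 2 powr (e - f)" by simp
    then have "(1 - x) powr e * (1 + x) powr f * ((1 - x) powr (- (1/2)) * (1 + x) powr (- (1/2))) \<le>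
        2 powr (e - f) * ((1 - x) powr (- (1/2)) * (1 + x) powr (- (1/2)))"
      by (intro mult_right_mono) auto
    moreover have "(1 - x) powr (e - 1/2) = (1 - x) powr e * (1 - x) powr (- (1/2))"
      "(1 + x) powr (f - 1/2) = (1 + x) powr f * (1 + x) powr (- (1/2))"
      by (simp_all flip: powr_add)
    ultimately show ?thesis by (simp add: mult_ac)
  qed
  show "jacobi_weight (e - 1/2) (f - 1/2) x \<le> 2 powr (e - f) * jacobi_weight (- (1/2)) (- (1/2)) x"
    using main[OF x] by (simp add: jacobi_weight_def)
  show "jacobi_weight (f - 1/2) (e - 1/2) x \<le> 2 powr (e - f) * jacobi_weight (- (1/2)) (- (1/2)) x"
    using main[of "- x"] x by (simp add: jacobi_weight_def mult.commute)
qed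

text \<open>The test polynomial is the Chebyshev reproducing kernel at \<open>x\<close>.\<close>

lemma christoffel_sum_ge:
  assumes N: "N \<ge> 2" and x: "x \<in> {-1..1}" and a: "a \<ge> -1/2" "b \<ge> -1/2"
  shows "(3/4 * real (N + 1) - 1/2) / 4 powr (max a b + 1/2) \<le> christoffel_sum a b N x"
proof -
  define e where "e = max a b + 1/2"
  define f where "f = min a b + 1/2"
  have ef: "0 \<le> f" "f \<le> e" using a by (auto simp: e_def f_def)
  have ab: "(a = e - 1/2 \<and> b = f - 1/2) \<or> (a = f - 1/2 \<and> b = e - 1/2)"
    by (auto simp: e_def f_def max_def min_def)
  let ?T = "jacobi_on (- (1/2)) (- (1/2))"
  define C where "C = christoffel_sum (- (1/2)) (- (1/2)) N x"
  have C: "3/4 * real (N + 1) - 1/2 \<le> C" unfolding C_def by (rule christoffel_chebyshev_ge[OF N x])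
  have C1: "C \<ge> 1" unfolding C_def by (rule christoffel_sum_ge_1) auto
  define q where "q = (\<Sum>k\<le>N. Polynomial.smult (poly (?T k) x) (?T k))"
  have deg: "degree q \<le> N"
    unfolding q_def
  proof (rule degree_sum_le)
    fix k assume "k \<in> {..N}"
    then have k: "k \<le> N" by simp
    have "degree (Polynomial.smult (poly (?T k) x) (?T k)) \<le> degree (?T k)" by (rule degree_smult_le)
    also have "\<dots> \<le> k" by (rule degree_jacobi_on)
    finally show "degree (Polynomial.smult (poly (?T k) x) (?T k)) \<le> N" using k by (rule order_trans)
  qed simp
  \<comment> \<open>The kernel has value \<open>C\<close> at \<open>x\<close> and squared Chebyshev
    norm \<open>pi * C\<close>, so the resulting lower bound is linear in \<open>C\<close>.\<close>
  have qx: "poly q x = C" by (simp add: q_def C_def christoffel_sum_def poly_sum power2_eq_square)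
  have gC: "jacobi_gamma (- (1/2)) (- (1/2)) = pi"
    by (simp add: jacobi_gamma_def Beta_def Gamma_one_half_real)
  have qC: "jacobi_int (- (1/2)) (- (1/2)) (q * q) = pi * C"
    unfolding q_def by (subst jacobi_int_sum_on_square) (simp_all add: gC C_def christoffel_sum_def)
  have "jacobi_int a b (q * q) \<le> 2 powr (e - f) * jacobi_int (- (1/2)) (- (1/2)) (q * q)"
  proof -
    have "jacobi_int a b (q * q) \<le> (LINT y:{-1..1}|lborel. 2 powr (e - f) * (jacobi_weight (- (1/2)) (- (1/2)) y * poly (q * q) y))"
      unfolding jacobi_int_def
    proof (rule set_integral_mono)
      show "set_integrable lborel {-1..1} (\<lambda>y. jacobi_weight a b y * poly (q * q) y)"
        using a by (intro set_integrable_jacobi_weight_poly) auto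
      show "set_integrable lborel {-1..1} (\<lambda>y. 2 powr (e - f) * (jacobi_weight (- (1/2)) (- (1/2)) y * poly (q * q) y))"
        by (intro set_integrable_mult_right set_integrable_jacobi_weight_poly) auto
      fix y :: real assume y: "y \<in> {-1..1}"
      have "jacobi_weight a b y \<le> 2 powr (e - f) * jacobi_weight (- (1/2)) (- (1/2)) y"
        using ab jacobi_weight_le_chebyshev[OF ef y] by auto
      then have "jacobi_weight a b y * (poly q y)\<^sup>2 \<le> 2 powr (e - f) * jacobi_weight (- (1/2)) (- (1/2)) y * (poly q y)\<^sup>2"
        by (intro mult_right_mono) auto
      then show "jacobi_weight a b y * poly (q * q) y \<le> 2 powr (e - f) * (jacobi_weight (- (1/2)) (- (1/2)) y * poly (q * q) y)"
        by (simp add: power2_eq_square mult_ac)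
    qed
    also have "\<dots> = 2 powr (e - f) * jacobi_int (- (1/2)) (- (1/2)) (q * q)"
      unfolding jacobi_int_def by (rule set_integral_mult_right)
    finally show ?thesis .
  qed
  also have "\<dots> = 2 powr (e - f) * pi * C" by (simp add: qC)
  finally have int: "jacobi_int a b (q * q) \<le> 2 powr (e - f) * pi * C" .
  let ?r = "christoffel_sum a b N x"
  have r0: "?r \<ge> 0" using christoffel_sum_ge_1[OF a, of N x] by simp
  \<comment> \<open>The powers of 2 from this bound and from the weight comparison combine to
    \<open>4 powr (- e)\<close>: the smaller parameter cancels.\<close>
  have "pi * 2 powr (- (e + f)) \<le> jacobi_gamma a b"
    using ab jacobi_gamma_ge[of e f] jacobi_gamma_ge[of f e] ef by (auto simp: add.commute)
  then have "pi * 2 powr (- (e + f)) * C\<^sup>2 \<le> jacobi_gamma a b * (poly q x)\<^sup>2"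
    unfolding qx by (intro mult_right_mono) auto
  also have "\<dots> \<le> jacobi_int a b (q * q) * ?r" by (rule poly_square_le_christoffel[OF a deg])
  also have "\<dots> \<le> 2 powr (e - f) * pi * C * ?r" by (intro mult_right_mono int r0)
  finally have "(pi * C) * (2 powr (- (e + f)) * C) \<le> (pi * C) * (2 powr (e - f) * ?r)"
    by (simp add: power2_eq_square mult_ac)
  moreover have "pi * C > 0" using C1 by simp
  ultimately have "2 powr (- (e + f)) * C \<le> 2 powr (e - f) * ?r"
    using mult_le_cancel_left_pos by blast
  then have "2 powr (e + f) * (2 powr (- (e + f)) * C) \<le> 2 powr (e + f) * (2 powr (e - f) * ?r)"
    by (intro mult_left_mono) auto
  then have "C \<le> 2 powr (2 * e) * ?r" by (simp add: mult.assoc[symmetric] powr_add[symmetric])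
  also have "2 powr (2 * e) = 4 powr e" using powr_powr[of 2 2 e] by simp
  finally have "C / 4 powr e \<le> ?r" by (simp add: field_simps)
  moreover have "(3/4 * real (N + 1) - 1/2) / 4 powr e \<le> C / 4 powr e" using C by (intro divide_right_mono) auto
  ultimately show ?thesis by (simp add: e_def)
qed

section \<open>Numerical estimates\<close>

lemma exp_ge_power:
  fixes x :: real
  assumes "x \<ge> 0" "n > 0"
  shows "(1 + x / n + (x / n)\<^sup>2 / 2) ^ n \<le> exp x"
proof -
  have "(1 + x / n + (x / n)\<^sup>2 / 2) ^ n \<le> exp (x / n) ^ n"
    using assms by (intro power_mono exp_lower_Taylor_quadratic) auto
  then show ?thesis using assms by (simp flip: exp_of_nat_mult)
qed

lemma exp_le_bernstein': "0 \<le> x \<Longrightarrow> x < 3 \<Longrightarrow> exp x \<le> 1 + x + x\<^sup>2 / (2 * (1 - x / 3))" for x :: real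
  using exp_le_bernstein[of x x] by simp

text \<open>Where more accuracy is needed, the argument is cut into \<open>n\<close> equal parts,
  for which a second-order estimate is sharp, and the estimate is raised to the power
  \<open>n\<close>.\<close>

lemma exp_numerals:
  "exp (109/100) \<le> (3::real)" "exp (113/100) \<le> (31/10::real)" "exp (69/100) \<le> (2::real)"
  "exp (68/1000) \<le> (10707/10000::real)" "exp (162/1000) \<le> (11767/10000::real)" "exp (22/100) \<le> (5/4::real)"
  "exp (23/100) \<le> (12594/10000::real)"
  "2 \<le> exp (6945/10000 :: real)" "315/100 \<le> exp (115/100 :: real)"
  "1490/1000 \<le> exp (4/10 :: real)" "17 \<le> exp (277/96 :: real)" "20 \<le> exp (301/96 :: real)"
proof -
  have up: "exp x \<le> (1 + y + y\<^sup>2 / (2 * (1 - y / 3))) ^ n" if "x = real n * y" "0 \<le> y" "y < 3" for x y :: real and n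
  proof -
    have "exp x = exp y ^ n" unfolding that(1) by (rule exp_of_nat_mult)
    also have "\<dots> \<le> (1 + y + y\<^sup>2 / (2 * (1 - y / 3))) ^ n" using that by (intro power_mono exp_le_bernstein') auto
    finally show ?thesis .
  qed
  show "exp (109/100) \<le> (3::real)" by (rule order_trans[OF up[of _ 4 "109/400"]]) (simp_all add: power2_eq_square eval_nat_numeral)
  show "exp (113/100) \<le> (31/10::real)" by (rule order_trans[OF up[of _ 8 "113/800"]]) (simp_all add: power2_eq_square eval_nat_numeral)
  show "exp (69/100) \<le> (2::real)" by (rule order_trans[OF up[of _ 4 "69/400"]]) (simp_all add: power2_eq_square eval_nat_numeral)
  show "exp (68/1000) \<le> (10707/10000::real)" by (rule order_trans[OF up[of _ 1 "68/1000"]]) (simp_all add: power2_eq_square)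
  show "exp (162/1000) \<le> (11767/10000::real)" by (rule order_trans[OF up[of _ 1 "162/1000"]]) (simp_all add: power2_eq_square)
  show "exp (22/100) \<le> (5/4::real)" by (rule order_trans[OF up[of _ 1 "22/100"]]) (simp_all add: power2_eq_square)
  show "exp (23/100) \<le> (12594/10000::real)" by (rule order_trans[OF up[of _ 1 "23/100"]]) (simp_all add: power2_eq_square)
  show "2 \<le> exp (6945/10000 :: real)" by (rule order_trans[OF _ exp_ge_power[of _ 10]]) (simp_all add: power2_eq_square eval_nat_numeral)
  show "315/100 \<le> exp (115/100 :: real)" by (rule order_trans[OF _ exp_ge_power[of _ 10]]) (simp_all add: power2_eq_square eval_nat_numeral)
  show "1490/1000 \<le> exp (4/10 :: real)" by (rule order_trans[OF _ exp_ge_power[of _ 4]]) (simp_all add: power2_eq_square eval_nat_numeral)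
  show "17 \<le> exp (277/96 :: real)" by (rule order_trans[OF _ exp_ge_power[of _ 16]]) (simp_all add: power2_eq_square eval_nat_numeral)
  show "20 \<le> exp (301/96 :: real)" by (rule order_trans[OF _ exp_ge_power[of _ 12]]) (simp_all add: power2_eq_square eval_nat_numeral)
qed

lemma le_ln_of_exp_le: "exp x \<le> y \<Longrightarrow> x \<le> ln y" for x y :: real
  using ln_mono[of "exp x" y] by simp

lemma ln_le_of_le_exp: "y \<le> exp x \<Longrightarrow> 0 < y \<Longrightarrow> ln y \<le> x" for x y :: real
  using ln_mono[of y "exp x"] by simp

lemma ln_numerals:
  "69/100 \<le> ln (2::real)" "ln (2::real) \<le> 6945/10000" "109/100 \<le> ln (3::real)"
proof -
  show "69/100 \<le> ln (2::real)" by (rule le_ln_of_exp_le[OF exp_numerals(3)])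
  show "ln (2::real) \<le> 6945/10000" by (rule ln_le_of_le_exp[OF exp_numerals(8)]) simp
  show "109/100 \<le> ln (3::real)" by (rule le_ln_of_exp_le[OF exp_numerals(1)])
qed

text \<open>Both bounds come from the exact sine and cosine of \<open>pi / 6\<close>.\<close>

lemma pi_bounds: "31/10 \<le> pi" "pi \<le> 315/100"
proof -
  show "pi \<le> 315/100"
  proof (rule ccontr)
    assume "\<not> pi \<le> 315/100"
    then have "sin (525/1000) < sin (pi / 6)" using pi_less_4 by (intro sin_monotone_2pi) auto
    also have "sin (pi / 6) = 1/2" by (rule sin_30)
    finally show False using sin_ge_cubic[of "525/1000"] by (simp add: power3_eq_cube)
  qed
  show "31/10 \<le> pi"
  proof (rule ccontr)
    assume "\<not> 31/10 \<le> pi"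
    then have "(pi / 6)\<^sup>2 \<le> (31/60)\<^sup>2" by (intro power_mono) auto
    moreover have "cos (pi / 6) = sqrt 3 / 2" by (rule cos_30)
    ultimately have "1 - (31/60)\<^sup>2 / 2 \<le> sqrt 3 / 2" using cos_ge_quadratic[of "pi / 6"] by linarith
    moreover have "sqrt 3 \<le> 17325/10000" by (rule real_le_lsqrt) (simp_all add: power2_eq_square)
    ultimately show False by (simp add: power2_eq_square)
  qed
qed

lemma ln_pi_bounds: "113/100 \<le> ln pi" "ln pi \<le> 115/100"
proof -
  show "113/100 \<le> ln pi" using exp_numerals(2) pi_bounds(1) by (intro le_ln_of_exp_le) linarith
  show "ln pi \<le> 115/100" using exp_numerals(9) pi_bounds(2) by (intro ln_le_of_le_exp) auto
qed

section \<open>The explicit constants\<close>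

lemma pochhammer_shift: "x * pochhammer (x + 1) n = pochhammer x n * (x + real n)" for x :: real
  by (simp flip: pochhammer_rec pochhammer_Suc)

text \<open>This is \<open>ln ((1 + y) / (1 - y)) \<ge> 2 * y\<close> at
  \<open>y = 1 / (2 * x + 1)\<close>, the midpoint estimate of the logarithm integral. Its sharpness
  keeps \<open>pochhammer_ratio_le_half\<close> free of an extra constant.\<close>

lemma inverse_le_ln_ratio:
  fixes x :: real
  assumes "x > 0"
  shows "1 / (x + 1/2) \<le> ln ((x + 1) / x)"
proof -
  define f where "f y = ln (1 + y) - ln (1 - y) - 2 * y" for y :: real
  define y where "y = 1 / (2 * x + 1)"
  have y: "0 \<le> y" "y < 1" using assms by (auto simp: y_def field_simps)
  have "f 0 \<le> f y"
  proof (rule DERIV_nonneg_imp_nondecreasing[OF y(1)])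
    fix t assume t: "0 \<le> t" "t \<le> y"
    then have t1: "t < 1" using y by simp
    then have tt: "t * t < 1" using mult_strict_mono[of t 1 t 1] t by auto
    have "(f has_real_derivative (1 / (1 + t) + 1 / (1 - t) - 2)) (at t)"
      unfolding f_def using t t1 by (auto intro!: derivative_eq_intros)
    moreover have "1 / (1 + t) + 1 / (1 - t) - 2 = 2 * (t * t) / (1 - t * t)"
      using t t1 tt by (simp add: field_simps)
    ultimately show "\<exists>z. (f has_real_derivative z) (at t) \<and> 0 \<le> z"
      using tt by (intro exI[of _ "2 * (t * t) / (1 - t * t)"]) auto
  qed
  then have "2 * y \<le> ln (1 + y) - ln (1 - y)" by (simp add: f_def)
  also have "\<dots> = ln ((1 + y) / (1 - y))" using y by (simp add: ln_div)
  also have "(1 + y) / (1 - y) = (x + 1) / x"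
  proof -
    have "y * (2 * x + 1) = 1" using assms by (simp add: y_def)
    then have "(1 + y) * x = (x + 1) * (1 - y)" by (simp add: algebra_simps)
    moreover have "1 - y \<noteq> 0" "x \<noteq> 0" using y assms by auto
    ultimately show ?thesis using frac_eq_eq by blast
  qed
  finally show ?thesis using assms by (simp add: y_def field_simps)
qed

text \<open>Factor by factor, \<open>1 + e / (i + 3/2) \<le> ((i + 2) / (i + 1)) powr e\<close>,
  since \<open>i + 3/2\<close> is the midpoint of \<open>i + 1\<close> and \<open>i + 2\<close>; the
  right-hand sides telescope.\<close>

lemma pochhammer_ratio_le_half:
  fixes e :: real
  assumes "e \<ge> 0"
  shows "pochhammer (e + 3/2) N \<le> pochhammer (3/2) N * real (N + 1) powr e"
proof (induction N)
  case (Suc N)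
  have "e + 3/2 + real N = (3/2 + real N) * (1 + e / (3/2 + real N))" by (simp add: field_simps)
  also have "\<dots> \<le> (3/2 + real N) * (real (N + 2) / real (N + 1)) powr e"
  proof (rule mult_left_mono)
    have "1 + e / (3/2 + real N) \<le> exp (e / (3/2 + real N))" by simp
    also have "e / (3/2 + real N) \<le> e * ln (real (N + 2) / real (N + 1))"
    proof -
      have "1 / (3/2 + real N) \<le> ln (real (N + 2) / real (N + 1))"
        using inverse_le_ln_ratio[of "real (N + 1)"] by (simp add: add_ac)
      from mult_left_mono[OF this assms] show ?thesis by simp
    qed
    finally show "1 + e / (3/2 + real N) \<le> (real (N + 2) / real (N + 1)) powr e" by (simp add: powr_def)
  qed simp
  finally have "pochhammer (e + 3/2) (Suc N) \<le>
      (pochhammer (3/2) N * real (N + 1) powr e) * ((3/2 + real N) * (real (N + 2) / real (N + 1)) powr e)"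
    unfolding pochhammer_Suc using Suc assms by (intro mult_mono) (auto intro!: pochhammer_nonneg mult_nonneg_nonneg)
  also have "\<dots> = pochhammer (3/2) (Suc N) * (real (N + 1) powr e * (real (N + 2) / real (N + 1)) powr e)"
    by (simp add: pochhammer_Suc mult_ac)
  also have "real (N + 1) powr e * (real (N + 2) / real (N + 1)) powr e = real (Suc N + 1) powr e"
    by (subst powr_mult[symmetric]) (auto simp: add_ac)
  finally show ?case .
qed simp

text \<open>\<open>1 + y \<le> exp y\<close> turns the product into a harmonic sum, which is at most
  \<open>ln (N + 1)\<close> plus the Euler-Mascheroni constant; \<open>13/22\<close> bounds the
  latter.\<close>

lemma pochhammer_ratio_le_harm:
  fixes e :: real
  assumes "e \<ge> 0" "N > 0"
  shows "pochhammer (e + 1) N \<le> fact N * (real (N + 1) powr e * exp (13/22 * e))"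
proof -
  have "pochhammer (e + 1) N \<le> fact N * exp (e * harm N)"
  proof (induction N)
    case (Suc N)
    have "e + 1 + real N = real (Suc N) * (1 + e / real (Suc N))" by (simp add: field_simps)
    also have "\<dots> \<le> real (Suc N) * exp (e / real (Suc N))" by (intro mult_left_mono) auto
    finally have "pochhammer (e + 1) (Suc N) \<le> (fact N * exp (e * harm N)) * (real (Suc N) * exp (e / real (Suc N)))"
      unfolding pochhammer_Suc using Suc assms by (intro mult_mono) (auto intro!: pochhammer_nonneg)
    also have "\<dots> = fact (Suc N) * exp (e * harm (Suc N))"
      by (simp add: harm_Suc distrib_left exp_add divide_inverse mult_ac)
    finally show ?case .
  qed (simp add: harm_def)
  also have "e * harm N \<le> e * (ln (real (N + 1)) + 13/22)"
  proof (rule mult_left_mono[OF _ assms(1)])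
    obtain n where n: "N = Suc n" using assms by (cases N) auto
    have "harm (Suc n) - ln (real_of_nat (n + 2)) + 1 / real_of_nat (2 * (n + 2)) \<le> (euler_mascheroni :: real)"
      by (rule euler_mascheroni_lower)
    moreover have "0 \<le> 1 / real_of_nat (2 * (n + 2))" by simp
    ultimately have "harm (Suc n) \<le> ln (real_of_nat (n + 2)) + (euler_mascheroni :: real)" by linarith
    then show "harm N \<le> ln (real (N + 1)) + 13/22"
      using euler_mascheroni_less_13_over_22 by (simp add: n)
  qed
  finally have "pochhammer (e + 1) N \<le> fact N * exp (e * (ln (real (N + 1)) + 13/22))" by simp
  also have "exp (e * (ln (real (N + 1)) + 13/22)) = real (N + 1) powr e * exp (13/22 * e)"
    by (simp add: powr_def distrib_left exp_add mult_ac)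
  finally show ?thesis .
qed

text \<open>The closed form does not increase with \<open>f\<close>, so \<open>f = 0\<close> is the
  worst case. The rest is compared with the Chebyshev value:
  \<open>pochhammer (3/2) N / pochhammer (1/2) N = 2 * N + 1\<close>, and equality holds at
  \<open>e = f = 0\<close>.\<close>

lemma christoffel_bound_le:
  fixes e f :: real
  assumes e: "e \<ge> 0" and f: "f \<ge> 0" and N: "N > 0"
  shows "christoffel_bound (e - 1/2) (f - 1/2) N \<le>
    real (2 * N + 1) * (real (N + 1) powr (2 * e) * exp (13/22 * e))"
proof -
  have 1: "pochhammer (e + f + 1) N / pochhammer (f + 1/2) N \<le> pochhammer (e + 1) N / pochhammer (1/2) N"
    unfolding pochhammer_prod prod_dividef[symmetric]
  proof (intro prod_mono conjI)
    fix i
    have "(e + 1/2) / (f + 1/2 + real i) \<le> (e + 1/2) / (1/2 + real i)"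
      using e f by (intro divide_left_mono mult_pos_pos) auto
    moreover have "(e + f + 1 + real i) / (f + 1/2 + real i) = 1 + (e + 1/2) / (f + 1/2 + real i)"
      using f by (simp add: field_simps)
    moreover have "(e + 1 + real i) / (1/2 + real i) = 1 + (e + 1/2) / (1/2 + real i)"
      by (simp add: field_simps)
    ultimately show "(e + f + 1 + of_nat i) / (f + 1/2 + of_nat i) \<le> (e + 1 + of_nat i) / (1/2 + of_nat i)"
      by simp
  qed (use e f in auto)
  have half: "pochhammer (3/2) N = real (2 * N + 1) * pochhammer (1/2 :: real) N"
    using pochhammer_shift[of "1/2" N] by (simp add: field_simps)
  have ph: "pochhammer (1/2 :: real) N > 0" by (intro pochhammer_pos) simp
  have ar: "e - 1/2 + (f - 1/2) + 2 = e + f + 1" "e - 1/2 + 2 = e + 3/2" "f - 1/2 + 1 = f + 1/2" by simp_all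
  have "christoffel_bound (e - 1/2) (f - 1/2) N =
      pochhammer (e + f + 1) N / pochhammer (f + 1/2) N * (pochhammer (e + 3/2) N / fact N)"
    unfolding christoffel_bound_def ar by simp
  also have "\<dots> \<le> pochhammer (e + 1) N / pochhammer (1/2) N * (pochhammer (e + 3/2) N / fact N)"
    using e by (intro mult_right_mono[OF 1] divide_nonneg_nonneg pochhammer_nonneg) auto
  also have "\<dots> \<le> (fact N * (real (N + 1) powr e * exp (13/22 * e))) / pochhammer (1/2) N *
      ((pochhammer (3/2) N * real (N + 1) powr e) / fact N)"
    using e ph pochhammer_ratio_le_half[OF e, of N] pochhammer_ratio_le_harm[OF e N]
    by (intro mult_mono divide_right_mono divide_nonneg_nonneg mult_nonneg_nonneg pochhammer_nonneg) auto
  also have "\<dots> = real (2 * N + 1) * ((real (N + 1) powr e * real (N + 1) powr e) * exp (13/22 * e))"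
    unfolding half using ph by simp
  also have "real (N + 1) powr e * real (N + 1) powr e = real (N + 1) powr (2 * e)"
    by (simp flip: powr_add)
  finally show ?thesis .
qed

text \<open>The squared constant \<open>m\<^sup>2\<close> of the theorem, with the first argument in
  the role of \<mu>. It is not symmetrized because lowering \<open>a\<close> by 1 may leave
  \<open>b\<close> the larger parameter.\<close>

definition jacobi_m :: "real \<Rightarrow> real \<Rightarrow> real" where
  "jacobi_m a b = (1 + sqrt ((a + b + 1) / 4) / 2) / (a + 3/2) *
     (exp (max a 0 / 3 + max (a\<^sup>2 + a * b) 0 / 4) / (2 powr (a + b) * (Gamma (a + 1))\<^sup>2))"

lemma jacobi_m_sq_eq: "jacobi_m_sq a b = jacobi_m (max a b) (min a b)"
proof -
  have s: "max a b + min a b = a + b" "max a b * min a b = a * b" by (auto simp: max_def min_def)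
  have e: "(exp x)\<^sup>2 = exp (2 * x)" for x :: real by (simp add: power2_eq_square flip: exp_add)
  have p: "(2 powr ((a + b) / 2))\<^sup>2 = 2 powr (a + b)" by (simp add: power2_eq_square flip: powr_add)
  have x: "2 * (2 * x / 12 + y / 8) = x / 3 + y / 4" for x y :: real by simp
  show ?thesis
    unfolding jacobi_m_sq_def jacobi_m_def jacobi_eta_def jacobi_c_def Let_def power_divide power_mult_distrib s e p x
    by simp
qed

lemma jacobi_m_nonneg: "a \<ge> -1/2 \<Longrightarrow> b \<ge> -1/2 \<Longrightarrow> jacobi_m a b \<ge> 0"
proof -
  assume "a \<ge> -1/2" "b \<ge> -1/2"
  then have "0 \<le> sqrt ((a + b + 1) / 4)" "0 \<le> a + 3/2" by simp_all
  then show ?thesis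
    unfolding jacobi_m_def by (intro mult_nonneg_nonneg divide_nonneg_nonneg) auto
qed

text \<open>The logarithm of the constant splits into four parts: \<open>l1\<close> for the square
  root, \<open>l2\<close> for the denominator \<open>1 + e\<close>, \<open>l3\<close> for the
  exponent, \<open>l4\<close> for the Gamma value.\<close>

lemma jacobi_m_ge:
  assumes e: "e \<ge> 0" "f \<ge> 0"
    and l: "exp l1 \<le> 1 + sqrt (e + f) / 4" "ln (1 + e) \<le> l2"
      "l3 \<le> max (e - 1/2) 0 / 3 + max ((e - 1/2) * (e + f - 1)) 0 / 4" "(Gamma (e + 1/2))\<^sup>2 \<le> exp l4"
  shows "exp (l1 - l2 + l3 - (e + f - 1) * ln 2 - l4) \<le> jacobi_m (e - 1/2) (f - 1/2)"
proof -
  have "e - 1/2 + (f - 1/2) + 1 = e + f" by simp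
  then have ar0: "sqrt ((e - 1/2 + (f - 1/2) + 1) / 4) / 2 = sqrt (e + f) / 4"
    by (simp only: real_sqrt_divide) simp
  have ar: "e - 1/2 + 3/2 = 1 + e"
    "(e - 1/2)\<^sup>2 + (e - 1/2) * (f - 1/2) = (e - 1/2) * (e + f - 1)" "e - 1/2 + (f - 1/2) = e + f - 1"
    "e - 1/2 + 1 = e + 1/2"
    by (simp_all add: real_sqrt_divide power2_eq_square field_simps)
  have G: "Gamma (e + 1/2) > 0" using e by (intro Gamma_real_pos) auto
  then have P: "0 < 2 powr (e + f - 1) * (Gamma (e + 1/2))\<^sup>2" by (intro mult_pos_pos) auto
  have "exp (l1 - l2 + l3 - (e + f - 1) * ln 2 - l4) =
      exp l1 / exp l2 * (exp l3 / (2 powr (e + f - 1) * exp l4))"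
    by (simp add: exp_diff exp_add powr_def)
  also have "\<dots> \<le> (1 + sqrt (e + f) / 4) / (1 + e) *
      (exp (max (e - 1/2) 0 / 3 + max ((e - 1/2) * (e + f - 1)) 0 / 4) / (2 powr (e + f - 1) * (Gamma (e + 1/2))\<^sup>2))"
  proof (intro mult_mono frac_le mult_left_mono l(1) l(4))
    have "1 + e = exp (ln (1 + e))" using e by simp
    also have "\<dots> \<le> exp l2" using l(2) by simp
    finally show "1 + e \<le> exp l2" .
  qed (use e l G P in auto)
  finally show ?thesis unfolding jacobi_m_def unfolding ar0 unfolding ar .
qed

text \<open>Log-convexity between \<open>Gamma (1/2) = sqrt pi\<close> and
  \<open>Gamma 1 = 1\<close>.\<close>

lemma Gamma_le_powr_pi:
  fixes e :: real
  assumes "0 \<le> e" "e \<le> 1/2"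
  shows "(Gamma (e + 1/2))\<^sup>2 \<le> exp ((1 - 2 * e) * ln pi)"
proof -
  have "Gamma ((1 - 2 * e) * (1/2) + 2 * e * 1) \<le> Gamma (1/2) powr (1 - 2 * e) * Gamma 1 powr (2 * e)"
    using assms by (intro Gamma_log_convex) auto
  moreover have "(1 - 2 * e) * (1/2) + 2 * e * 1 = e + 1/2" by (simp add: field_simps)
  ultimately have "Gamma (e + 1/2) \<le> sqrt pi powr (1 - 2 * e)" by (simp only: Gamma_one_half_real) simp
  then have "(Gamma (e + 1/2))\<^sup>2 \<le> (sqrt pi powr (1 - 2 * e))\<^sup>2"
    using assms Gamma_real_pos[of "e + 1/2"] by (intro power_mono) auto
  also have "\<dots> = pi powr (1 - 2 * e)"
    by (simp add: power2_eq_square flip: powr_mult)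
  finally show ?thesis by (simp add: powr_def)
qed

lemma Gamma_le_1:
  fixes e :: real
  assumes "1/2 \<le> e" "e \<le> 3/2"
  shows "(Gamma (e + 1/2))\<^sup>2 \<le> exp 0"
proof -
  have "Gamma ((1 - (e - 1/2)) * 1 + (e - 1/2) * 2) \<le> Gamma 1 powr (1 - (e - 1/2)) * Gamma 2 powr (e - 1/2)"
    using assms by (intro Gamma_log_convex) auto
  moreover have "(1 - (e - 1/2)) * 1 + (e - 1/2) * 2 = e + 1/2" by simp
  moreover have "Gamma (2 :: real) = 1" using Gamma_fact[of 1, where 'a = real] by simp
  ultimately have "Gamma (e + 1/2) \<le> 1" by (simp only:) simp
  then show ?thesis using Gamma_real_pos[of "e + 1/2"] assms by (simp add: abs_square_le_1)
qed

text \<open>A linear minorant of the logarithm of the constant, uniform in \<open>f\<close>. The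
  cases differ in the Gamma bound, which changes at \<open>e = 1/2\<close>, and in the point where
  \<open>ln (1 + e)\<close> is replaced by a tangent: \<open>1 + e\<close> near \<open>1\<close>,
  \<open>exp (4/10)\<close> and \<open>2\<close>.\<close>

lemma jacobi_m_ge_exp:
  fixes e f :: real
  assumes e: "2/25 \<le> e" "e \<le> 3/2" and f: "0 \<le> f" "f \<le> e \<or> (1/2 \<le> e \<and> f \<le> 1)"
  shows "exp (- (265/1000) - 79/100 * e) \<le> jacobi_m (e - 1/2) (f - 1/2)"
proof -
  have lb: "exp (- (265/1000) - 79/100 * e) \<le> jacobi_m (e - 1/2) (f - 1/2)"
    if "exp l1 \<le> 1 + sqrt (e + f) / 4" "ln (1 + e) \<le> l2"
      "l3 \<le> max (e - 1/2) 0 / 3 + max ((e - 1/2) * (e + f - 1)) 0 / 4" "(Gamma (e + 1/2))\<^sup>2 \<le> exp l4"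
      "- (265/1000) - 79/100 * e \<le> l1 - l2 + l3 - (e + f - 1) * ln 2 - l4" for l1 l2 l3 l4
    using order_trans[OF _ jacobi_m_ge[OF _ f(1) that(1-4)]] e that(5) by simp
  have ln1: "ln (1 + e) \<le> e" using e by (intro ln_add_one_self_le_self) auto
  have sq: "s \<le> sqrt (e + f)" if "s \<ge> 0" "s\<^sup>2 \<le> e + f" for s
    using that real_le_rsqrt by blast
  \<comment> \<open>In the exponent \<open>f\<close> enters through \<open>e + f - 1\<close>, with a
    nonpositive coefficient; replacing this by an upper bound \<open>u\<close> removes
    \<open>f\<close>.\<close>
  have slope: "u * ((e - 1/2) / 4 - 6945/10000) \<le> (e + f - 1) * ((e - 1/2) / 4 - ln 2)"
    if "0 \<le> u" "e + f - 1 \<le> u" for u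
  proof -
    have "(e - 1/2) / 4 - ln 2 \<le> 0" using e ln_numerals(1) by (simp add: field_simps)
    have "u * ((e - 1/2) / 4 - 6945/10000) \<le> u * ((e - 1/2) / 4 - ln 2)"
      using that ln_numerals(2) by (intro mult_left_mono) auto
    also have "\<dots> \<le> (e + f - 1) * ((e - 1/2) / 4 - ln 2)"
      by (rule mult_right_mono_neg) fact+
    finally show ?thesis .
  qed
  have eq: "(e + f - 1) * ((e - 1/2) / 4 - ln 2) = (e - 1/2) * (e + f - 1) / 4 - (e + f - 1) * ln 2"
    by (simp add: field_simps)
  consider "e \<le> 1/2" "f \<le> e" | "1/2 \<le> e" "e \<le> 1" "f \<le> 1" | "1 \<le> e" "f \<le> e" using e f by linarith
  then show ?thesis
  proof cases
    case 1
    show ?thesis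
    proof (rule lb[where ?l1.0 = "68/1000" and ?l2.0 = e and ?l3.0 = "(1/2 - e) * (1 - e - f) / 4" and ?l4.0 = "(1 - 2 * e) * ln pi"])
      have "2828/10000 \<le> sqrt (e + f)" using e f by (intro sq) (auto simp: power2_eq_square)
      then show "exp (68/1000) \<le> 1 + sqrt (e + f) / 4" using exp_numerals(4) by linarith
      have "(1/2 - e) * (1 - e - f) = (e - 1/2) * (e + f - 1)" by (simp add: field_simps)
      moreover have "x / 4 \<le> max y 0 / 3 + max x 0 / 4" for x y :: real by (simp add: max_def)
      ultimately show "(1/2 - e) * (1 - e - f) / 4 \<le> max (e - 1/2) 0 / 3 + max ((e - 1/2) * (e + f - 1)) 0 / 4" by metis
      have 1: "(1/2 - e) * (1 - 2 * e) \<le> (1/2 - e) * (1 - e - f)" using 1 by (intro mult_left_mono) auto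
      have 2: "(1 - 2 * e) * (69/100) \<le> (1 - e - f) * ln 2"
        using 1 ln_numerals(1) \<open>e \<le> 1/2\<close> \<open>f \<le> e\<close> by (intro mult_mono) auto
      have 3: "(1 - 2 * e) * ln pi \<le> (1 - 2 * e) * (115/100)"
        using ln_pi_bounds \<open>e \<le> 1/2\<close> by (intro mult_left_mono) auto
      have 4: "- (265/1000) - 79/100 * e \<le> 68/1000 - e + (1/2 - e) * (1 - 2 * e) / 4 + (1 - 2 * e) * (69/100) - (1 - 2 * e) * (115/100)"
      proof -
        have "(1/2 - e) * (1 - 2 * e) / 4 = 1/8 - 1/2 * e + e * e / 2" by (simp add: field_simps)
        moreover have "(1 - 2 * e) * (69/100) = 69/100 - 138/100 * e" "(1 - 2 * e) * (115/100) = 115/100 - 230/100 * e"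
          by simp_all
        moreover have "0 \<le> e * e / 2" by simp
        ultimately show ?thesis using e by linarith
      qed
      have 5: "- ((e + f - 1) * ln 2) = (1 - e - f) * ln 2" by (simp add: algebra_simps)
      show "- (265/1000) - 79/100 * e \<le> 68/1000 - e + (1/2 - e) * (1 - e - f) / 4 - (e + f - 1) * ln 2 - (1 - 2 * e) * ln pi"
        using 1 2 3 4 5 by linarith
    qed (use 1 e ln1 in \<open>auto intro: Gamma_le_powr_pi\<close>)
  next
    case 2
    show ?thesis
    proof (rule lb[where ?l1.0 = "162/1000" and ?l2.0 = "72/1000 + 672/1000 * e"
          and ?l3.0 = "(e - 1/2) / 3 + (e - 1/2) * (e + f - 1) / 4" and ?l4.0 = 0])
      have "7072/10000 - 2/10000 \<le> sqrt (e + f)" using 2 f by (intro sq) (auto simp: power2_eq_square)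
      then show "exp (162/1000) \<le> 1 + sqrt (e + f) / 4" using exp_numerals(5) by linarith
      show "(Gamma (e + 1/2))\<^sup>2 \<le> exp 0" using 2 by (intro Gamma_le_1) auto
      show "ln (1 + e) \<le> 72/1000 + 672/1000 * e"
      proof -
        define w where "w = (1 + e) / exp (4/10)"
        have "ln w \<le> w - 1" using e by (intro ln_le_minus_one) (auto simp: w_def)
        moreover have "ln w = ln (1 + e) - 4/10" using e by (simp add: w_def ln_div)
        moreover have "w \<le> 6712/10000 + 6712/10000 * e"
        proof -
          have "w \<le> (1 + e) / (1490/1000)"
            unfolding w_def using exp_numerals(10) e by (intro divide_left_mono) auto
          then show ?thesis using e by (simp add: field_simps)
        qed
        ultimately show ?thesis using 2 by linarith
      qed
      have 1: "e * ((e - 1/2) / 4 - 6945/10000) \<le> (e + f - 1) * ((e - 1/2) / 4 - ln 2)"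
        by (rule slope) (use 2 in auto)
      have 2: "- (265/1000) - 79/100 * e \<le> 162/1000 - (72/1000 + 672/1000 * e) + (e - 1/2) / 3 + e * ((e - 1/2) / 4 - 6945/10000)"
      proof -
        define q where "q = e * e"
        \<comment> \<open>The tangent to \<open>e * e\<close> close to the minimizer of the
          quadratic difference of both sides; the case \<open>1 \<le> e\<close> does the
          same.\<close>
        have "0 \<le> (e - 7344/10000) * (e - 7344/10000)" by simp
        also have "\<dots> = q - 14688/10000 * e + 7344/10000 * (7344/10000)" by (simp add: q_def field_simps)
        finally have "14688/10000 * e - 5394/10000 \<le> q" by simp
        moreover have "e * ((e - 1/2) / 4 - 6945/10000) = 1/4 * q - 8195/10000 * e" "(e - 1/2) / 3 = 1/3 * e - 1/6"
          by (simp_all add: q_def field_simps)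
        ultimately show ?thesis using \<open>e \<le> 1\<close> by linarith
      qed
      show "- (265/1000) - 79/100 * e \<le> 162/1000 - (72/1000 + 672/1000 * e) + ((e - 1/2) / 3 + (e - 1/2) * (e + f - 1) / 4) - (e + f - 1) * ln 2 - 0"
        using order_trans[OF 2 add_left_mono[OF 1]] unfolding eq by (simp add: algebra_simps)
    qed (use 2 e in auto)
  next
    case 3
    show ?thesis
    proof (rule lb[where ?l1.0 = "22/100" and ?l2.0 = "6945/10000 + (e - 1) / 2"
          and ?l3.0 = "(e - 1/2) / 3 + (e - 1/2) * (e + f - 1) / 4" and ?l4.0 = 0])
      have "1 \<le> sqrt (e + f)" using 3 f by (intro sq) auto
      then show "exp (22/100) \<le> 1 + sqrt (e + f) / 4" using exp_numerals(6) by linarith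
      show "(Gamma (e + 1/2))\<^sup>2 \<le> exp 0" using 3 e by (intro Gamma_le_1) auto
      show "ln (1 + e) \<le> 6945/10000 + (e - 1) / 2"
      proof -
        have "ln ((1 + e) / 2) \<le> (1 + e) / 2 - 1" using e by (intro ln_le_minus_one) auto
        moreover have "ln ((1 + e) / 2) = ln (1 + e) - ln 2" using e by (simp add: ln_div)
        ultimately show ?thesis using ln_numerals(2) by (simp add: field_simps)
      qed
      have 1: "(2 * e - 1) * ((e - 1/2) / 4 - 6945/10000) \<le> (e + f - 1) * ((e - 1/2) / 4 - ln 2)"
        by (rule slope) (use 3 e in auto)
      have 2: "- (265/1000) - 79/100 * e \<le> 22/100 - (6945/10000 + (e - 1) / 2) + (e - 1/2) / 3 + (2 * e - 1) * ((e - 1/2) / 4 - 6945/10000)"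
      proof -
        define q where "q = e * e"
        have "0 \<le> (e - 12657/10000) * (e - 12657/10000)" by simp
        also have "\<dots> = q - 25314/10000 * e + 12657/10000 * (12657/10000)" by (simp add: q_def field_simps)
        finally have "25314/10000 * e - 16021/10000 \<le> q" by simp
        moreover have "(2 * e - 1) * ((e - 1/2) / 4 - 6945/10000) = 1/2 * q - 1889/1000 * e + 8195/10000" "(e - 1/2) / 3 = 1/3 * e - 1/6" "(e - 1) / 2 = 1/2 * e - 1/2"
          by (simp_all add: q_def field_simps)
        ultimately show ?thesis using \<open>1 \<le> e\<close> by (simp only:)
      qed
      show "- (265/1000) - 79/100 * e \<le> 22/100 - (6945/10000 + (e - 1) / 2) + ((e - 1/2) / 3 + (e - 1/2) * (e + f - 1) / 4) - (e + f - 1) * ln 2 - 0"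
        using order_trans[OF 2 add_left_mono[OF 1]] unfolding eq by (simp add: algebra_simps)
    qed (use 3 e in auto)
  qed
qed

text \<open>The cutoff \<open>2/25 \<le> e\<close> excludes a neighbourhood of the Chebyshev case, where this fails for large \<open>N\<close>.\<close>

lemma crude_bound:
  fixes a b :: real
  defines "e \<equiv> a + 1/2"
  assumes e: "2/25 \<le> e" "e \<le> 3/2" and b: "-1/2 \<le> b" "b \<le> a \<or> (0 \<le> a \<and> b \<le> 1/2)" and N: "N \<ge> 2"
  shows "christoffel_bound a b N * (real N + 1/3) \<le> 2519/1000 * (jacobi_m a b * real (N + 1) powr (2 * a + 2))\<^sup>2"
proof -
  define d where "d = real (N + 1)"
  have d: "d \<ge> 3" using N by (simp add: d_def)
  have N1: "real (2 * N + 1) = 2 * d - 1" "real N + 1/3 = d - 2/3" by (simp_all add: d_def)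
  have ab: "a = e - 1/2" "b = (b + 1/2) - 1/2" by (simp_all add: e_def)
  have R: "christoffel_bound a b N \<le> (2 * d - 1) * (d powr (2 * e) * exp (13/22 * e))"
  proof -
    have "christoffel_bound (e - 1/2) (b + 1/2 - 1/2) N \<le>
        real (2 * N + 1) * (real (N + 1) powr (2 * e) * exp (13/22 * e))"
      using e b N by (intro christoffel_bound_le) auto
    then show ?thesis unfolding ab[symmetric] N1 d_def[symmetric] .
  qed
  have m: "exp (- (265/1000) - 79/100 * e) \<le> jacobi_m a b"
    using jacobi_m_ge_exp[of e "b + 1/2"] e b by (auto simp: e_def)
  \<comment> \<open>The numbers collect what the final comparison needs:
    \<open>3/10 = 53/100 - 23/100\<close>, and \<open>217091/100000\<close> is just above
    \<open>13/22 + 158/100\<close>. The part of \<open>2 * e\<close> above \<open>4/25\<close> uses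
    \<open>d \<ge> 3\<close>; the rest, \<open>4/25 * ln d + 7 / (6 * d)\<close>, is smallest near
    \<open>d = exp 2\<close>, hence the tangent there.\<close>
  have ln_d: "3/10 + 217091/100000 * e \<le> 2 * e * ln d + 7 / (6 * d)"
  proof -
    have 1: "109/100 \<le> ln d" using ln_numerals(3) ln_mono[of 3 d] d by linarith
    have "ln (d / exp 2) \<ge> 1 - 1 / (d / exp 2)"
      using ln_le_minus_one[of "exp 2 / d"] d by (simp add: ln_div)
    then have "3 - exp 2 / d \<le> ln d" using d by (simp add: ln_div)
    moreover have "exp 2 / d \<le> (74/10) / d"
    proof -
      have "exp 2 \<le> (74/10 :: real)"
      proof -
        have "exp (1/4 :: real) \<le> 12841/10000" using exp_le_bernstein'[of "1/4"] by (simp add: power2_eq_square)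
        then have "exp (1/4 :: real) ^ 8 \<le> (12841/10000) ^ 8" by (intro power_mono) auto
        also have "(12841/10000) ^ 8 \<le> (74/10 :: real)" by (simp add: eval_nat_numeral)
        finally show ?thesis by (simp flip: exp_of_nat_mult)
      qed
      then show ?thesis using d by (intro divide_right_mono) auto
    qed
    ultimately have 2: "3 - (74/10) / d \<le> ln d" by linarith
    define P where "P = (2 * e - 4/25) * ln d"
    define i where "i = 1 / d"
    have "(2 * e - 4/25) * (109/100) \<le> P" unfolding P_def using 1 e by (intro mult_left_mono) auto
    then have "218/100 * e - 1744/10000 \<le> P" by simp
    moreover have "3 - (74/10) * i \<le> ln d" using 2 by (simp add: i_def)
    moreover have "i \<le> 1/3" using d by (simp add: i_def field_simps)
    ultimately have "3/10 + 217091/100000 * e \<le> P + 4/25 * ln d + 7/6 * i" using e by linarith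
    also have "\<dots> = 2 * e * ln d + 7 / (6 * d)" by (simp add: P_def i_def algebra_simps)
    finally show ?thesis .
  qed
  \<comment> \<open>The left-hand side is
    \<open>2 * d\<^sup>2 * (1 - 1 / (2 * d)) * (1 - 2 / (3 * d))\<close>, and
    \<open>1 - y \<le> exp (- y)\<close> applies twice.\<close>
  have poly: "(2 * d - 1) * (d - 2/3) \<le> 2 * d\<^sup>2 * exp (- 7 / (6 * d))"
  proof -
    have "1 - 1 / (2 * d) \<le> exp (- 1 / (2 * d))" "1 - 2 / (3 * d) \<le> exp (- 2 / (3 * d))"
      using exp_ge_add_one_self[of "- 1 / (2 * d)"] exp_ge_add_one_self[of "- 2 / (3 * d)"] by simp_all
    then have "(1 - 1 / (2 * d)) * (1 - 2 / (3 * d)) \<le> exp (- 1 / (2 * d)) * exp (- 2 / (3 * d))"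
      using d by (intro mult_mono) (auto simp: field_simps)
    also have "\<dots> = exp (- 7 / (6 * d))"
      using d by (simp add: field_simps flip: exp_add)
    finally have "2 * d\<^sup>2 * ((1 - 1 / (2 * d)) * (1 - 2 / (3 * d))) \<le> 2 * d\<^sup>2 * exp (- 7 / (6 * d))"
      by (intro mult_left_mono) auto
    also have "2 * d\<^sup>2 * ((1 - 1 / (2 * d)) * (1 - 2 / (3 * d))) = (2 * d - 1) * (d - 2/3)"
      using d by (simp add: field_simps power2_eq_square)
    finally show ?thesis .
  qed
  have "christoffel_bound a b N * (real N + 1/3) \<le>
      (2 * d - 1) * (d powr (2 * e) * exp (13/22 * e)) * (d - 2/3)"
    unfolding N1 using R d by (intro mult_right_mono) auto
  also have "\<dots> = ((2 * d - 1) * (d - 2/3)) * (exp (2 * e * ln d) * exp (13/22 * e))"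
    using d by (simp add: powr_def)
  also have "\<dots> \<le> (2 * d\<^sup>2 * exp (- 7 / (6 * d))) * (exp (2 * e * ln d) * exp (13/22 * e))"
    by (intro mult_right_mono poly) auto
  also have "\<dots> = d\<^sup>2 * (2 * exp (- 7 / (6 * d) + 2 * e * ln d + 13/22 * e))"
    by (simp only: exp_add mult_ac)
  also have "\<dots> \<le> d\<^sup>2 * (2519/1000 * exp (2 * (- (265/1000) - 79/100 * e) + 4 * e * ln d))"
  proof (rule mult_left_mono)
    have "2 * exp (23/100) \<le> (2519/1000 :: real)" using exp_numerals(7) by linarith
    then have "2 \<le> 2519/1000 * exp (- (23/100) :: real)" by (simp add: exp_minus field_simps)
    then have "2 * exp (- 7 / (6 * d) + 2 * e * ln d + 13/22 * e) \<le>
        2519/1000 * exp (- (23/100)) * exp (- 7 / (6 * d) + 2 * e * ln d + 13/22 * e)"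
      by (intro mult_right_mono) auto
    also have "\<dots> = 2519/1000 * exp (- (23/100) + (- 7 / (6 * d) + 2 * e * ln d + 13/22 * e))"
      unfolding mult.assoc exp_add[symmetric] ..
    also have "\<dots> \<le> 2519/1000 * exp (2 * (- (265/1000) - 79/100 * e) + 4 * e * ln d)"
    proof (intro mult_left_mono)
      have "- (23/100) + (- 7 / (6 * d) + 2 * e * ln d + 13/22 * e) \<le> 2 * (- (265/1000) - 79/100 * e) + 4 * e * ln d"
        using ln_d e by simp
      then show "exp (- (23/100) + (- 7 / (6 * d) + 2 * e * ln d + 13/22 * e)) \<le>
          exp (2 * (- (265/1000) - 79/100 * e) + 4 * e * ln d)" by simp
    qed simp
    finally show "2 * exp (- 7 / (6 * d) + 2 * e * ln d + 13/22 * e) \<le>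
        2519/1000 * exp (2 * (- (265/1000) - 79/100 * e) + 4 * e * ln d)" .
  qed simp
  also have "\<dots> = 2519/1000 * (exp (- (265/1000) - 79/100 * e) * d powr (2 * a + 2))\<^sup>2"
  proof -
    have "d powr (2 * a + 2) = d * exp (2 * e * ln d)"
    proof -
      have "2 * a + 2 = 1 + 2 * e" by (simp add: e_def)
      then show ?thesis using d by (simp only: powr_add) (simp add: powr_def)
    qed
    moreover have "exp (2 * x + 4 * e * ln d) = (exp x * exp (2 * e * ln d))\<^sup>2" for x
      by (simp add: power2_eq_square flip: exp_add)
    ultimately show ?thesis by (simp only: power_mult_distrib) (simp add: mult_ac)
  qed
  also have "\<dots> \<le> 2519/1000 * (jacobi_m a b * d powr (2 * a + 2))\<^sup>2"
    using m by (intro mult_left_mono power_mono mult_right_mono) auto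
  finally show ?thesis unfolding d_def .
qed

section \<open>Growth of both sides under unit steps of the parameters\<close>

lemma pochhammer_plus_1: "x > 0 \<Longrightarrow> pochhammer (x + 1) n = pochhammer x n * ((x + real n) / x)" for x :: real
  using pochhammer_shift[of x n] by (simp add: nonzero_eq_divide_eq mult.commute)

lemma christoffel_bound_Suc_left:
  assumes "a \<ge> 0" "b \<ge> -1/2"
  shows "christoffel_bound (a + 1) b N =
    christoffel_bound a b N * ((a + b + 2 + real N) / (a + b + 2) * ((a + 2 + real N) / (a + 2)))"
proof -
  have ar: "a + 1 + b + 2 = a + b + 2 + 1" "a + 1 + 2 = a + 2 + 1" by simp_all
  have "W * p * (V * q) / (F * U) = W * V / (F * U) * (p * q)" for W V F U p q :: real by simp
  moreover have "pochhammer (a + b + 2 + 1) N = pochhammer (a + b + 2) N * ((a + b + 2 + real N) / (a + b + 2))"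
    by (rule pochhammer_plus_1) (use assms in simp)
  moreover have "pochhammer (a + 2 + 1) N = pochhammer (a + 2) N * ((a + 2 + real N) / (a + 2))"
    by (rule pochhammer_plus_1) (use assms in simp)
  ultimately show ?thesis
    unfolding christoffel_bound_def ar by metis
qed

lemma christoffel_bound_Suc_both:
  assumes "a \<ge> 0" "b \<ge> -1/2"
  shows "christoffel_bound (a + 1) (b + 1) N =
    christoffel_bound a b N * ((a + b + 2 + real N) / (a + b + 2) * ((a + b + 3 + real N) / (a + b + 3)) *
      ((a + 2 + real N) / (a + 2)) * ((b + 1) / (b + 1 + real N)))"
proof -
  have ar: "a + 1 + (b + 1) + 2 = a + b + 3 + 1" "a + 1 + 2 = a + 2 + 1" "a + b + 3 = a + b + 2 + 1" by simp_all
  have key: "W * p * r * (V * q) / (F * (U * (s / t))) = W * V / (F * U) * (p * r * q * (t / s))"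
    for W V F U p q r s t :: real by (simp add: mult_ac)
  have "pochhammer (a + b + 3 + 1) N = pochhammer (a + b + 2) N * ((a + b + 2 + real N) / (a + b + 2)) *
      ((a + b + 3 + real N) / (a + b + 3))"
    using assms pochhammer_plus_1[of "a + b + 3" N] pochhammer_plus_1[of "a + b + 2" N]
    by (simp only: ar(3))
  moreover have "pochhammer (a + 2 + 1) N = pochhammer (a + 2) N * ((a + 2 + real N) / (a + 2))"
    by (rule pochhammer_plus_1) (use assms in simp)
  moreover have "pochhammer (b + 1 + 1) N = pochhammer (b + 1) N * ((b + 1 + real N) / (b + 1))"
    by (rule pochhammer_plus_1) (use assms in simp)
  ultimately show ?thesis
    unfolding christoffel_bound_def ar(1,2) by (simp only: key)
qed

text \<open>The Gamma value grows by \<open>a + 1\<close>, the power of 2 by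
  \<open>2 powr (1 + b' - b)\<close>, and of the square root only monotonicity is kept.
  \<open>l\<close> is a guaranteed gain in the exponent term with \<open>max\<close>.\<close>

lemma jacobi_m_Suc_ge:
  assumes a: "a \<ge> 0" and b: "b \<ge> -1/2" "b' \<ge> b"
    and l: "max (a\<^sup>2 + a * b) 0 + l \<le> (a + 1)\<^sup>2 + (a + 1) * b'"
  shows "jacobi_m a b * ((a + 3/2) / (a + 5/2) * exp (1/3 + l / 4) / (2 powr (1 + b' - b) * (a + 1)\<^sup>2)) \<le> jacobi_m (a + 1) b'"
proof -
  have G: "Gamma (a + 1 + 1) = (a + 1) * Gamma (a + 1)"
    using a by (intro Gamma_plus1) (auto elim!: nonpos_Ints_cases)
  have Gp: "Gamma (a + 1) > 0" using a by (intro Gamma_real_pos) auto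
  define E where "E = max (a\<^sup>2 + a * b) 0"
  define E' where "E' = max ((a + 1)\<^sup>2 + (a + 1) * b') 0"
  define S where "S = sqrt ((a + b + 1) / 4)"
  define S' where "S' = sqrt ((a + 1 + b' + 1) / 4)"
  have S: "0 \<le> S" "S \<le> S'" unfolding S_def S'_def using a b by (auto intro!: real_sqrt_le_mono)
  have EE: "E + l \<le> E'" using l by (simp add: E_def E'_def)
  have p: "2 powr (a + 1 + b') = 2 powr (a + b) * 2 powr (1 + b' - b)" by (simp add: add_ac flip: powr_add)
  have "jacobi_m a b * ((a + 3/2) / (a + 5/2) * exp (1/3 + l / 4) / (2 powr (1 + b' - b) * (a + 1)\<^sup>2)) =
      (1 + S / 2) / (a + 5/2) * (exp (a / 3 + E / 4 + (1/3 + l / 4)) / (2 powr (a + 1 + b') * (Gamma (a + 1 + 1))\<^sup>2))"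
  proof -
    have mx: "max a 0 = a" using a by simp
    have key: "s / w * (x / (p * g2)) * (w / r * y / (t * u2)) = s / r * (x * y / (p * t * (u2 * g2)))"
      if "w \<noteq> 0" for s w x p g2 r y t u2 :: real using that by (simp add: mult_ac)
    show ?thesis
      unfolding jacobi_m_def mx G p power_mult_distrib exp_add[of "a / 3 + max (a\<^sup>2 + a * b) 0 / 4"] E_def S_def
      by (rule key) (use a in simp)
  qed
  also have "\<dots> \<le> (1 + S' / 2) / (a + 5/2) * (exp ((a + 1) / 3 + E' / 4) / (2 powr (a + 1 + b') * (Gamma (a + 1 + 1))\<^sup>2))"
    using S EE a G Gp by (intro mult_mono divide_right_mono) (auto simp: add_divide_distrib)
  also have "\<dots> = jacobi_m (a + 1) b'"
  proof -
    have "max (a + 1) 0 = a + 1" "a + 1 + 3/2 = a + 5/2" using a by simp_all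
    then show ?thesis unfolding jacobi_m_def E'_def S'_def by (simp only:)
  qed
  finally show ?thesis .
qed

text \<open>A polynomial minorant, exact at \<open>x = y\<close>, which turns the step estimates
  into polynomial inequalities.\<close>

lemma exp_ge_tangent_power:
  fixes x y :: real
  assumes "n > 0" "0 \<le> 1 + (x - y) / n"
  shows "exp y * (1 + (x - y) / n) ^ n \<le> exp x"
proof -
  have "(1 + (x - y) / n) ^ n \<le> exp ((x - y) / n) ^ n"
    using assms by (intro power_mono exp_ge_add_one_self) auto
  also have "\<dots> = exp (x - y)" using assms by (simp flip: exp_of_nat_mult)
  finally have "exp y * (1 + (x - y) / n) ^ n \<le> exp y * exp (x - y)" by (intro mult_left_mono) auto
  then show ?thesis by (simp flip: exp_add)
qed

text \<open>The step from \<open>a\<close> to \<open>a + 1\<close> at \<open>N = 2\<close>, where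
  \<open>81 = 3 ^ 4\<close>, and at the worst value \<open>b = -1/2\<close>; other cases reduce to
  it. The exponential is replaced by its tangent power at \<open>a = 2\<close>.\<close>

lemma step_left_estimate:
  fixes a :: real
  assumes a: "a \<ge> 0"
  shows "(a + 7/2) * (a + 4) / ((a + 3/2) * (a + 2)) / 81 \<le>
    ((a + 3/2) / (a + 5/2) * exp (1/3 + (2 * a + 7/16) / 4) / (2 * (a + 1)\<^sup>2))\<^sup>2"
proof -
  have "17 * ((a + 2) / 4) ^ 4 \<le> exp (277/96) * (1 + (a - 2) / 4) ^ 4"
    using exp_numerals(11) by (intro mult_mono) (auto simp: field_simps)
  also have "\<dots> = exp (85/96) * (exp 2 * (1 + (a - 2) / real 4) ^ 4)"
    by (simp flip: exp_add)
  also have "\<dots> \<le> exp (85/96) * exp a"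
    using a by (intro mult_left_mono exp_ge_tangent_power) (auto simp: field_simps)
  finally have E: "17 * ((a + 2) / 4) ^ 4 \<le> exp (a + 85/96)" by (simp add: exp_add mult.commute)
  have poly: "(a + 7/2) * (a + 4) * (a + 5/2)\<^sup>2 * (a + 1) ^ 4 \<le> 17 * 81 / 1024 * ((a + 2) ^ 5 * (a + 3/2) ^ 3)"
  proof -
    \<comment> \<open>With denominators cleared, all coefficients of the difference are
      nonnegative.\<close>
    have "8192 * (17 * 81 / 1024 * ((a + 2) ^ 5 * (a + 3/2) ^ 3)) - 8192 * ((a + 7/2) * (a + 4) * (a + 5/2)\<^sup>2 * (a + 1) ^ 4) =
        472928 + 1529136 * a + 1905616 * a ^ 2 + 1147480 * a ^ 3 + 390270 * a ^ 4 + 147959 * a ^ 5 + 78878 * a ^ 6 + 24564 * a ^ 7 + 2824 * a ^ 8"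
      by (simp add: eval_nat_numeral field_simps)
    also have "\<dots> \<ge> 0" using a by (intro add_nonneg_nonneg mult_nonneg_nonneg zero_le_power) auto
    finally have "8192 * ((a + 7/2) * (a + 4) * (a + 5/2)\<^sup>2 * (a + 1) ^ 4) \<le> 8192 * (17 * 81 / 1024 * ((a + 2) ^ 5 * (a + 3/2) ^ 3))" by (simp only: diff_ge_0_iff_ge)
    then show ?thesis by (rule mult_left_le_imp_le) simp
  qed
  have "(a + 7/2) * (a + 4) / ((a + 3/2) * (a + 2)) / 81 \<le>
      (a + 3/2)\<^sup>2 / (a + 5/2)\<^sup>2 * (17 * ((a + 2) / 4) ^ 4) / (4 * (a + 1) ^ 4)"
  proof -
    have "(a + 7/2) * (a + 4) / ((a + 3/2) * (a + 2)) / 81 =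
        ((a + 7/2) * (a + 4) * (a + 5/2)\<^sup>2 * (a + 1) ^ 4) / ((a + 3/2) * (a + 2) * 81 * (a + 5/2)\<^sup>2 * (a + 1) ^ 4)"
      using a by simp
    also have "\<dots> \<le> (17 * 81 / 1024 * ((a + 2) ^ 5 * (a + 3/2) ^ 3)) / ((a + 3/2) * (a + 2) * 81 * (a + 5/2)\<^sup>2 * (a + 1) ^ 4)"
      using a by (intro divide_right_mono poly) auto
    also have "\<dots> = (a + 3/2)\<^sup>2 / (a + 5/2)\<^sup>2 * (17 * ((a + 2) / 4) ^ 4) / (4 * (a + 1) ^ 4)"
      using a by (simp add: power_divide divide_simps) (simp add: eval_nat_numeral)
    finally show ?thesis .
  qed
  also have "\<dots> \<le> (a + 3/2)\<^sup>2 / (a + 5/2)\<^sup>2 * exp (a + 85/96) / (4 * (a + 1) ^ 4)"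
    using a by (intro divide_right_mono mult_left_mono E) auto
  also have "\<dots> = ((a + 3/2) / (a + 5/2) * exp (1/3 + (2 * a + 7/16) / 4) / (2 * (a + 1)\<^sup>2))\<^sup>2"
  proof -
    have "(exp (1/3 + (2 * a + 7/16) / 4))\<^sup>2 = exp (a + 85/96)"
      by (simp add: power2_eq_square field_simps flip: exp_add)
    then show ?thesis by (simp add: power_divide power_mult_distrib flip: power_mult)
  qed
  finally show ?thesis .
qed

text \<open>The analogue for raising both parameters. The quotient in \<open>b\<close> is bounded by
  a multiple of \<open>exp (b / 2)\<close>, the factor in \<open>b\<close> that the right-hand side
  contains; the exponential in \<open>a\<close> is replaced by its tangent power at
  \<open>a = 1\<close>.\<close>

lemma step_both_estimate:
  fixes a b :: real
  assumes a: "a \<ge> 0" and b: "b \<ge> -1/2"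
  shows "(a + 7/2) * (a + 9/2) * (a + 4) / ((a + 3/2) * (a + 5/2) * (a + 2)) * ((b + 1) / (b + 3)) / 81 \<le>
    ((a + 3/2) / (a + 5/2) * exp (1/3 + (3 * a + b + 31/16) / 4) / (4 * (a + 1)\<^sup>2))\<^sup>2"
proof -
  have bb: "(b + 1) / (b + 3) \<le> 35/100 * exp (b / 2)"
  proof -
    \<comment> \<open>\<open>12/100\<close> is about \<open>b / 2\<close> where
      \<open>(b + 1) / (b + 3) * exp (- b / 2)\<close> is largest.\<close>
    have "1 + 12/100 \<le> exp (12/100 :: real)" by (rule exp_ge_add_one_self)
    then have "(1 + 12/100) * (1 + (b / 2 - 12/100)) \<le> exp (12/100) * exp (b / 2 - 12/100)"
      using b exp_ge_add_one_self[of "b / 2 - 12/100"] by (intro mult_mono) auto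
    then have "35/100 * ((112/100) * (88/100 + b / 2)) \<le> 35/100 * exp (b / 2)"
      by (simp flip: exp_add)
    moreover have "(b + 1) / (b + 3) \<le> 35/100 * ((112/100) * (88/100 + b / 2))"
    proof -
      define q where "q = b * b"
      have "0 \<le> (b - 175/1000) * (b - 175/1000)" by simp
      also have "\<dots> = q - 35/100 * b + 30625/1000000" by (simp add: q_def field_simps)
      finally have q: "35/100 * b - 30625/1000000 \<le> q" by simp
      have eq: "35/100 * ((112/100) * (88/100 + b / 2)) * (b + 3) = 196/1000 * q + 93296/100000 * b + 103488/100000"
        by (simp add: q_def field_simps)
      have "b + 1 \<le> 35/100 * ((112/100) * (88/100 + b / 2)) * (b + 3)" unfolding eq using q b by linarith
      then show ?thesis using b by (simp add: pos_divide_le_eq)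
    qed
    ultimately show ?thesis by linarith
  qed
  have "20 * ((a + 3) / 4) ^ 6 \<le> exp (301/96) * (1 + (3/2 * a - 3/2) / 6) ^ 6"
    using exp_numerals(12) a by (intro mult_mono power_mono) (auto simp: field_simps)
  also have "\<dots> = exp (157/96) * (exp (3/2) * (1 + (3/2 * a - 3/2) / real 6) ^ 6)"
    by (simp flip: exp_add)
  also have "\<dots> \<le> exp (157/96) * exp (3/2 * a)"
    using a by (intro mult_left_mono exp_ge_tangent_power) (auto simp: field_simps)
  finally have E: "20 * ((a + 3) / 4) ^ 6 \<le> exp (3/2 * a + 157/96)" by (simp add: exp_add mult.commute)
  have poly: "35/100 * ((a + 7/2) * (a + 9/2) * (a + 4) * (a + 5/2) * (a + 1) ^ 4) \<le>
      20 * 81 / (16 * 4096) * ((a + 3) ^ 6 * (a + 3/2) ^ 3 * (a + 2))"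
  proof -
    have "655360 * (20 * 81 / (16 * 4096) * ((a + 3) ^ 6 * (a + 3/2) ^ 3 * (a + 2))) - 655360 * (35/100 * ((a + 7/2) * (a + 9/2) * (a + 4) * (a + 5/2) * (a + 1) ^ 4)) =
        43589430 + 172383347 * a + 315521254 * a ^ 2 + 369808569 * a ^ 3 + 313735600 * a ^ 4 + 194172425 * a ^ 5 + 83506302 * a ^ 6 + 23586119 * a ^ 7 + 4108174 * a ^ 8 + 396900 * a ^ 9 + 16200 * a ^ 10"
      by (simp add: eval_nat_numeral field_simps)
    also have "\<dots> \<ge> 0" using a by (intro add_nonneg_nonneg mult_nonneg_nonneg zero_le_power) auto
    finally have "655360 * (35/100 * ((a + 7/2) * (a + 9/2) * (a + 4) * (a + 5/2) * (a + 1) ^ 4)) \<le> 655360 * (20 * 81 / (16 * 4096) * ((a + 3) ^ 6 * (a + 3/2) ^ 3 * (a + 2)))" by (simp only: diff_ge_0_iff_ge)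
    then show ?thesis by (rule mult_left_le_imp_le) simp
  qed
  have "(a + 7/2) * (a + 9/2) * (a + 4) / ((a + 3/2) * (a + 5/2) * (a + 2)) * ((b + 1) / (b + 3)) / 81 \<le>
      (a + 7/2) * (a + 9/2) * (a + 4) / ((a + 3/2) * (a + 5/2) * (a + 2)) * (35/100 * exp (b / 2)) / 81"
    using a by (intro divide_right_mono mult_left_mono bb) auto
  also have "\<dots> = (35/100 * ((a + 7/2) * (a + 9/2) * (a + 4) * (a + 5/2) * (a + 1) ^ 4)) /
      ((a + 3/2) * (a + 2) * 81 * (a + 5/2)\<^sup>2 * (a + 1) ^ 4) * exp (b / 2)"
  proof -
    have id: "p / (x * y * z) * (c * E) / 81 = (c * (p * y * w)) / (x * z * 81 * y\<^sup>2 * w) * E"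
      if "x \<noteq> 0" "y \<noteq> 0" "z \<noteq> 0" "w \<noteq> 0" for p x y z w c E :: real
      using that by (simp add: power2_eq_square mult_ac)
    show ?thesis by (rule id) (use a in auto)
  qed
  also have "\<dots> \<le> (20 * 81 / (16 * 4096) * ((a + 3) ^ 6 * (a + 3/2) ^ 3 * (a + 2))) /
      ((a + 3/2) * (a + 2) * 81 * (a + 5/2)\<^sup>2 * (a + 1) ^ 4) * exp (b / 2)"
    using a by (intro mult_right_mono divide_right_mono poly) auto
  also have "\<dots> = (a + 3/2)\<^sup>2 / (a + 5/2)\<^sup>2 * (20 * ((a + 3) / 4) ^ 6) / (16 * (a + 1) ^ 4) * exp (b / 2)"
    using a by (simp add: power_divide divide_simps) (simp add: eval_nat_numeral)
  also have "\<dots> \<le> (a + 3/2)\<^sup>2 / (a + 5/2)\<^sup>2 * exp (3/2 * a + 157/96) / (16 * (a + 1) ^ 4) * exp (b / 2)"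
    using a by (intro mult_right_mono divide_right_mono mult_left_mono E) auto
  also have "\<dots> = ((a + 3/2) / (a + 5/2) * exp (1/3 + (3 * a + b + 31/16) / 4) / (4 * (a + 1)\<^sup>2))\<^sup>2"
  proof -
    have "(exp (1/3 + (3 * a + b + 31/16) / 4))\<^sup>2 = exp (3/2 * a + 157/96 + b / 2)"
      by (simp add: power2_eq_square field_simps flip: exp_add)
    also have "\<dots> = exp (3/2 * a + 157/96) * exp (b / 2)" by (rule exp_add)
    finally show ?thesis by (simp add: power_divide power_mult_distrib flip: power_mult)
  qed
  finally show ?thesis .
qed

text \<open>The left-hand side is \<open>\<sigma>2 + R/3\<close> for \<open>r = 1\<close>, and \<open>2519/1000\<close> bounds \<open>1 / 0.63\<^sup>2\<close> from below.\<close>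

definition crude_ineq :: "real \<Rightarrow> real \<Rightarrow> nat \<Rightarrow> bool" where
  "crude_ineq a b N \<longleftrightarrow>
     christoffel_bound a b N * (real N + 1/3) \<le> 2519/1000 * (jacobi_m a b * real (N + 1) powr (2 * a + 2))\<^sup>2"

text \<open>Passing to \<open>a + 1\<close> multiplies \<open>d powr (2 * a + 2)\<close> by
  \<open>d\<^sup>2\<close>, so the right-hand side gains at least \<open>d ^ 4 * m\<^sup>2\<close>,
  which must cover the growth \<open>q\<close> of the left-hand side.\<close>

lemma crude_ineq_step:
  assumes a: "a \<ge> 0" "a \<ge> -1/2" "b \<ge> -1/2" and N: "N \<ge> 2"
    and R: "christoffel_bound (a + 1) b' N = christoffel_bound a b N * q"
    and q: "0 \<le> q" "q \<le> (real (N + 1)) ^ 4 * m\<^sup>2"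
    and m: "m \<ge> 0" "jacobi_m a b * m \<le> jacobi_m (a + 1) b'"
    and IH: "crude_ineq a b N"
  shows "crude_ineq (a + 1) b' N"
proof -
  let ?d = "real (N + 1)"
  let ?J = "jacobi_m a b * ?d powr (2 * a + 2)"
  have J0: "jacobi_m a b \<ge> 0" using a by (intro jacobi_m_nonneg) auto
  have "christoffel_bound (a + 1) b' N * (real N + 1/3) = (christoffel_bound a b N * (real N + 1/3)) * q"
    unfolding R by simp
  also have "\<dots> \<le> 2519/1000 * ?J\<^sup>2 * q"
    using IH q by (intro mult_right_mono) (auto simp: crude_ineq_def)
  also have "\<dots> \<le> 2519/1000 * ?J\<^sup>2 * (?d ^ 4 * m\<^sup>2)"
    by (intro mult_left_mono q) auto
  also have "\<dots> = 2519/1000 * ((jacobi_m a b * m) * (?d powr (2 * a + 2) * ?d\<^sup>2))\<^sup>2"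
    by (simp add: power_mult_distrib mult_ac flip: power_mult)
  also have "?d powr (2 * a + 2) * ?d\<^sup>2 = ?d powr (2 * (a + 1) + 2)"
  proof -
    have "?d\<^sup>2 = ?d powr 2" using powr_realpow[of ?d 2] by simp
    then show ?thesis by (simp only: powr_add[symmetric]) simp
  qed
  also have "2519/1000 * ((jacobi_m a b * m) * ?d powr (2 * (a + 1) + 2))\<^sup>2 \<le>
      2519/1000 * (jacobi_m (a + 1) b' * ?d powr (2 * (a + 1) + 2))\<^sup>2"
    using m J0 by (intro mult_left_mono power_mono mult_right_mono) auto
  finally show ?thesis by (simp add: crude_ineq_def)
qed

text \<open>Compares a growth factor with its value at \<open>d = 3\<close>, the slack being
  \<open>(d - 3) * (x - 1)\<close>. This reduces the steps to \<open>N = 2\<close>.\<close>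

lemma ratio_le:
  fixes d x :: real
  assumes "d \<ge> 3" "x \<ge> 1"
  shows "0 \<le> (x + d - 1) / x" "(x + d - 1) / x \<le> d / 3 * ((x + 2) / x)"
proof -
  show "0 \<le> (x + d - 1) / x" using assms by simp
  have "0 \<le> (d - 3) * (x - 1)" using assms by simp
  then have "x + d - 1 \<le> d / 3 * (x + 2)" using assms by (simp add: field_simps)
  then have "(x + d - 1) / x \<le> (d / 3 * (x + 2)) / x" using assms by (intro divide_right_mono) auto
  then show "(x + d - 1) / x \<le> d / 3 * ((x + 2) / x)" by simp
qed

lemma crude_ineq_step_left:
  assumes a: "a \<ge> 0" and b: "b \<ge> -1/2" and N: "N \<ge> 2" and IH: "crude_ineq a b N"
  shows "crude_ineq (a + 1) b N"
proof -
  define d where "d = real (N + 1)"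
  have d: "d \<ge> 3" and Nd: "real N = d - 1" using N by (simp_all add: d_def)
  let ?m = "(a + 3/2) / (a + 5/2) * exp (1/3 + (2 * a + 7/16) / 4) / (2 * (a + 1)\<^sup>2)"
  have "(a + b + 2 + real N) / (a + b + 2) * ((a + 2 + real N) / (a + 2)) \<le>
      (d / 3 * ((a + b + 2 + 2) / (a + b + 2))) * (d / 3 * ((a + 2 + 2) / (a + 2)))"
    using ratio_le[OF d, of "a + b + 2"] ratio_le[OF d, of "a + 2"] a b unfolding Nd
    by (intro mult_mono) (simp_all add: add_diff_eq)
  also have "\<dots> = (d / 3)\<^sup>2 * ((a + b + 2 + 2) / (a + b + 2) * ((a + 4) / (a + 2)))"
  proof -
    have "(t * A) * (t * B) = t\<^sup>2 * (A * B)" for t A B :: real by (simp add: power2_eq_square)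
    moreover have "a + 2 + 2 = a + 4" by simp
    ultimately show ?thesis by (simp only:)
  qed
  also have "\<dots> \<le> (d / 3) ^ 4 * ((a + 7/2) / (a + 3/2) * ((a + 4) / (a + 2)))"
  proof (intro mult_mono)
    show "(d / 3)\<^sup>2 \<le> (d / 3) ^ 4" using d by (intro power_increasing) auto
    have "2 / (a + b + 2) \<le> 2 / (a + 3/2)" using a b by (intro divide_left_mono mult_pos_pos) auto
    moreover have "(a + b + 2 + 2) / (a + b + 2) = 1 + 2 / (a + b + 2)" using a b by (simp add: field_simps)
    moreover have "(a + 7/2) / (a + 3/2) = 1 + 2 / (a + 3/2)" using a by (simp add: field_simps)
    ultimately show "(a + b + 2 + 2) / (a + b + 2) \<le> (a + 7/2) / (a + 3/2)" by simp
  qed (use a b in auto)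
  also have "\<dots> = d ^ 4 * ((a + 7/2) * (a + 4) / ((a + 3/2) * (a + 2)) / 81)"
    by (simp add: power_divide)
  also have "\<dots> \<le> d ^ 4 * ?m\<^sup>2"
    by (intro mult_left_mono step_left_estimate a) (use d in simp)
  finally have q: "(a + b + 2 + real N) / (a + b + 2) * ((a + 2 + real N) / (a + 2)) \<le> d ^ 4 * ?m\<^sup>2" .
  show ?thesis
  proof (rule crude_ineq_step[OF a _ b N christoffel_bound_Suc_left[OF a b] _ q[unfolded d_def] _ _ IH])
    \<comment> \<open>\<open>7/16 = 1/2 - 1/16\<close>: if \<open>a\<^sup>2 + a * b\<close> is
      negative, the new value is at least
      \<open>(a + 1) * (a + 1/2) = 2 * a + 7/16 + (a - 1/4)\<^sup>2\<close>.\<close>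
    have l: "max (a\<^sup>2 + a * b) 0 + (2 * a + 7/16) \<le> (a + 1)\<^sup>2 + (a + 1) * b"
    proof (cases "a\<^sup>2 + a * b \<ge> 0")
      case True
      then show ?thesis using b by (simp add: power2_eq_square algebra_simps)
    next
      case False
      have "0 \<le> (a - 1/4) * (a - 1/4)" by simp
      moreover have "(a + 1) * (- (1/2)) \<le> (a + 1) * b" using a b by (intro mult_left_mono) auto
      ultimately show ?thesis using False by (simp add: power2_eq_square field_simps)
    qed
    show "jacobi_m a b * ?m \<le> jacobi_m (a + 1) b"
      using jacobi_m_Suc_ge[OF a b order_refl l] by simp
  qed (use a b in auto)
qed

lemma crude_ineq_step_both:
  assumes a: "a \<ge> 0" and b: "b \<ge> -1/2" and N: "N \<ge> 2" and IH: "crude_ineq a b N"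
  shows "crude_ineq (a + 1) (b + 1) N"
proof -
  define d where "d = real (N + 1)"
  have d: "d \<ge> 3" and Nd: "real N = d - 1" using N by (simp_all add: d_def)
  let ?m = "(a + 3/2) / (a + 5/2) * exp (1/3 + (3 * a + b + 31/16) / 4) / (4 * (a + 1)\<^sup>2)"
  let ?q = "(a + b + 2 + real N) / (a + b + 2) * ((a + b + 3 + real N) / (a + b + 3)) *
      ((a + 2 + real N) / (a + 2)) * ((b + 1) / (b + 1 + real N))"
  have shrink: "(x + 2) / x \<le> (y + 2) / y" if "0 < y" "y \<le> x" for x y :: real
  proof -
    have "2 / x \<le> 2 / y" using that by (intro divide_left_mono mult_pos_pos) auto
    then show ?thesis using that by (simp add: add_divide_distrib)
  qed
  have "?q \<le> (d / 3 * ((a + b + 2 + 2) / (a + b + 2))) * (d / 3 * ((a + b + 3 + 2) / (a + b + 3))) *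
      (d / 3 * ((a + 2 + 2) / (a + 2))) * ((b + 1) / (b + 3))"
  proof -
    have 1: "(b + 1) / (b + 1 + (d - 1)) \<le> (b + 1) / (b + 3)"
      using b d by (intro divide_left_mono mult_pos_pos) auto
    show ?thesis
      using ratio_le[OF d, of "a + b + 2"] ratio_le[OF d, of "a + b + 3"] ratio_le[OF d, of "a + 2"] a b d 1 unfolding Nd
      by (intro mult_mono[OF mult_mono[OF mult_mono]] mult_nonneg_nonneg) (simp_all add: add_diff_eq)
  qed
  also have "\<dots> = (d / 3) ^ 3 * ((a + b + 2 + 2) / (a + b + 2) * ((a + b + 3 + 2) / (a + b + 3)) *
      ((a + 4) / (a + 2)) * ((b + 1) / (b + 3)))"
  proof -
    have "(t * A) * (t * B) * (t * C) * D = t ^ 3 * (A * B * C * D)" for t A B C D :: real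
      by (simp add: power3_eq_cube)
    moreover have "a + 2 + 2 = a + 4" by simp
    ultimately show ?thesis by (simp only:)
  qed
  also have "\<dots> \<le> (d / 3) ^ 4 * ((a + 7/2) / (a + 3/2) * ((a + 9/2) / (a + 5/2)) * ((a + 4) / (a + 2)) * ((b + 1) / (b + 3)))"
  proof (intro mult_mono)
    show "(d / 3) ^ 3 \<le> (d / 3) ^ 4" using d by (intro power_increasing) auto
    show "(a + b + 2 + 2) / (a + b + 2) \<le> (a + 7/2) / (a + 3/2)"
      using shrink[of "a + 3/2" "a + b + 2"] a b by (simp add: add_ac)
    show "(a + b + 3 + 2) / (a + b + 3) \<le> (a + 9/2) / (a + 5/2)"
      using shrink[of "a + 5/2" "a + b + 3"] a b by (simp add: add_ac)
  qed (use a b d in auto)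
  also have "\<dots> = d ^ 4 * ((a + 7/2) * (a + 9/2) * (a + 4) / ((a + 3/2) * (a + 5/2) * (a + 2)) * ((b + 1) / (b + 3)) / 81)"
    by (simp add: power_divide)
  also have "\<dots> \<le> d ^ 4 * ?m\<^sup>2"
    by (intro mult_left_mono step_both_estimate a b) (use d in simp)
  finally have q: "?q \<le> d ^ 4 * ?m\<^sup>2" .
  show ?thesis
  proof (rule crude_ineq_step[OF a _ b N christoffel_bound_Suc_both[OF a b] _ q[unfolded d_def] _ _ IH])
    have l: "max (a\<^sup>2 + a * b) 0 + (3 * a + b + 31/16) \<le> (a + 1)\<^sup>2 + (a + 1) * (b + 1)"
    proof (cases "a\<^sup>2 + a * b \<ge> 0")
      case True
      then show ?thesis by (simp add: power2_eq_square algebra_simps)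
    next
      case False
      have "0 \<le> (a - 1/4) * (a - 1/4)" by simp
      moreover have "a * (- (1/2)) \<le> a * b" using a b by (intro mult_left_mono) auto
      ultimately show ?thesis using False by (simp add: power2_eq_square field_simps)
    qed
    have "b \<le> b + 1" by simp
    from jacobi_m_Suc_ge[OF a b this l] show "jacobi_m a b * ?m \<le> jacobi_m (a + 1) (b + 1)" by simp
  qed (use a b in auto)
qed

text \<open>Induction on the integer part of \<open>a\<close>, down to \<open>a \<le> 1\<close>.
  Above \<open>1/2\<close>, \<open>b\<close> is lowered together with \<open>a\<close>, which
  preserves \<open>b \<le> a\<close>; otherwise it stays and may exceed \<open>a - 1\<close>, hence
  the second alternative in the hypothesis.\<close>

lemma crude_ineq_holds:
  assumes N: "N \<ge> 2"
  shows "2/25 - 1/2 \<le> a \<Longrightarrow> -1/2 \<le> b \<Longrightarrow> b \<le> a \<or> (0 \<le> a \<and> b \<le> 1/2) \<Longrightarrow> crude_ineq a b N"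
proof (induction "nat \<lfloor>a\<rfloor>" arbitrary: a b rule: less_induct)
  case less
  show ?case
  proof (cases "a \<le> 1")
    case True
    then show ?thesis
      unfolding crude_ineq_def using less.prems N by (intro crude_bound) auto
  next
    case False
    then have a: "a - 1 \<ge> 0" and dec: "nat \<lfloor>a - 1\<rfloor> < nat \<lfloor>a\<rfloor>" by linarith+
    show ?thesis
    proof (cases "b \<le> 1/2")
      case True
      have "crude_ineq (a - 1) b N" using less.hyps[OF dec] less.prems a True by auto
      then show ?thesis using crude_ineq_step_left[OF a _ N, of b] less.prems by simp
    next
      case False
      have "crude_ineq (a - 1) (b - 1) N" using less.hyps[OF dec, of "b - 1"] less.prems a False by auto
      then show ?thesis using crude_ineq_step_both[OF a _ N, of "b - 1"] less.prems False by simp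
    qed
  qed
qed

text \<open>Near the Chebyshev case, with \<open>\<kappa>\<close> standing for
  \<open>exp (13/22 * e)\<close> and \<open>w\<close> for \<open>4 powr (- e)\<close>. As a
  polynomial in \<open>d\<close> the left-hand side has a quadratic coefficient that is
  \<open>5/4\<close> at \<open>e = 0\<close>, where \<open>\<kappa> = w = 1\<close>; its linear and
  constant coefficients are not positive.\<close>

lemma corner_lhs_le:
  fixes \<kappa> w e :: real
  assumes e: "0 \<le> e" "e \<le> 2/25" and k: "1 \<le> \<kappa>" "\<kappa> \<le> 1 + 62/100 * e"
    and w: "1 - 1389/1000 * e \<le> w" "w \<le> 1" "\<kappa> * w \<le> 1" and d: "d \<ge> 1"
    and r: "r = (3/4 * d - 1/2) * w"
  shows "(2 * d - 1) * \<kappa> * (d - r + 1/3) + d * r - d \<le> d\<^sup>2 * (5/4 + 146/100 * e)"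
proof -
  define \<rho> where "\<rho> = 3/4 * w"
  have id: "(2 * d - 1) * \<kappa> * (d - r + 1/3) + d * r - d =
      d\<^sup>2 * (2 * \<kappa> * (1 - \<rho>) + \<rho>) + d * (7/3 * (\<kappa> * \<rho>) - \<kappa> / 3 - 2/3 * \<rho> - 1) - \<kappa> * (2/3 * \<rho> + 1/3)"
    unfolding r \<rho>_def by (simp add: power2_eq_square field_simps)
  have kr: "\<kappa> * \<rho> \<le> 3/4" using w(3) by (simp add: \<rho>_def)
  have r1: "\<rho> \<ge> 66/100" using w(1) e by (simp add: \<rho>_def)
  have lin: "d * (7/3 * (\<kappa> * \<rho>) - \<kappa> / 3 - 2/3 * \<rho> - 1) \<le> 0"
  proof (rule mult_nonneg_nonpos)
    show "7/3 * (\<kappa> * \<rho>) - \<kappa> / 3 - 2/3 * \<rho> - 1 \<le> 0" using kr r1 k(1) by linarith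
  qed (use d in simp)
  have const: "0 \<le> \<kappa> * (2/3 * \<rho> + 1/3)" using k r1 by simp
  have quad: "2 * \<kappa> * (1 - \<rho>) + \<rho> \<le> 5/4 + 146/100 * e"
  proof -
    have r2: "1 - \<rho> \<le> 1/4 + 105/100 * e" using w(1) e by (simp add: \<rho>_def)
    have "(2 * \<kappa> - 1) * (1 - \<rho>) \<le> (1 + 124/100 * e) * (1/4 + 10418/10000 * e)"
      using w k e by (intro mult_mono) (auto simp: \<rho>_def)
    also have "\<dots> = 1/4 + 13518/10000 * e + (124/100 * 10418/10000) * (e * e)" by (simp add: field_simps)
    also have "e * e \<le> 2/25 * e" using e by (intro mult_right_mono) auto
    finally have "(2 * \<kappa> - 1) * (1 - \<rho>) \<le> 1/4 + 146/100 * e" using e by simp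
    moreover have "2 * \<kappa> * (1 - \<rho>) + \<rho> = (2 * \<kappa> - 1) * (1 - \<rho>) + 1" by (simp add: algebra_simps)
    ultimately show ?thesis by linarith
  qed
  have "d\<^sup>2 * (2 * \<kappa> * (1 - \<rho>) + \<rho>) \<le> d\<^sup>2 * (5/4 + 146/100 * e)" by (intro mult_left_mono quad) auto
  then show ?thesis unfolding id using lin const by linarith
qed

text \<open>At \<open>e = f = 0\<close> the right-hand side exceeds \<open>1301/1000\<close>, and
  this slack over \<open>5/4\<close> must survive for small parameters. In \<open>g = e + f\<close>
  and \<open>h = e - f\<close>, the growth of the square root, \<open>sqrt g \<ge> 5/2 * g\<close>
  because \<open>g \<le> 4/25\<close>, outweighs the decay of the exponential in \<open>g\<close>,
  and the exponential grows in \<open>h\<close>.\<close>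

lemma jacobi_m_sq_ge_corner:
  fixes e f :: real
  assumes f: "0 \<le> f" "f \<le> e" and e: "e \<le> 2/25"
  shows "5/4 + 146/100 * e \<le> 2519/1000 * (jacobi_m (e - 1/2) (f - 1/2))\<^sup>2"
proof -
  define g h where "g = e + f" and "h = e - f"
  have g: "0 \<le> g" "g \<le> 16/100" and h: "0 \<le> h" and eg: "e = (g + h) / 2"
    using assms by (auto simp: g_def h_def)
  have e0: "0 \<le> e" using f by simp
  \<comment> \<open>The coefficients are \<open>101/100 = 2 * (113/100) - 1 - 1/4\<close> and
    \<open>8195/10000 = 6945/10000 + 1/8\<close>, from the bounds on \<open>ln pi\<close> and
    \<open>ln 2\<close>.\<close>
  define l where "l = 1/8 + 101/100 * e - 8195/10000 * g"
  define q where "q = (1 + sqrt g / 4) * (2 / pi) * exp l"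
  have q0: "q \<ge> 0" using g by (simp add: q_def)
  have sg: "25/10 * g \<le> sqrt g"
  proof (rule real_le_rsqrt)
    have "(25/10 * g)\<^sup>2 = (625/100 * g) * g" by (simp add: power2_eq_square)
    also have "\<dots> \<le> 1 * g" using g by (intro mult_right_mono) auto
    finally show "(25/10 * g)\<^sup>2 \<le> g" by simp
  qed
  have "q \<le> exp (ln (1 + sqrt g / 4) - e + (1/8 - e / 4 - g / 8) - (e + f - 1) * ln 2 - (1 - 2 * e) * ln pi)"
  proof -
    have "e * (113/100) \<le> e * ln pi" "g * ln 2 \<le> g * (6945/10000)"
      by (rule mult_left_mono[OF ln_pi_bounds(1) e0], rule mult_left_mono[OF ln_numerals(2) g(1)])
    then have "ln (1 + sqrt g / 4) + (ln 2 - ln pi) + l \<le>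
        ln (1 + sqrt g / 4) - e + (1/8 - e / 4 - g / 8) - (g * ln 2 - ln 2) - (ln pi - 2 * (e * ln pi))"
      by (simp add: l_def)
    also have "\<dots> = ln (1 + sqrt g / 4) - e + (1/8 - e / 4 - g / 8) - (e + f - 1) * ln 2 - (1 - 2 * e) * ln pi"
      by (simp add: g_def algebra_simps)
    finally have "exp (ln (1 + sqrt g / 4) + (ln 2 - ln pi) + l) \<le> exp \<dots>" by simp
    moreover have "0 < 1 + sqrt g / 4" using g by (simp add: add_pos_nonneg)
    then have "q = exp (ln (1 + sqrt g / 4) + (ln 2 - ln pi) + l)"
      by (simp add: q_def exp_add exp_diff)
    ultimately show ?thesis by simp
  qed
  also have "\<dots> \<le> jacobi_m (e - 1/2) (f - 1/2)"
  proof (rule jacobi_m_ge[OF e0 f(1)])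
    show "exp (ln (1 + sqrt g / 4)) \<le> 1 + sqrt (e + f) / 4"
      using g by (simp add: g_def add_pos_nonneg)
    show "ln (1 + e) \<le> e" using e0 by (intro ln_add_one_self_le_self) auto
    show "(Gamma (e + 1/2))\<^sup>2 \<le> exp ((1 - 2 * e) * ln pi)" using e e0 by (intro Gamma_le_powr_pi) auto
    have "(e - 1/2) * (e + f - 1) = 1/2 - g / 2 - e + e * g" by (simp add: g_def field_simps)
    moreover have "0 \<le> e * g" using e0 g by simp
    ultimately have "1/2 - g / 2 - e \<le> max ((e - 1/2) * (e + f - 1)) 0" by linarith
    moreover have "0 \<le> max (e - 1/2) 0" by simp
    moreover have "1/8 - e / 4 - g / 8 \<le> x / 3 + y / 4" if "1/2 - g / 2 - e \<le> y" "0 \<le> x" for x y :: real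
      using that by linarith
    ultimately show "1/8 - e / 4 - g / 8 \<le> max (e - 1/2) 0 / 3 + max ((e - 1/2) * (e + f - 1)) 0 / 4"
      by blast
  qed
  finally have qj: "q \<le> jacobi_m (e - 1/2) (f - 1/2)" .
  have P: "5/4 + 73/100 * g \<le> 1301/1000 * ((1 + 125/100 * g) * (1 - 629/1000 * g))"
      "1 \<le> (1 + 125/100 * g) * (1 - 629/1000 * g)"
  proof -
    have "g * g \<le> 16/100 * g" using g by (intro mult_right_mono) auto
    moreover have "(1 + 125/100 * g) * (1 - 629/1000 * g) = 1 + 621/1000 * g - 78625/100000 * (g * g)"
      by (simp add: field_simps)
    ultimately show "1 \<le> (1 + 125/100 * g) * (1 - 629/1000 * g)"
      "5/4 + 73/100 * g \<le> 1301/1000 * ((1 + 125/100 * g) * (1 - 629/1000 * g))" using g by linarith+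
  qed
  define y where "y = (1 + 125/100 * g) * (1 - 629/1000 * g)"
  have yh: "1 * h \<le> y * h" using P(2) h unfolding y_def by (intro mult_right_mono) auto
  have "5/4 + 146/100 * e = 5/4 + 73/100 * g + 73/100 * h" by (simp add: eg)
  also have "\<dots> \<le> 1301/1000 * y + (1301/1000 * 101/100) * (y * h)"
    using P(1) yh h unfolding y_def[symmetric] by linarith
  also have "\<dots> = 1301/1000 * ((1 + 125/100 * g) * ((1 - 629/1000 * g) * (1 + 101/100 * h)))"
    by (simp add: y_def field_simps)
  also have "\<dots> \<le> 1301/1000 * ((1 + sqrt g / 4)\<^sup>2 * exp (- 629/1000 * g + 101/100 * h))"
  proof (intro mult_left_mono mult_mono)
    have "(1 + sqrt g / 4)\<^sup>2 = 1 + sqrt g / 2 + g / 16" using g by (simp add: power2_sum power_divide)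
    then show "1 + 125/100 * g \<le> (1 + sqrt g / 4)\<^sup>2" using sg g by simp
    have "(1 - 629/1000 * g) * (1 + 101/100 * h) \<le> exp (- 629/1000 * g) * exp (101/100 * h)"
      using exp_ge_add_one_self[of "- 629/1000 * g"] exp_ge_add_one_self[of "101/100 * h"] g h
      by (intro mult_mono) auto
    then show "(1 - 629/1000 * g) * (1 + 101/100 * h) \<le> exp (- 629/1000 * g + 101/100 * h)"
      by (simp only: exp_add)
  qed (use g h in auto)
  also have "\<dots> \<le> 2519/1000 * (4 / pi\<^sup>2) * exp (1/4) * ((1 + sqrt g / 4)\<^sup>2 * exp (- 629/1000 * g + 101/100 * h))"
  proof (rule mult_right_mono)
    have "pi\<^sup>2 \<le> (315/100)\<^sup>2" using pi_bounds(2) by (intro power_mono) auto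
    then have "4 / (315/100)\<^sup>2 \<le> 4 / pi\<^sup>2" by (intro divide_left_mono) auto
    moreover have "1 + 1/4 + (1/4)\<^sup>2 / 2 \<le> exp (1/4 :: real)" by (intro exp_lower_Taylor_quadratic) simp
    ultimately have "2519/1000 * (4 / (315/100)\<^sup>2) * (1 + 1/4 + (1/4)\<^sup>2 / 2) \<le> 2519/1000 * (4 / pi\<^sup>2) * exp (1/4 :: real)"
      by (intro mult_mono) auto
    moreover have "1301/1000 \<le> 2519/1000 * (4 / (315/100)\<^sup>2) * (1 + 1/4 + (1/4)\<^sup>2 / (2::real))"
      by (simp add: power2_eq_square)
    ultimately show "1301/1000 \<le> 2519/1000 * (4 / pi\<^sup>2) * exp (1/4 :: real)" by linarith
  qed simp
  also have "\<dots> = 2519/1000 * q\<^sup>2"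
  proof -
    have "(exp l)\<^sup>2 = exp (2 * l)" by (simp add: power2_eq_square flip: exp_add)
    also have "2 * l = 1/4 + (- 629/1000 * g + 101/100 * h)" by (simp add: l_def eg field_simps)
    finally have "(exp l)\<^sup>2 = exp (1/4) * exp (- 629/1000 * g + 101/100 * h)" by (simp only: exp_add)
    then have "q\<^sup>2 = (1 + sqrt g / 4)\<^sup>2 * (4 / pi\<^sup>2) * (exp (1/4) * exp (- 629/1000 * g + 101/100 * h))"
      by (simp only: q_def power_mult_distrib) (simp add: power_divide)
    moreover have "c * p * x * (t * z) = c * (t * p * (x * z))" for c p x t z :: real by (simp add: mult_ac)
    ultimately show ?thesis by (simp only:)
  qed
  also have "\<dots> \<le> 2519/1000 * (jacobi_m (e - 1/2) (f - 1/2))\<^sup>2"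
    using qj q0 by (intro mult_left_mono power_mono) auto
  finally show ?thesis .
qed

text \<open>With \<open>D = d powr (2 * e)\<close>, the bound on the Christoffel function carries
  one factor \<open>D\<close>, the right-hand side two. As \<open>D \<ge> 1\<close> and
  \<open>r \<ge> 1\<close>, the nonnegative remainder \<open>d * r - d\<close> may be multiplied by
  \<open>D\<close> too, which leaves the quadratic estimate of \<open>corner_lhs_le\<close>.\<close>

lemma corner_ineq:
  fixes a b :: real
  assumes N: "N \<ge> 2" and b: "-1/2 \<le> b" "b \<le> a" and a: "a \<le> 2/25 - 1/2"
    and r: "r = (3/4 * real (N + 1) - 1/2) / 4 powr (a + 1/2)"
  shows "r < real (N + 1)"
    "christoffel_bound a b N * (real (N + 1) - r + 1/3) + real (N + 1) * r - real (N + 1) \<le>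
       2519/1000 * (jacobi_m a b * real (N + 1) powr (2 * a + 2))\<^sup>2"
proof -
  define e f where "e = a + 1/2" and "f = b + 1/2"
  have ef: "0 \<le> f" "f \<le> e" "0 \<le> e" "e \<le> 2/25" "a = e - 1/2" "b = f - 1/2"
    using assms by (auto simp: e_def f_def)
  define d where "d = real (N + 1)"
  have d: "d \<ge> 3" and N1: "real (2 * N + 1) = 2 * d - 1" using N by (simp_all add: d_def)
  define \<kappa> where "\<kappa> = exp (13/22 * e)"
  define w where "w = exp (- (2 * e * ln 2))"
  define D where "D = d powr (2 * e)"
  have D: "1 \<le> D" using d ef by (simp add: D_def ge_one_powr_ge_zero)
  have rw: "r = (3/4 * d - 1/2) * w"
  proof -
    have "ln 4 = 2 * ln (2::real)" using ln_realpow[of 2 2] by simp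
    then have "4 powr e = exp (2 * e * ln 2)" by (simp add: powr_def)
    then show ?thesis by (simp add: r d_def w_def e_def exp_minus field_simps)
  qed
  have eln: "138/100 * e \<le> 2 * e * ln 2" "2 * e * ln 2 \<le> 1389/1000 * e"
  proof -
    have "e * (69/100) \<le> e * ln 2" "e * ln 2 \<le> e * (6945/10000)"
      by (rule mult_left_mono[OF ln_numerals(1) ef(3)], rule mult_left_mono[OF ln_numerals(2) ef(3)])
    then show "138/100 * e \<le> 2 * e * ln 2" "2 * e * ln 2 \<le> 1389/1000 * e" by simp_all
  qed
  have k: "1 \<le> \<kappa>" "\<kappa> \<le> 1 + 62/100 * e"
  proof -
    show "1 \<le> \<kappa>" using ef by (simp add: \<kappa>_def)
    have "\<kappa> \<le> 1 + 13/22 * e + (13/22 * e)\<^sup>2" unfolding \<kappa>_def using ef by (intro exp_bound) auto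
    also have "(13/22 * e)\<^sup>2 = 169/484 * (e * e)" by (simp add: power2_eq_square)
    also have "e * e \<le> 2/25 * e" using ef by (intro mult_right_mono) auto
    finally show "\<kappa> \<le> 1 + 62/100 * e" using ef by simp
  qed
  have w: "1 - 1389/1000 * e \<le> w" "w \<le> 1" "\<kappa> * w \<le> 1"
  proof -
    show "1 - 1389/1000 * e \<le> w"
      using exp_ge_add_one_self[of "- (2 * e * ln 2)"] eln(2) by (simp add: w_def)
    show "w \<le> 1" using ef by (simp add: w_def)
    have "\<kappa> * w = exp (13/22 * e - 2 * e * ln 2)" by (simp add: \<kappa>_def w_def flip: exp_add)
    also have "\<dots> \<le> 1" using eln(1) ef by simp
    finally show "\<kappa> * w \<le> 1" .
  qed
  have r1: "1 \<le> r"
  proof -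
    have "1 \<le> (7/4) * (888/1000 :: real)" by simp
    also have "\<dots> \<le> r" unfolding rw using d w(1) ef by (intro mult_mono) auto
    finally show ?thesis .
  qed
  have r2: "r \<le> 3/4 * d"
  proof -
    have "r \<le> (3/4 * d - 1/2) * 1" unfolding rw using d w by (intro mult_left_mono) auto
    then show ?thesis by simp
  qed
  then have "r < d" using d by linarith
  then show "r < real (N + 1)" by (simp only: d_def)
  have dr: "0 \<le> d * r - d"
  proof -
    have "d * 1 \<le> d * r" using d r1 by (intro mult_left_mono) auto
    then show ?thesis by simp
  qed
  have "christoffel_bound a b N * (d - r + 1/3) \<le> ((2 * d - 1) * (D * \<kappa>)) * (d - r + 1/3)"
    using christoffel_bound_le[OF ef(3,1), of N] N r2 d
    by (intro mult_right_mono) (auto simp: ef N1 D_def \<kappa>_def d_def)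
  moreover have "1 * (d * r - d) \<le> D * (d * r - d)" using D dr by (intro mult_right_mono)
  moreover have "((2 * d - 1) * (D * \<kappa>)) * (d - r + 1/3) + D * (d * r - d) =
      D * ((2 * d - 1) * \<kappa> * (d - r + 1/3) + d * r - d)" by (simp add: algebra_simps)
  moreover have "A + x \<le> W" if "A \<le> B" "1 * x \<le> y" "B + y = W" for A B x y W :: real
    using that by linarith
  ultimately have "christoffel_bound a b N * (d - r + 1/3) + (d * r - d) \<le>
      D * ((2 * d - 1) * \<kappa> * (d - r + 1/3) + d * r - d)" by blast
  then have "christoffel_bound a b N * (d - r + 1/3) + d * r - d \<le>
      D * ((2 * d - 1) * \<kappa> * (d - r + 1/3) + d * r - d)" by (simp only: add_diff_eq)
  also have "\<dots> \<le> D * (d\<^sup>2 * (5/4 + 146/100 * e))"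
    using corner_lhs_le[OF ef(3,4) k w _ rw] d D by (intro mult_left_mono) auto
  also have "\<dots> \<le> D * (d\<^sup>2 * (2519/1000 * (jacobi_m a b)\<^sup>2))"
    using jacobi_m_sq_ge_corner[OF ef(1,2,4)] D unfolding ef(5,6) by (intro mult_left_mono) auto
  also have "\<dots> \<le> D\<^sup>2 * (d\<^sup>2 * (2519/1000 * (jacobi_m a b)\<^sup>2))"
    using D by (intro mult_right_mono) (auto simp: power2_eq_square)
  also have "\<dots> = 2519/1000 * (jacobi_m a b * (D * d))\<^sup>2"
    by (simp add: power_mult_distrib mult_ac)
  also have "D * d = d powr (2 * a + 2)"
  proof -
    have "2 * a + 2 = 2 * e + 1" by (simp add: e_def)
    then show ?thesis using d by (simp only: powr_add D_def) simp
  qed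
  finally show "christoffel_bound a b N * (real (N + 1) - r + 1/3) + real (N + 1) * r - real (N + 1) \<le>
      2519/1000 * (jacobi_m a b * real (N + 1) powr (2 * a + 2))\<^sup>2"
    by (simp only: d_def)
qed

section \<open>Choice of the minorant, and the probability bound\<close>

lemma exists_christoffel_minorant:
  assumes ab: "a \<ge> -1/2" "b \<ge> -1/2" and N: "N \<ge> 2"
  defines "R \<equiv> christoffel_bound (max a b) (min a b) N" and "d \<equiv> real (N + 1)"
  obtains r where "\<And>x. x \<in> {-1..1} \<Longrightarrow> r \<le> christoffel_sum a b N x" "r < d"
    "(R - d) * (d - r) + d\<^sup>2 - d + R / 3 \<le> 2519/1000 * (jacobi_m_sq a b * d powr (2 * max a b + 2))\<^sup>2"
proof -
  \<comment> \<open>At \<open>r = 1\<close> this is the left-hand side of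
    \<open>crude_ineq\<close>.\<close>
  have id: "(R - d) * (d - r) + d\<^sup>2 - d + R / 3 = R * (d - r + 1/3) + d * r - d" for r
    by (simp add: power2_eq_square algebra_simps)
  show thesis
  proof (cases "2/25 - 1/2 \<le> max a b")
    case True
    have "crude_ineq (max a b) (min a b) N"
      by (rule crude_ineq_holds[OF N True]) (use ab in auto)
    then have "R * (d - 1 + 1/3) + d * 1 - d \<le> 2519/1000 * (jacobi_m_sq a b * d powr (2 * max a b + 2))\<^sup>2"
      by (simp add: crude_ineq_def jacobi_m_sq_eq R_def d_def)
    then show thesis
      by (intro that[of 1] christoffel_sum_ge_1[OF ab]) (use N in \<open>simp_all only: id, simp_all add: d_def\<close>)
  next
    case False
    have m: "-1/2 \<le> min a b" "min a b \<le> max a b" "max a b \<le> 2/25 - 1/2" using ab False by auto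
    define r where "r = (3/4 * d - 1/2) / 4 powr (max a b + 1/2)"
    note c = corner_ineq[OF N m r_def[unfolded d_def]]
    show thesis
    proof (rule that)
      show "r \<le> christoffel_sum a b N x" if "x \<in> {-1..1}" for x
        using christoffel_sum_ge[OF N that ab] by (simp only: r_def d_def)
      show "r < d" using c(1) by (simp only: d_def)
      show "(R - d) * (d - r) + d\<^sup>2 - d + R / 3 \<le> 2519/1000 * (jacobi_m_sq a b * d powr (2 * max a b + 2))\<^sup>2"
        unfolding id using c(2) by (simp only: jacobi_m_sq_eq R_def d_def)
    qed
  qed
qed

text \<open>The last assumption keeps the denominator positive: otherwise the quotient, with value 0
  for division by 0, would not be positive, whereas a condition number always is, and the event
  would be empty.\<close>

theorem theorem3:
  fixes M :: "'a measure" and X :: "nat \<Rightarrow> 'a \<Rightarrow> real"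
    and \<alpha> \<beta> \<mu> \<delta> :: real and n N :: nat
  assumes "prob_space M"
    and "\<alpha> \<ge> -1/2" and "\<beta> \<ge> -1/2" and "\<mu> = max \<alpha> \<beta>"
    and "n > N" and "N \<ge> 2"
    and "0.63 * real n > jacobi_m_sq \<alpha> \<beta> * real (N + 1) powr (2 * \<mu> + 2) * ln (real (N + 1))"
    and "prob_space.indep_vars M (\<lambda>_. borel) X {1..n}"
    and "\<And>j. j \<in> {1..n} \<Longrightarrow> distributed M lborel (X j) (\<lambda>x. ennreal (beta_density \<alpha> \<beta> x))"
    and "0 < \<delta>" and "\<delta> < 1"
    and "0.63 - jacobi_m_sq \<alpha> \<beta> * real (N + 1) powr (2 * \<mu> + 2) *
           (ln (real (N + 1)) / real n + sqrt (2 / real n * ln (2 / \<delta>))) > 0"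
  shows "measure M {\<omega> \<in> space M. cond2 (jacobi_gram \<alpha> \<beta> N n (\<lambda>j. X j \<omega>)) \<le>
           ereal ((1.72 + jacobi_m_sq \<alpha> \<beta> * real (N + 1) powr (2 * \<mu> + 2) *
                    (ln (real (N + 1)) / real n + sqrt (2 / real n * ln (2 / \<delta>)))) /
                  (0.63 - jacobi_m_sq \<alpha> \<beta> * real (N + 1) powr (2 * \<mu> + 2) *
                    (ln (real (N + 1)) / real n + sqrt (2 / real n * ln (2 / \<delta>)))))}
         \<ge> (1 - \<delta>)\<^sup>2"
proof -
  interpret prob_space M by (rule assms(1))
  note ab = assms(2,3) and \<mu> = assms(4) and N = assms(6)
  define d where "d = real (N + 1)"
  define s where "s = jacobi_m_sq \<alpha> \<beta> * d powr (2 * \<mu> + 2)"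
  define L where "L = ln (2 / \<delta>)"
  \<comment> \<open>\<open>u\<close> is the square-root part of \<open>t\<close>. It satisfies
    \<open>n * u\<^sup>2 = 2 * s\<^sup>2 * L\<close>, the quantity with which the Bernstein exponent
    is compared.\<close>
  define u where "u = s * sqrt (2 / real n * L)"
  define t where "t = s * (ln d / real n + sqrt (2 / real n * L))"
  define \<epsilon> where "\<epsilon> = t / (63/100)"
  define R where "R = christoffel_bound (max \<alpha> \<beta>) (min \<alpha> \<beta>) N"
  have n: "n > 0" and d: "d \<ge> 3" using assms(5) N by (simp_all add: d_def)
  have L: "0 < L" "exp (- L) = \<delta> / 2" using assms(10,11) by (simp_all add: L_def exp_minus)
  have s0: "0 \<le> s" using ab by (simp add: s_def jacobi_m_sq_eq jacobi_m_nonneg)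
  have u0: "0 \<le> u" using s0 L by (simp add: u_def)
  have ut: "u \<le> t" using s0 d by (simp add: u_def t_def mult_left_mono)
  have t1: "t < 63/100" using assms(12) by (simp add: t_def s_def d_def L_def)
  have \<epsilon>: "0 \<le> \<epsilon>" "\<epsilon> < 1" using u0 ut t1 by (simp_all add: \<epsilon>_def)
  have R: "christoffel_sum \<alpha> \<beta> N x \<le> R" if "x \<in> {-1..1}" for x
    unfolding R_def by (rule christoffel_sum_le[OF ab that])
  have dR: "d \<le> R" unfolding d_def by (rule le_christoffel_bound[OF ab R])
  obtain r where r: "\<And>x. x \<in> {-1..1} \<Longrightarrow> r \<le> christoffel_sum \<alpha> \<beta> N x" "r < d"
    "(R - d) * (d - r) + d\<^sup>2 - d + R / 3 \<le> 2519/1000 * s\<^sup>2"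
    using exists_christoffel_minorant[OF ab N] unfolding R_def s_def d_def \<mu> by metis
  define \<sigma>2 where "\<sigma>2 = (R - d) * (d - r) + d\<^sup>2 - d"
  have \<sigma>2: "\<sigma>2 > 0"
  proof -
    have "0 \<le> (R - d) * (d - r)" using dR r(2) by simp
    moreover have "0 < d * (d - 1)" using d by simp
    moreover have "d * (d - 1) = d\<^sup>2 - d" by (simp add: power2_eq_square algebra_simps)
    ultimately show ?thesis unfolding \<sigma>2_def by linarith
  qed
  have R\<epsilon>: "0 \<le> R * \<epsilon>" "R * \<epsilon> \<le> R" using dR d \<epsilon> by (simp_all add: mult_left_le)
  \<comment> \<open>The exponent of the tail is at least \<open>L\<close>, so the failure
    probability is at most \<open>2 * exp (- L) = \<delta>\<close>. The numbers fit as
    \<open>2519/1000 \<le> (100/63)\<^sup>2\<close>.\<close>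
  have key: "L * (2 * (\<sigma>2 + R * \<epsilon> / 3)) \<le> real n * \<epsilon>\<^sup>2"
  proof -
    have "L * (2 * (\<sigma>2 + R * \<epsilon> / 3)) \<le> L * (2 * (2519/1000 * s\<^sup>2))"
      using L(1) r(3) R\<epsilon> unfolding \<sigma>2_def[symmetric] by (intro mult_left_mono) auto
    also have "\<dots> = 2519/1000 * (2 * (s\<^sup>2 * L))" by simp
    also have "2 * (s\<^sup>2 * L) = real n * u\<^sup>2"
      using n L(1) by (simp add: u_def power_mult_distrib)
    also have "2519/1000 * (real n * u\<^sup>2) \<le> (100/63)\<^sup>2 * (real n * t\<^sup>2)"
      using u0 ut by (intro mult_mono power_mono) (auto simp: power2_eq_square)
    also have "\<dots> = real n * \<epsilon>\<^sup>2" by (simp add: \<epsilon>_def power_divide power_mult_distrib)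
    finally show ?thesis .
  qed
  have "(1 - \<delta>)\<^sup>2 \<le> 1 - \<delta>"
    using assms(10,11) mult_right_mono[of "1 - \<delta>" 1 "1 - \<delta>"] by (simp add: power2_eq_square)
  also have "\<delta> \<ge> 2 * exp (- real n * \<epsilon>\<^sup>2 / (2 * (\<sigma>2 + R * \<epsilon> / 3)))"
  proof -
    have "L \<le> real n * \<epsilon>\<^sup>2 / (2 * (\<sigma>2 + R * \<epsilon> / 3))"
      using key \<sigma>2 R\<epsilon> by (subst pos_le_divide_eq) auto
    then have "exp (- real n * \<epsilon>\<^sup>2 / (2 * (\<sigma>2 + R * \<epsilon> / 3))) \<le> exp (- L)" by simp
    then show ?thesis using L(2) by simp
  qed
  then have "1 - \<delta> \<le> 1 - 2 * exp (- real n * \<epsilon>\<^sup>2 / (2 * (\<sigma>2 + R * \<epsilon> / 3)))" by simp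
  also have "\<dots> \<le> prob {\<omega> \<in> space M. cond2 (jacobi_gram \<alpha> \<beta> N n (\<lambda>j. X j \<omega>)) \<le> ereal ((1 + \<epsilon>) / (1 - \<epsilon>))}"
    by (rule cond2_jacobi_gram_tail[OF ab n R r(1) assms(8,9) \<epsilon> _ \<sigma>2]) (simp_all add: \<sigma>2_def d_def)
  also have "\<dots> \<le> prob {\<omega> \<in> space M. cond2 (jacobi_gram \<alpha> \<beta> N n (\<lambda>j. X j \<omega>)) \<le> ereal ((1.72 + t) / (0.63 - t))}"
  proof (rule finite_measure_mono)
    have "X j \<in> borel_measurable M" if "j \<in> {1..n}" for j
      using assms(8) that by (auto simp: indep_vars_def)
    then show "{\<omega> \<in> space M. cond2 (jacobi_gram \<alpha> \<beta> N n (\<lambda>j. X j \<omega>)) \<le> ereal ((1.72 + t) / (0.63 - t))} \<in> sets M"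
      by (rule sets_cond2_jacobi_gram_le)
    have "(1 + \<epsilon>) / (1 - \<epsilon>) = (63/100 + t) / (63/100 - t)"
      using t1 by (simp add: \<epsilon>_def divide_simps) (simp add: algebra_simps)
    \<comment> \<open>Only here is the constant in the numerator relaxed from \<open>0.63\<close> to
      \<open>1.72\<close>.\<close>
    also have "\<dots> \<le> (1.72 + t) / (0.63 - t)" using t1 by (simp add: divide_right_mono)
    finally show "{\<omega> \<in> space M. cond2 (jacobi_gram \<alpha> \<beta> N n (\<lambda>j. X j \<omega>)) \<le> ereal ((1 + \<epsilon>) / (1 - \<epsilon>))} \<subseteq>
        {\<omega> \<in> space M. cond2 (jacobi_gram \<alpha> \<beta> N n (\<lambda>j. X j \<omega>)) \<le> ereal ((1.72 + t) / (0.63 - t))}"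
      by (auto intro: order_trans)
  qed
  finally show ?thesis unfolding t_def s_def d_def L_def .
qed

end
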